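(* Let $T=(\pi,\lambda)$ be a hyperbolically self-similar IET of $d\ge2$ intervals on $[0,1)$ and let $M$ be its positive self-similarity matrix. Let $f\in\operatorname{Aff}(T,\omega)$, where $\omega$ is of central-stable type, and let $h$ be the conjugacy of $f$ and $T$ ($h\circ f=T\circ h$). Then $$\mathfrak H(h)=\frac{\rho_T}{\zeta^f}\qquad\text{and}\qquad 0<\frac{\rho_T}{\zeta^f}<\dim_H(\mu_f),$$ where $\rho_T$ is the logarithm of the Perron–Frobenius eigenvalue of $M$, $\zeta^f$ is defined in the context, and $\mu_f$ is the unique invariant probability measure of $f$.
   Context: **AIETs.** Let $\mathcal A$ be a finite alphabet with $d\ge 2$ letters. A permutation is a pair $\pi=(\pi_t,\pi_b)$ of bijections $\mathcal A\to\{1,\dots,d\}$, always assumed irreducible: $\pi_t^{-1}\{1,\dots,k\}\ne\pi_b^{-1}\{1,\dots,k\}$ for $1\le k<d$. An affine interval exchange transformation (AIET) $f=(\pi,\lambda,\omega)$, with $\lambda\in\mathbb R_{>0}^{\mathcal A}$ and log-slope vector $\omega\in\mathbb R^{\mathcal A}$, is a bijection of $I=[0,\sum_\alpha\lambda_\alpha)$ which maps each interval of the partition of $I$ into left-closed right-open intervals $I_\alpha=I_\alpha(f)$ of lengths $\lambda_\alpha$ (ordered from left to right according to $\pi_t$) affinely with slope $e^{\omega_\alpha}$, the images $f(I_\alpha)$ being ordered from left to right according to $\pi_b$. An IET $T=(\pi,\lambda)$ is an AIET with $\omega=0$. **Rauzy–Veech induction.** Put $\alpha(\varepsilon)=\pi_\varepsilon^{-1}(d)$,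 $\varepsilon\in\{t,b\}$. If $|I_{\alpha(t)}|>|f(I_{\alpha(b)})|$ (top type, winner $\alpha(t)$), set $I^{(1)}=I\setminus f(I_{\alpha(b)})$, $I^{(1)}_{\alpha(t)}=I_{\alpha(t)}\setminus f(I_{\alpha(b)})$ and $I^{(1)}_\alpha=I_\alpha$ for the other letters. If $|I_{\alpha(t)}|<|f(I_{\alpha(b)})|$ (bottom type, winner $\alpha(b)$), set $I^{(1)}=I\setminus I_{\alpha(t)}$, $I^{(1)}_{\alpha(t)}=f^{-1}(I_{\alpha(t)})$, $I^{(1)}_{\alpha(b)}=I_{\alpha(b)}\setminus f^{-1}(I_{\alpha(t)})$ and $I^{(1)}_\alpha=I_\alpha$ for the other letters. The first return map of $f$ to $I^{(1)}$ is an AIET exchanging the $I^{(1)}_\alpha$. If this can be iterated forever (no equality of lengths occurs), $f$ is infinitely renormalizable; one gets intervals $I^{(n)}$, $I^{(n)}_\alpha=I^{(n)}_\alpha(f)$, permutations $\pi^{(n)}$ and return times $q^{(n)}_\alpha$ such that the first return map of $f$ to $I^{(n)}$ equals $f^{q^{(n)}_\alpha}$ on $I^{(n)}_\alpha$. The combinatorial rotation number $\gamma(f)$ is the infinite sequence of pairs ($\pi^{(n)}$, type of step $n$), $n\ge0$; it is $\infty$-complete if every letter is a winner infinitely often. **Hyperbolic self-similarity.** An IET $T=(\pi,\lambda)$ on $[0,1)$ is self-similar if $\gamma(T)$ is $\infty$-complete and periodic. For a period $N$, the self-similarity matrix is $M=M(T)$, $M_{\alpha\beta}=\#\{0\le k<q^{(N)}_\alpha: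 T^kI^{(N)}_\alpha\subset I_\beta\}$; then $\lambda M=e^{\rho_T}\lambda$. Let $\Omega_\pi$ be the matrix with $(\Omega_\pi)_{\alpha\beta}=1$ if $\pi_b(\alpha)>\pi_b(\beta),\pi_t(\alpha)<\pi_t(\beta)$; $-1$ if $\pi_b(\alpha)<\pi_b(\beta),\pi_t(\alpha)>\pi_t(\beta)$; $0$ otherwise; put $\kappa-1=\dim\ker\Omega_\pi$ and $2g=d-(\kappa-1)$. $T$ is hyperbolically self-similar if it is self-similar and $M$ has $g$ simple real eigenvalues of modulus $>1$ and $g$ simple real eigenvalues of modulus $<1$, all with pairwise distinct moduli, and eigenvalue $1$ with $\kappa-1$ independent fixed vectors; so $\mathbb R^{\mathcal A}$ has a basis of right eigenvectors of $M$: $g$ expanding, $g$ contracting, $\kappa-1$ fixed. Convention: $N$ is replaced by a multiple so that all entries and all eigenvalues of $M$ are positive. **Types.** A vector $\omega$ with $\langle\omega,\lambda\rangle=0$ is of central-stable type if in its decomposition in the eigenbasis of $M$ at least one fixed but no expanding eigenvector occurs; then $\omega=\omega_c+\omega_s$ with $M\omega_c=\omega_c\ne0$ and $\omega_s$ a combination of contracting eigenvectors. **Aff.** $\operatorname{Aff}(T,\omega)$ is the set of AIETs $f$ on $[0,1)$ with log-slope vector $\omega$ and $\gamma(f)=\gamma(T)$; for $\omega$ of central-stable type such $f$ is uniquely ergodic and (known fact) conjugated to $T$ by an increasing homeomorphism $h$ of $[0,1)$ (extended to $[0,1]$ by $h(1)=1$). **The number $\zeta^f$.** Let $f_c\in\operatorname{Aff}(T,\omega_c)$,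 and let $\Sigma=\{(\alpha,i):\alpha\in\mathcal A,\ 0\le i<q^{(N)}_\alpha\}$; for $(\alpha,i)\in\Sigma$ let $\beta(\alpha,i)$ be the letter with $f_c^i(I^{(N)}_\alpha(f_c))\subset I_{\beta(\alpha,i)}(f_c)$. For $n\ge1$, $$\zeta_n=\frac1n\max\Big\{-\sum_{j=1}^n\log\frac{\mathrm{Leb}\big(f_c^{i_j}I^{(N)}_{\alpha_j}(f_c)\big)}{\mathrm{Leb}\big(I_{\alpha_{j-1}}(f_c)\big)}\ :\ (\alpha_j,i_j)\in\Sigma\ (0\le j\le n),\ \beta(\alpha_j,i_j)=\alpha_{j-1}\ (1\le j\le n)\Big\},$$ and $\zeta^f:=\lim_{n\to\infty}\zeta_n=\inf_{n\ge1}\zeta_n$ (the limit exists by subadditivity of $n\zeta_n$). **Hölder exponent.** $\mathfrak H(h)=\sup\{a>0:\exists C>0\ \forall x,y\in[0,1]\ |h(y)-h(x)|\le C|y-x|^a\}$. **Dimension.** For a Borel probability $\mu$ on $\mathbb R$, $\dim_H(\mu)=\inf\{\dim_H(E): E\text{ Borel},\ \mu(E)=1\}$. *)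

theory Defs
  imports "HOL-Probability.Probability" "HOL-Computational_Algebra.Polynomial"
begin

section \<open>Affine interval exchange transformations\<close>

text \<open>
  The alphabet is the universe of a finite type \<open>'a\<close>, so that \<open>d = CARD('a)\<close>. An AIET is stored as its
  combinatorial and metric data together with the transformation itself. The transformation is a
  total function on the reals; its values outside \<open>[0, \<Sum>\<^sub>\<alpha> \<lambda>\<^sub>\<alpha>)\<close> are irrelevant and never used.
\<close>

record ('a::finite) aiet =
  pi_t :: "'a \<Rightarrow> nat"
  pi_b :: "'a \<Rightarrow> nat"
  lens :: "real^'a"
  logslope :: "real^'a"
  amap :: "real \<Rightarrow> real"

definition irreducible_perm :: "('a::finite \<Rightarrow> nat) \<Rightarrow> ('a \<Rightarrow> nat) \<Rightarrow> bool" where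
  "irreducible_perm pt pb \<longleftrightarrow>
     bij_betw pt UNIV {1..CARD('a)} \<and> bij_betw pb UNIV {1..CARD('a)} \<and>
     (\<forall>k. 1 \<le> k \<and> k < CARD('a) \<longrightarrow> pt -` {1..k} \<noteq> pb -` {1..k})"

definition dom_ivl :: "('a::finite) aiet \<Rightarrow> real set" where
  "dom_ivl f = {0 ..< (\<Sum>\<alpha>\<in>UNIV. lens f $ \<alpha>)}"

definition left_end :: "('a::finite) aiet \<Rightarrow> 'a \<Rightarrow> real" where
  "left_end f \<alpha> = (\<Sum>\<beta> | pi_t f \<beta> < pi_t f \<alpha>. lens f $ \<beta>)"

definition ivl :: "('a::finite) aiet \<Rightarrow> 'a \<Rightarrow> real set" where
  "ivl f \<alpha> = {left_end f \<alpha> ..< left_end f \<alpha> + lens f $ \<alpha>}"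

definition is_aiet :: "('a::finite) aiet \<Rightarrow> bool" where
  "is_aiet f \<longleftrightarrow>
     irreducible_perm (pi_t f) (pi_b f) \<and>
     (\<forall>\<alpha>. 0 < lens f $ \<alpha>) \<and>
     bij_betw (amap f) (dom_ivl f) (dom_ivl f) \<and>
     (\<forall>\<alpha>. \<exists>c. \<forall>x\<in>ivl f \<alpha>. amap f x = exp (logslope f $ \<alpha>) * x + c) \<and>
     (\<forall>\<alpha> \<beta>. pi_b f \<alpha> < pi_b f \<beta> \<longrightarrow>
        (\<forall>x\<in>amap f ` ivl f \<alpha>. \<forall>y\<in>amap f ` ivl f \<beta>. x < y))"

definition on_unit_interval :: "('a::finite) aiet \<Rightarrow> bool" where
  "on_unit_interval f \<longleftrightarrow> (\<Sum>\<alpha>\<in>UNIV. lens f $ \<alpha>) = 1"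

definition is_iet :: "('a::finite) aiet \<Rightarrow> bool" where
  "is_iet f \<longleftrightarrow> is_aiet f \<and> logslope f = 0"

section \<open>Rauzy--Veech induction\<close>

text \<open>
  A state of the induction is a pair \<open>(J, F)\<close> of the family of exchanged intervals and the map
  exchanging them. The permutation of a state is read off from the left-to-right
  order of the intervals \<open>J \<alpha>\<close> and of their images \<open>F ` J \<alpha>\<close>.
\<close>

type_synonym 'a state = "('a \<Rightarrow> real set) \<times> (real \<Rightarrow> real)"

datatype rtype = Top | Bottom

type_synonym 'a rotation_number = "nat \<Rightarrow> (('a \<Rightarrow> nat) \<times> ('a \<Rightarrow> nat)) \<times> rtype"

definition leb :: "real set \<Rightarrow> real" where
  "leb A = measure lborel A"

definition order_position :: "('a::finite \<Rightarrow> real set) \<Rightarrow> 'a \<Rightarrow> nat" where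
  "order_position J \<alpha> = card {\<beta>. Inf (J \<beta>) \<le> Inf (J \<alpha>)}"

definition state_perm :: "('a::finite) state \<Rightarrow> ('a \<Rightarrow> nat) \<times> ('a \<Rightarrow> nat)" where
  "state_perm S = (order_position (fst S), order_position (\<lambda>\<alpha>. snd S ` fst S \<alpha>))"

definition last_letter :: "('a::finite \<Rightarrow> nat) \<Rightarrow> 'a" where
  "last_letter p = inv p CARD('a)"

definition last_t :: "('a::finite) state \<Rightarrow> 'a" where
  "last_t S = last_letter (fst (state_perm S))"

definition last_b :: "('a::finite) state \<Rightarrow> 'a" where
  "last_b S = last_letter (snd (state_perm S))"

definition len_t :: "('a::finite) state \<Rightarrow> real" where
  "len_t S = leb (fst S (last_t S))"

definition len_b :: "('a::finite) state \<Rightarrow> real" where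
  "len_b S = leb (snd S ` fst S (last_b S))"

text \<open>In case of equality of the two lengths, where the induction stops, the value below is arbitrary.\<close>

definition step_type :: "('a::finite) state \<Rightarrow> rtype" where
  "step_type S = (if len_t S > len_b S then Top else Bottom)"

definition first_return :: "(real \<Rightarrow> real) \<Rightarrow> real set \<Rightarrow> real \<Rightarrow> real" where
  "first_return F A x = (F ^^ (LEAST k. 0 < k \<and> (F ^^ k) x \<in> A)) x"

definition rv_step :: "('a::finite) state \<Rightarrow> 'a state" where
  "rv_step S =
    (let J = fst S; F = snd S; I = (\<Union>\<alpha>. J \<alpha>); lt = last_t S; lb = last_b S in
     case step_type S of
       Top \<Rightarrow> (J(lt := J lt - F ` J lb), first_return F (I - F ` J lb))
     | Bottom \<Rightarrow>
         (let P = {x\<in>I. F x \<in> J lt} in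
          (J(lt := P, lb := J lb - P), first_return F (I - J lt))))"

definition rv_state :: "('a::finite) aiet \<Rightarrow> nat \<Rightarrow> 'a state" where
  "rv_state f n = (rv_step ^^ n) (ivl f, amap f)"

definition infinitely_renormalizable :: "('a::finite) aiet \<Rightarrow> bool" where
  "infinitely_renormalizable f \<longleftrightarrow> (\<forall>n. len_t (rv_state f n) \<noteq> len_b (rv_state f n))"

definition ivl_n :: "('a::finite) aiet \<Rightarrow> nat \<Rightarrow> 'a \<Rightarrow> real set" where
  "ivl_n f n \<alpha> = fst (rv_state f n) \<alpha>"

definition return_time :: "('a::finite) aiet \<Rightarrow> nat \<Rightarrow> 'a \<Rightarrow> nat" where
  "return_time f n \<alpha> = (LEAST k. 0 < k \<and> (amap f ^^ k) ` ivl_n f n \<alpha> \<subseteq> (\<Union>\<beta>. ivl_n f n \<beta>))"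

definition rotation_number :: "('a::finite) aiet \<Rightarrow> 'a rotation_number" where
  "rotation_number f n = (state_perm (rv_state f n), step_type (rv_state f n))"

definition winner :: "(('a::finite \<Rightarrow> nat) \<times> ('a \<Rightarrow> nat)) \<times> rtype \<Rightarrow> 'a" where
  "winner g = (case g of ((pt, pb), Top) \<Rightarrow> last_letter pt | ((pt, pb), Bottom) \<Rightarrow> last_letter pb)"

definition infinity_complete :: "('a::finite) rotation_number \<Rightarrow> bool" where
  "infinity_complete \<gamma> \<longleftrightarrow> (\<forall>\<alpha>. infinite {n. winner (\<gamma> n) = \<alpha>})"

definition is_period :: "('a::finite) rotation_number \<Rightarrow> nat \<Rightarrow> bool" where
  "is_period \<gamma> N \<longleftrightarrow> 0 < N \<and> (\<forall>n. \<gamma> (n + N) = \<gamma> n)"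

section \<open>Hyperbolic self-similarity\<close>

definition self_similar :: "('a::finite) aiet \<Rightarrow> bool" where
  "self_similar T \<longleftrightarrow>
     is_iet T \<and> on_unit_interval T \<and> infinitely_renormalizable T \<and>
     infinity_complete (rotation_number T) \<and> (\<exists>N. is_period (rotation_number T) N)"

definition sim_matrix :: "('a::finite) aiet \<Rightarrow> nat \<Rightarrow> real^'a^'a" where
  "sim_matrix T N = (\<chi> \<alpha> \<beta>. real (card {k. k < return_time T N \<alpha> \<and>
     (amap T ^^ k) ` ivl_n T N \<alpha> \<subseteq> ivl T \<beta>}))"

definition Omega :: "('a::finite \<Rightarrow> nat) \<Rightarrow> ('a \<Rightarrow> nat) \<Rightarrow> real^'a^'a" where
  "Omega pt pb = (\<chi> \<alpha> \<beta>. if pb \<alpha> > pb \<beta> \<and> pt \<alpha> < pt \<beta> then 1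
                         else if pb \<alpha> < pb \<beta> \<and> pt \<alpha> > pt \<beta> then -1 else 0)"

text \<open>\<open>dim_ker_Omega T\<close> is \<open>\<kappa> - 1\<close>. The rank \<open>d - (\<kappa> - 1)\<close> of the antisymmetric matrix is even.\<close>

definition dim_ker_Omega :: "('a::finite) aiet \<Rightarrow> nat" where
  "dim_ker_Omega T = dim {v. Omega (pi_t T) (pi_b T) *v v = 0}"

definition genus :: "('a::finite) aiet \<Rightarrow> nat" where
  "genus T = (CARD('a) - dim_ker_Omega T) div 2"

definition charpoly :: "real^'a^('a::finite) \<Rightarrow> real poly" where
  "charpoly M = det (\<chi> i j. (if i = j then [:0, 1:] else 0) - [:M $ i $ j:])"

definition eigenvector :: "'k::field^'a^('a::finite) \<Rightarrow> 'k \<Rightarrow> 'k^'a \<Rightarrow> bool" where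
  "eigenvector M x v \<longleftrightarrow> v \<noteq> 0 \<and> M *v v = x *s v"

definition simple_eigenvalue :: "real^'a^('a::finite) \<Rightarrow> real \<Rightarrow> bool" where
  "simple_eigenvalue M x \<longleftrightarrow> order x (charpoly M) = 1"

definition complex_eigenvalues :: "real^'a^('a::finite) \<Rightarrow> complex set" where
  "complex_eigenvalues M = {z. \<exists>v. eigenvector (\<chi> i j. complex_of_real (M $ i $ j)) z v}"

definition hyperbolically_self_similar :: "('a::finite) aiet \<Rightarrow> nat \<Rightarrow> bool" where
  "hyperbolically_self_similar T N \<longleftrightarrow>
     self_similar T \<and> is_period (rotation_number T) N \<and>
     (\<exists>E C. finite E \<and> finite C \<and> card E = genus T \<and> card C = genus T \<and>
        (\<forall>x\<in>E. simple_eigenvalue (sim_matrix T N) x \<and> \<bar>x\<bar> > 1) \<and>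
        (\<forall>x\<in>C. simple_eigenvalue (sim_matrix T N) x \<and> \<bar>x\<bar> < 1) \<and>
        inj_on abs (E \<union> C)) \<and>
     dim {v. sim_matrix T N *v v = v} = dim_ker_Omega T"

definition positive_matrix :: "real^'a^('a::finite) \<Rightarrow> bool" where
  "positive_matrix M \<longleftrightarrow> (\<forall>\<alpha> \<beta>. 0 < M $ \<alpha> $ \<beta>)"

definition positive_spectrum :: "real^'a^('a::finite) \<Rightarrow> bool" where
  "positive_spectrum M \<longleftrightarrow> (\<forall>z\<in>complex_eigenvalues M. z \<in> \<real> \<and> 0 < Re z)"

text \<open>For a positive matrix the Perron--Frobenius eigenvalue is the spectral radius.\<close>

definition perron_frobenius :: "real^'a^('a::finite) \<Rightarrow> real" where
  "perron_frobenius M = Max (cmod ` complex_eigenvalues M)"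

definition rho :: "('a::finite) aiet \<Rightarrow> nat \<Rightarrow> real" where
  "rho T N = ln (perron_frobenius (sim_matrix T N))"

section \<open>Central-stable type and the class Aff\<close>

definition eigenbasis :: "real^'a^('a::finite) \<Rightarrow> (real^'a) set \<Rightarrow> bool" where
  "eigenbasis M B \<longleftrightarrow> independent B \<and> span B = UNIV \<and> (\<forall>v\<in>B. \<exists>x. eigenvector M x v)"

definition central_stable_type :: "real^'a^('a::finite) \<Rightarrow> real^'a \<Rightarrow> real^'a \<Rightarrow> bool" where
  "central_stable_type M l \<omega> \<longleftrightarrow>
     \<omega> \<bullet> l = 0 \<and>
     (\<exists>B c. eigenbasis M B \<and> \<omega> = (\<Sum>v\<in>B. c v *\<^sub>R v) \<and>
        (\<exists>v\<in>B. eigenvector M 1 v \<and> c v \<noteq> 0) \<and>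
        (\<forall>v\<in>B. \<forall>x. eigenvector M x v \<and> \<bar>x\<bar> > 1 \<longrightarrow> c v = 0))"

definition central_stable_decomposition ::
    "real^'a^('a::finite) \<Rightarrow> real^'a \<Rightarrow> real^'a \<Rightarrow> real^'a \<Rightarrow> bool" where
  "central_stable_decomposition M \<omega> \<omega>c \<omega>s \<longleftrightarrow>
     \<omega> = \<omega>c + \<omega>s \<and> eigenvector M 1 \<omega>c \<and>
     \<omega>s \<in> span {v. \<exists>x. \<bar>x\<bar> < 1 \<and> eigenvector M x v}"

definition Aff :: "('a::finite) aiet \<Rightarrow> real^'a \<Rightarrow> 'a aiet set" where
  "Aff T \<omega> = {f. is_aiet f \<and> on_unit_interval f \<and> logslope f = \<omega> \<and>
                 infinitely_renormalizable f \<and> rotation_number f = rotation_number T}"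

definition increasing_homeo :: "(real \<Rightarrow> real) \<Rightarrow> bool" where
  "increasing_homeo h \<longleftrightarrow>
     (\<exists>g. homeomorphism {0..<1} {0..<1} h g) \<and> strict_mono_on {0..<1} h \<and> h 1 = 1"

definition conjugacy :: "(real \<Rightarrow> real) \<Rightarrow> ('a::finite) aiet \<Rightarrow> 'a aiet \<Rightarrow> bool" where
  "conjugacy h f T \<longleftrightarrow> increasing_homeo h \<and> (\<forall>x\<in>{0..<1}. h (amap f x) = amap T (h x))"

section \<open>The number zeta\<close>

definition tower_index :: "('a::finite) aiet \<Rightarrow> nat \<Rightarrow> ('a \<times> nat) set" where
  "tower_index f N = {(\<alpha>, i). i < return_time f N \<alpha>}"

definition tower_floor :: "('a::finite) aiet \<Rightarrow> nat \<Rightarrow> 'a \<times> nat \<Rightarrow> real set" where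
  "tower_floor f N p = (amap f ^^ snd p) ` ivl_n f N (fst p)"

definition floor_letter :: "('a::finite) aiet \<Rightarrow> nat \<Rightarrow> 'a \<times> nat \<Rightarrow> 'a" where
  "floor_letter f N p = (THE \<beta>. tower_floor f N p \<subseteq> ivl f \<beta>)"

definition zeta_n :: "('a::finite) aiet \<Rightarrow> nat \<Rightarrow> nat \<Rightarrow> real" where
  "zeta_n f N n = (1 / real n) *
     Max {- (\<Sum>j=1..n. ln (leb (tower_floor f N (p j)) / leb (ivl f (fst (p (j - 1)))))) | p.
            (\<forall>j\<in>{0..n}. p j \<in> tower_index f N) \<and>
            (\<forall>j\<in>{1..n}. floor_letter f N (p j) = fst (p (j - 1)))}"

definition zeta :: "('a::finite) aiet \<Rightarrow> nat \<Rightarrow> real" where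
  "zeta f N = lim (\<lambda>n. zeta_n f N n)"

section \<open>Hoelder exponent and Hausdorff dimension\<close>

text \<open>Suprema and infima are taken in the extended reals, so that empty or unbounded sets do not
  produce unspecified values.\<close>

definition holder_exponent :: "(real \<Rightarrow> real) \<Rightarrow> ereal" where
  "holder_exponent h = Sup (ereal ` {a. 0 < a \<and>
     (\<exists>C>0. \<forall>x\<in>{0..1}. \<forall>y\<in>{0..1}. \<bar>h y - h x\<bar> \<le> C * \<bar>y - x\<bar> powr a)})"

text \<open>Covering sets are required to be bounded because \<^const>\<open>diameter\<close> is meaningless otherwise.\<close>

definition hausdorff_pre :: "real \<Rightarrow> real \<Rightarrow> real set \<Rightarrow> ennreal" where
  "hausdorff_pre s \<delta> E =
     Inf {(\<Sum>i. ennreal (diameter (U i) powr s)) | U :: nat \<Rightarrow> real set.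
            E \<subseteq> (\<Union>i. U i) \<and> (\<forall>i. bounded (U i) \<and> diameter (U i) \<le> \<delta>)}"

definition hausdorff_measure :: "real \<Rightarrow> real set \<Rightarrow> ennreal" where
  "hausdorff_measure s E = (SUP \<delta>\<in>{0<..}. hausdorff_pre s \<delta> E)"

definition hausdorff_dim :: "real set \<Rightarrow> ereal" where
  "hausdorff_dim E = Inf (ereal ` {s. 0 < s \<and> hausdorff_measure s E = 0})"

definition measure_dim :: "real measure \<Rightarrow> ereal" where
  "measure_dim \<mu> = Inf {hausdorff_dim E | E. E \<in> sets borel \<and> emeasure \<mu> E = 1}"

definition invariant_prob :: "('a::finite) aiet \<Rightarrow> real measure \<Rightarrow> bool" where
  "invariant_prob f \<mu> \<longleftrightarrow>
     prob_space \<mu> \<and> sets \<mu> = sets borel \<and> emeasure \<mu> (dom_ivl f) = 1 \<and>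
     (\<forall>A\<in>sets borel. A \<subseteq> dom_ivl f \<longrightarrow>
        emeasure \<mu> {x \<in> dom_ivl f. amap f x \<in> A} = emeasure \<mu> A)"

end

(*
  The floors of the renormalisation towers of f at level n are nested intervals coded by admissible
  paths of symbols. The Rauzy-Veech words, and hence the coding, depend only on the rotation number,
  so T, f and f_c share it. Perron-Frobenius uniqueness gives every floor over I_alpha the mu_f-mass
  exp (-n rho) lambda_alpha and yields h x = mu_f [0,x). Since M^n omega -> omega_c exponentially
  fast, the length of a floor of f is, up to a bounded factor, the product of the ratios of f_c along
  its path; so the shortest floor of level n has length of order exp (-n zeta), which gives the
  Hoelder exponent.

  For the dimension, a subaction V turns the potential -log ratio into zeta + g with g <= 0 up to a
  coboundary. If g vanished identically, then the Birkhoff sums of omega_c would be a coboundary over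
  the letters; they are zero on the floors of index 0, which makes V constant, hence omega_c = 0.
  So g < 0 on some symbol, the mu_f-typical floor is exponentially longer than exp (-n zeta), and the
  mass distribution principle gives dim mu_f > rho / zeta.
*)

theory Submission
  imports Defs
begin

text \<open>Affinity removes all distortion: a floor of level n is an affine image of a base
  interval, so its length is exactly a product of slopes times a base length. What remains is a
  bounded comparison of the base lengths of f and f_c; it holds because the recursion for base
  lengths is perturbed summably.

  The Hoelder bound is proved at the exponent rho / zeta itself, which asks for control up to
  bounded factors rather than exp (o(n)). Subadditivity alone gives n zeta + o(n); since M is
  positive, two paths can be joined at bounded cost, and the error stays bounded. The same bound
  makes the supremum defining the subaction finite.

  The dimension of the measure is not computed: a lower bound s > rho / zeta suffices, and it may be
  proved on a set of positive measure. A symbol with g < 0 need not be available from every letter,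
  hence the passage to two steps of the weighted transfer operator. The non-coboundary argument
  leaves one letter undecided; there the orthogonality of omega_c to lambda decides, which follows
  from M omega_c = omega_c and lambda M = exp (rho) lambda.\<close>

section \<open>Coding by paths\<close>

text \<open>Iterating the hypothesis shows that \<open>a (k * m)\<close> differs from
  \<open>k * a m\<close> by at most \<open>(k + 1) * c\<close>. Reading \<open>a (k * m)\<close> in
  two ways makes \<open>a n / n\<close> Cauchy; dividing by k and letting k tend to infinity returns
  the bound with the same constant \<open>c\<close>.\<close>

lemma quasi_additive_limit:
  fixes a :: "nat \<Rightarrow> real"
  assumes qa: "\<And>m n. \<bar>a (m + n) - a m - a n\<bar> \<le> c"
  obtains z where "\<And>n. \<bar>a n - real n * z\<bar> \<le> c" "(\<lambda>n. a n / real n) \<longlonglongrightarrow> z"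
proof -
  have c0: "c \<ge> 0" using qa[of 0 0] by linarith
  have mult: "\<bar>a (k * m) - real k * a m\<bar> \<le> (real k + 1) * c" for k m
  proof (induction k)
    case 0
    show ?case using qa[of 0 0] by simp
  next
    case (Suc k)
    show ?case using qa[of m "k * m"] Suc by (simp add: algebra_simps)
  qed
  have comp: "\<bar>a m / real m - a k / real k\<bar> \<le> 2 * c / real m + 2 * c / real k"
    if "m > 0" "k > 0" for m k
  proof -
    have "\<bar>real k * a m - real m * a k\<bar> \<le> (real k + 1) * c + (real m + 1) * c"
      using mult[of k m] mult[of m k] by (simp add: mult.commute)
    also have "\<dots> \<le> (2 * real k) * c + (2 * real m) * c"
      using that c0 by (intro add_mono mult_right_mono) auto
    finally have "\<bar>(real k * a m - real m * a k) / (real m * real k)\<bar>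
        \<le> ((2 * real k) * c + (2 * real m) * c) / (real m * real k)"
      by (simp add: abs_divide divide_right_mono)
    then show ?thesis using that by (simp add: field_simps)
  qed
  have "Cauchy (\<lambda>n. a n / real n)"
  proof (rule metric_CauchyI)
    fix e :: real assume "e > 0"
    obtain M :: nat where "real M > max 1 (4 * c / e)"
      using reals_Archimedean2 by blast
    then have M: "real M > 4 * c / e" "M > 0" by auto
    have half: "2 * c / real m < e / 2" if "m \<ge> M" for m
    proof -
      have "real m > 4 * c / e" using M that by linarith
      then show ?thesis using M that \<open>e > 0\<close> by (simp add: field_simps)
    qed
    show "\<exists>M. \<forall>m\<ge>M. \<forall>n\<ge>M. dist (a m / real m) (a n / real n) < e"
    proof (intro exI allI impI)
      fix m n assume mn: "m \<ge> M" "n \<ge> M"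
      then show "dist (a m / real m) (a n / real n) < e"
        using comp[of m n] half[OF mn(1)] half[OF mn(2)] M by (simp add: dist_real_def)
    qed
  qed
  then obtain z where z: "(\<lambda>n. a n / real n) \<longlonglongrightarrow> z"
    using Cauchy_convergent_iff convergent_def by blast
  have bound: "\<bar>a m - real m * z\<bar> \<le> c" for m
  proof -
    have lim: "(\<lambda>k. \<bar>a (k * m) / real k - a m\<bar>) \<longlonglongrightarrow> \<bar>real m * z - a m\<bar>"
    proof (cases "m = 0")
      case True
      then show ?thesis by (auto intro!: tendsto_eq_intros lim_const_over_n)
    next
      case False
      have "(\<lambda>k. a (k * m) / real (k * m)) \<longlonglongrightarrow> z"
        using LIMSEQ_subseq_LIMSEQ[OF z, of "\<lambda>k. k * m"] False by (simp add: strict_mono_def o_def)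
      then have "(\<lambda>k. real m * (a (k * m) / real (k * m))) \<longlonglongrightarrow> real m * z"
        by (intro tendsto_intros)
      moreover have "(\<lambda>k. real m * (a (k * m) / real (k * m))) = (\<lambda>k. a (k * m) / real k)"
        using False by auto
      ultimately show ?thesis by (intro tendsto_intros) auto
    qed
    have lim2: "(\<lambda>k. c + c / real k) \<longlonglongrightarrow> c"
      by (auto intro!: tendsto_eq_intros lim_const_over_n)
    have "\<bar>a (k * m) / real k - a m\<bar> \<le> c + c / real k" if "k \<ge> 1" for k
    proof -
      have "\<bar>(a (k * m) - real k * a m) / real k\<bar> \<le> ((real k + 1) * c) / real k"
        using mult[of k m] that by (simp add: abs_divide divide_right_mono)
      then show ?thesis using that by (simp add: field_simps)
    qed
    then show ?thesis
      using LIMSEQ_le[OF lim lim2] by (metis abs_minus_commute)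
  qed
  show thesis using that[OF bound z] .
qed

text \<open>For return words \<open>W\<close>, the pair (\<alpha>, i) is the floor of height i over
  \<alpha>. The index set is defined from words, not from a map, so that T, f and f_c share
  it.\<close>

definition sym_index :: "('a \<Rightarrow> 'a list) \<Rightarrow> ('a \<times> nat) set" where
  "sym_index W = {(\<alpha>, i). i < length (W \<alpha>)}"

text \<open>The letter whose interval contains the floor, written \<beta>(\<alpha>, i) in the
  definition of zeta.\<close>

definition sym_target :: "('a \<Rightarrow> 'a list) \<Rightarrow> 'a \<times> nat \<Rightarrow> 'a" where
  "sym_target W \<sigma> = W (fst \<sigma>) ! snd \<sigma>"

text \<open>Paths are stored with the most recent symbol first. The last entry only records the
  initial letter, with the dummy index 0.\<close>

fun paths :: "('a \<Rightarrow> 'a list) \<Rightarrow> nat \<Rightarrow> ('a \<times> nat) list set" where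
  "paths W 0 = {[(\<alpha>, 0)] | \<alpha>. True}"
| "paths W (Suc n) = {\<sigma> # xs | \<sigma> xs. \<sigma> \<in> sym_index W \<and> xs \<in> paths W n \<and> sym_target W \<sigma> = fst (hd xs)}"

lemma Cons_in_paths [simp]:
  "\<sigma> # xs \<in> paths W (Suc n) \<longleftrightarrow> \<sigma> \<in> sym_index W \<and> xs \<in> paths W n \<and> sym_target W \<sigma> = fst (hd xs)"
  by (cases \<sigma>) auto

lemma paths_SucE:
  assumes "xs \<in> paths W (Suc n)"
  obtains \<sigma> ys where "xs = \<sigma> # ys" "\<sigma> \<in> sym_index W" "ys \<in> paths W n" "sym_target W \<sigma> = fst (hd ys)"
  using assms by auto

declare paths.simps(2) [simp del]

text \<open>The last entry is the dummy that only records the initial letter, so it must not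
  contribute; hence \<open>butlast\<close>.\<close>

definition path_sum :: "('b \<Rightarrow> real) \<Rightarrow> 'b list \<Rightarrow> real" where
  "path_sum \<phi> xs = sum_list (map \<phi> (butlast xs))"

lemma path_sum_single [simp]: "path_sum \<phi> [x] = 0"
  by (simp add: path_sum_def)

lemma path_sum_Cons [simp]: "xs \<noteq> [] \<Longrightarrow> path_sum \<phi> (x # xs) = \<phi> x + path_sum \<phi> xs"
  by (simp add: path_sum_def)

lemma paths_length: "xs \<in> paths W n \<Longrightarrow> length xs = Suc n"
  by (induction n arbitrary: xs) (auto elim!: paths_SucE)

lemma paths_not_Nil: "xs \<in> paths W n \<Longrightarrow> xs \<noteq> []"
  using paths_length by fastforce

lemma finite_sym_index: "finite (sym_index (W :: 'a::finite \<Rightarrow> 'a list))"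
proof -
  have "sym_index W = (SIGMA \<alpha>:UNIV. {..<length (W \<alpha>)})" by (auto simp: sym_index_def)
  then show ?thesis by simp
qed

lemma finite_paths: "finite (paths (W :: 'a::finite \<Rightarrow> 'a list) n)"
proof (induction n)
  case 0
  have "paths W 0 = (\<lambda>\<alpha>. [(\<alpha>, 0)]) ` UNIV" by auto
  then show ?case by (metis finite finite_imageI)
next
  case (Suc n)
  have "paths W (Suc n) \<subseteq> (\<lambda>(\<sigma>, xs). \<sigma> # xs) ` (sym_index W \<times> paths W n)" by (force elim!: paths_SucE)
  then show ?case using Suc finite_sym_index finite_subset by blast
qed

lemma sum_paths_Suc:
  fixes F :: "('a::finite \<times> nat) list \<Rightarrow> real"
  shows "(\<Sum>xs\<in>paths W (Suc n). F xs) =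
    (\<Sum>xs\<in>paths W n. \<Sum>\<sigma> | \<sigma> \<in> sym_index W \<and> sym_target W \<sigma> = fst (hd xs). F (\<sigma> # xs))"
proof -
  have "(\<Sum>xs\<in>paths W n. \<Sum>\<sigma> | \<sigma> \<in> sym_index W \<and> sym_target W \<sigma> = fst (hd xs). F (\<sigma> # xs))
    = (\<Sum>(xs, \<sigma>)\<in>(SIGMA xs:paths W n. {\<sigma>. \<sigma> \<in> sym_index W \<and> sym_target W \<sigma> = fst (hd xs)}). F (\<sigma> # xs))"
    by (subst sum.Sigma) (auto intro: finite_paths finite_subset[OF _ finite_sym_index])
  also have "\<dots> = (\<Sum>xs\<in>paths W (Suc n). F xs)"
    by (rule sum.reindex_bij_witness[of _ "\<lambda>xs. (tl xs, hd xs)" "\<lambda>(xs, \<sigma>). \<sigma> # xs"]) (auto elim!: paths_SucE)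
  finally show ?thesis by simp
qed

text \<open>Choose in each interval that meets the convex set K a common point. An interval whose
  point is neither the leftmost nor the rightmost lies between two points of K and is therefore
  contained in K.\<close>

lemma card_intersecting_intervals_le_2:
  fixes I :: "'b \<Rightarrow> real set"
  assumes iv: "\<And>i. i \<in> A \<Longrightarrow> \<exists>u v. I i = {u..<v}"
    and dj: "\<And>i j. i \<in> A \<Longrightarrow> j \<in> A \<Longrightarrow> i \<noteq> j \<Longrightarrow> I i \<inter> I j = {}"
    and fin: "finite A"
    and K: "\<And>x y z. x \<in> K \<Longrightarrow> z \<in> K \<Longrightarrow> x \<le> y \<Longrightarrow> y \<le> z \<Longrightarrow> y \<in> K"
    and no: "\<And>i. i \<in> A \<Longrightarrow> \<not> I i \<subseteq> K"
  shows "card {i \<in> A. I i \<inter> K \<noteq> {}} \<le> 2"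
proof -
  define B where "B = {i \<in> A. I i \<inter> K \<noteq> {}}"
  show ?thesis unfolding B_def[symmetric]
  proof (cases "B = {}")
  case True
  show "card B \<le> 2" unfolding True by simp
next
  case False
  define p where "p i = (SOME x. x \<in> I i \<inter> K)" for i
  have p: "p i \<in> I i" "p i \<in> K" if "i \<in> B" for i
    using that someI_ex[of "\<lambda>x. x \<in> I i \<inter> K"] unfolding p_def B_def by auto
  have fB: "finite B" using fin unfolding B_def by simp
  obtain a where a: "a \<in> B" "\<And>i. i \<in> B \<Longrightarrow> p a \<le> p i"
  proof -
    have "Min (p ` B) \<in> p ` B" using fB False by (intro Min_in) auto
    then obtain a where "a \<in> B" "p a = Min (p ` B)" by auto
    then show ?thesis using that[of a] fB by simp
  qed
  obtain b where b: "b \<in> B" "\<And>i. i \<in> B \<Longrightarrow> p i \<le> p b"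
  proof -
    have "Max (p ` B) \<in> p ` B" using fB False by (intro Max_in) auto
    then obtain b where "b \<in> B" "p b = Max (p ` B)" by auto
    then show ?thesis using that[of b] fB by simp
  qed
  have "B \<subseteq> {a, b}"
  proof
    fix i assume i: "i \<in> B"
    show "i \<in> {a, b}"
    proof (rule ccontr)
      assume "i \<notin> {a, b}"
      then have n: "p a \<notin> I i" "p b \<notin> I i" using p[OF a(1)] p[OF b(1)] a(1) b(1) i dj[of a i] dj[of b i] unfolding B_def by auto
      obtain u v where uv: "I i = {u..<v}" using iv i unfolding B_def by blast
      have "p a < u" "v \<le> p b" using n a(2)[OF i] b(2)[OF i] p(1)[OF i] uv by auto
      then have "I i \<subseteq> K" using uv K[OF p(2)[OF a(1)] p(2)[OF b(1)]] by fastforce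
      then show False using no i unfolding B_def by blast
    qed
  qed
  then have "card B \<le> card {a, b}" by (intro card_mono) auto
  also have "\<dots> \<le> 2" by (cases "a = b") auto
  finally show "card B \<le> 2" .
qed
qed

section \<open>Maximal path sums and the sharp Hoelder bound\<close>

section \<open>The Hoelder exponent of a coded measure\<close>

lemma ex_nat_mult_gt: "x > 0 \<Longrightarrow> \<exists>n. (y::real) < real n * x"
  using reals_Archimedean3 by blast

lemma leb_ivl: "u \<le> v \<Longrightarrow> leb {u..<v} = v - u"
  by (simp add: leb_def)

lemma powr_exp: "exp x powr y = exp (x * y :: real)"
  by (simp add: powr_def mult.commute[of y])

text \<open>Three maps meet here: \<open>cell\<close> and \<open>\<mu>\<close> will come from f, the
  ratios \<open>r\<close> from f_c and \<open>lam\<close> from T, all indexed by the same paths.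
  \<open>cell_size\<close> is the bounded comparison of f with f_c, and \<open>full\<close> says
  that the self-similarity matrix is positive.\<close>

locale coded_measure =
  fixes W :: "'a::finite \<Rightarrow> 'a list"
    and cell :: "('a \<times> nat) list \<Rightarrow> real set"
    and \<mu> :: "real measure"
    and r :: "'a \<times> nat \<Rightarrow> real"
    and lam :: "'a \<Rightarrow> real"
    and \<rho> D :: real
  assumes full: "\<beta> \<in> set (W \<alpha>)"
    and cell_ivl: "xs \<in> paths W n \<Longrightarrow> \<exists>u v. 0 \<le> u \<and> u < v \<and> v \<le> 1 \<and> cell xs = {u..<v}"
    and cell_cover: "(\<Union>xs\<in>paths W n. cell xs) = {0..<1}"
    and cell_disj: "xs \<in> paths W n \<Longrightarrow> ys \<in> paths W n \<Longrightarrow> xs \<noteq> ys \<Longrightarrow> cell xs \<inter> cell ys = {}"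
    and r01: "\<sigma> \<in> sym_index W \<Longrightarrow> 0 < r \<sigma> \<and> r \<sigma> < 1"
    and cell_size: "xs \<in> paths W n \<Longrightarrow> \<bar>ln (leb (cell xs)) - path_sum (\<lambda>\<sigma>. ln (r \<sigma>)) xs\<bar> \<le> D"
    and prob: "prob_space \<mu>" and sets_\<mu>: "sets \<mu> = sets borel"
    and unit: "measure \<mu> {0..<1} = 1"
    and cell_mass: "xs \<in> paths W n \<Longrightarrow> measure \<mu> (cell xs) = exp (- (real n * \<rho>)) * lam (fst (hd xs))"
    and lam_pos: "lam \<alpha> > 0" and \<rho>_pos: "\<rho> > 0"
    and lam_eigen: "(\<Sum>\<sigma> | \<sigma> \<in> sym_index W \<and> sym_target W \<sigma> = \<beta>. lam (fst \<sigma>)) = exp \<rho> * lam \<beta>"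
begin

interpretation prob_space \<mu> by (rule prob)

definition \<phi> :: "'a \<times> nat \<Rightarrow> real" where "\<phi> \<sigma> = - ln (r \<sigma>)"

text \<open>For the ratios of f_c this is n times \<open>zeta_n\<close>, so that
  \<open>\<zeta>\<close> below becomes the number in the theorem.\<close>

definition Z :: "nat \<Rightarrow> real" where "Z n = Max (path_sum \<phi> ` paths W n)"

definition \<zeta> :: real where "\<zeta> = lim (\<lambda>n. Z n / real n)"

text \<open>A crude bound for the potential of a single symbol; it is the price of exchanging one
  symbol of a path.\<close>

definition c\<phi> :: real where "c\<phi> = (\<Sum>\<sigma>\<in>sym_index W. \<phi> \<sigma>)"

lemma \<phi>_pos: "\<sigma> \<in> sym_index W \<Longrightarrow> \<phi> \<sigma> > 0"
  using r01 unfolding \<phi>_def by simp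

lemma \<phi>_le: "\<sigma> \<in> sym_index W \<Longrightarrow> \<phi> \<sigma> \<le> c\<phi>"
  unfolding c\<phi>_def using \<phi>_pos finite_sym_index by (intro member_le_sum) (auto simp: less_imp_le)

lemma ex_symbol: "\<exists>\<sigma>\<in>sym_index W. fst \<sigma> = \<alpha> \<and> sym_target W \<sigma> = \<beta>"
  using full[of \<beta> \<alpha>] by (auto simp: in_set_conv_nth sym_index_def sym_target_def)

lemma c\<phi>_nonneg: "c\<phi> \<ge> 0"
  unfolding c\<phi>_def using \<phi>_pos by (intro sum_nonneg) (auto simp: less_imp_le)

lemma paths_nonempty: "paths W n \<noteq> {}"
proof (induction n)
  case (Suc n)
  then obtain xs where "xs \<in> paths W n" by auto
  moreover obtain \<sigma> where "\<sigma> \<in> sym_index W" "sym_target W \<sigma> = fst (hd xs)"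
    using ex_symbol by blast
  ultimately have "\<sigma> # xs \<in> paths W (Suc n)" by simp
  then show ?case by blast
qed auto

lemma Z_ge: "xs \<in> paths W n \<Longrightarrow> path_sum \<phi> xs \<le> Z n"
  unfolding Z_def using finite_paths by (intro Max_ge) auto

lemma Z_attained: "\<exists>xs\<in>paths W n. path_sum \<phi> xs = Z n"
proof -
  have "Z n \<in> path_sum \<phi> ` paths W n"
    unfolding Z_def using finite_paths paths_nonempty by (intro Max_in) auto
  then show ?thesis by auto
qed

text \<open>Only the earliest symbol of \<open>ys\<close> has to change: it is replaced by one over
  the same letter whose target is the current letter of \<open>xs\<close>. This loses at most
  \<open>c\<phi>\<close>. A path of length 0 has no symbol to replace, hence the guard on the
  current letter.\<close>

lemma join_paths:
  assumes "xs \<in> paths W m" "ys \<in> paths W n"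
  shows "\<exists>zs\<in>paths W (m + n). (n > 0 \<longrightarrow> fst (hd zs) = fst (hd ys)) \<and>
           path_sum \<phi> xs + path_sum \<phi> ys - c\<phi> \<le> path_sum \<phi> zs"
  using assms(2)
proof (induction n arbitrary: ys)
  case 0
  then show ?case using assms(1) c\<phi>_nonneg by force
next
  case (Suc n)
  then obtain \<sigma> ys' where ys: "ys = \<sigma> # ys'" "\<sigma> \<in> sym_index W" "ys' \<in> paths W n"
      "sym_target W \<sigma> = fst (hd ys')" by (auto elim!: paths_SucE)
  show ?case
  proof (cases "n = 0")
    case True
    obtain \<tau> where \<tau>: "\<tau> \<in> sym_index W" "fst \<tau> = fst \<sigma>" "sym_target W \<tau> = fst (hd xs)"
      using ex_symbol by blast
    have "path_sum \<phi> ys' = 0" using ys(3) True by auto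
    then show ?thesis
      using \<tau> ys assms(1) True \<phi>_pos[OF \<tau>(1)] \<phi>_le[OF ys(2)] paths_not_Nil[OF ys(3)] paths_not_Nil[OF assms(1)]
      by (intro bexI[of _ "\<tau> # xs"]) auto
  next
    case False
    obtain zs where zs: "zs \<in> paths W (m + n)" "fst (hd zs) = fst (hd ys')"
        "path_sum \<phi> xs + path_sum \<phi> ys' - c\<phi> \<le> path_sum \<phi> zs"
      using Suc.IH[OF ys(3)] False by auto
    then show ?thesis
      using ys paths_not_Nil[OF ys(3)] paths_not_Nil[OF zs(1)]
      by (intro bexI[of _ "\<sigma> # zs"]) auto
  qed
qed

lemma split_path:
  assumes "zs \<in> paths W (m + n)"
  shows "\<exists>xs\<in>paths W m. \<exists>ys\<in>paths W n. fst (hd ys) = fst (hd zs) \<and>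
           path_sum \<phi> zs = path_sum \<phi> xs + path_sum \<phi> ys"
  using assms
proof (induction n arbitrary: zs)
  case 0
  then show ?case by (intro bexI[of _ zs] bexI[of _ "[(fst (hd zs), 0)]"]) auto
next
  case (Suc n)
  then obtain \<sigma> zs' where zs: "zs = \<sigma> # zs'" "\<sigma> \<in> sym_index W" "zs' \<in> paths W (m + n)"
      "sym_target W \<sigma> = fst (hd zs')" by (auto elim!: paths_SucE)
  obtain xs ys where ih: "xs \<in> paths W m" "ys \<in> paths W n" "fst (hd ys) = fst (hd zs')"
      "path_sum \<phi> zs' = path_sum \<phi> xs + path_sum \<phi> ys"
    using Suc.IH[OF zs(3)] by blast
  show ?case
    using ih zs paths_not_Nil[OF ih(2)] paths_not_Nil[OF zs(3)]
    by (intro bexI[OF _ ih(1)] bexI[of _ "\<sigma> # ys"]) auto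
qed

text \<open>Cutting a path is free and gives subadditivity; joining two paths costs at most
  \<open>c\<phi>\<close> and gives the reverse inequality. Both are needed to bound the distance of
  \<open>Z n\<close> from a linear function.\<close>

lemma Z_quasi_additive: "\<bar>Z (m + n) - Z m - Z n\<bar> \<le> c\<phi>"
proof -
  obtain xs ys where "xs \<in> paths W m" "path_sum \<phi> xs = Z m" "ys \<in> paths W n" "path_sum \<phi> ys = Z n"
    using Z_attained by metis
  then have "Z m + Z n - c\<phi> \<le> Z (m + n)"
    using join_paths[of xs m ys n] Z_ge[of _ "m + n"] by fastforce
  moreover obtain zs where zs: "zs \<in> paths W (m + n)" "path_sum \<phi> zs = Z (m + n)"
    using Z_attained by metis
  then have "Z (m + n) \<le> Z m + Z n"
    using split_path[OF zs(1)] Z_ge[of _ m] Z_ge[of _ n] by fastforce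
  ultimately show ?thesis using c\<phi>_nonneg by linarith
qed

lemma Z_bound: "\<bar>Z n - real n * \<zeta>\<bar> \<le> c\<phi>" and Z_limit: "(\<lambda>n. Z n / real n) \<longlonglongrightarrow> \<zeta>"
proof -
  obtain z where z: "\<And>n. \<bar>Z n - real n * z\<bar> \<le> c\<phi>" "(\<lambda>n. Z n / real n) \<longlonglongrightarrow> z"
    using quasi_additive_limit[of Z c\<phi>] Z_quasi_additive by blast
  then have "\<zeta> = z" unfolding \<zeta>_def by (simp add: limI)
  with z show "\<bar>Z n - real n * \<zeta>\<bar> \<le> c\<phi>" "(\<lambda>n. Z n / real n) \<longlonglongrightarrow> \<zeta>" by auto
qed

text \<open>The potential is positive on finitely many symbols. This makes the cells shrink
  uniformly, whatever their path.\<close>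

lemma path_sum_ge: "\<exists>\<delta>>0. \<forall>n. \<forall>xs\<in>paths W n. real n * \<delta> \<le> path_sum \<phi> xs"
proof -
  define \<delta> where "\<delta> = Min (\<phi> ` sym_index W)"
  have ne: "sym_index W \<noteq> {}" using ex_symbol by blast
  then have "\<delta> \<in> \<phi> ` sym_index W" unfolding \<delta>_def using finite_sym_index by (intro Min_in) auto
  then have "\<delta> > 0" using \<phi>_pos by auto
  moreover have le: "\<delta> \<le> \<phi> \<sigma>" if "\<sigma> \<in> sym_index W" for \<sigma>
    unfolding \<delta>_def using that finite_sym_index by (intro Min_le) auto
  have "real n * \<delta> \<le> path_sum \<phi> xs" if "xs \<in> paths W n" for n xs
    using that
  proof (induction n arbitrary: xs)
    case (Suc n)
    then obtain \<sigma> ys where "xs = \<sigma> # ys" "\<sigma> \<in> sym_index W" "ys \<in> paths W n" by (auto elim!: paths_SucE)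
    then show ?case using Suc.IH[of ys] le[of \<sigma>] paths_not_Nil[of ys] by (simp add: algebra_simps)
  qed auto
  ultimately show ?thesis by blast
qed

lemma \<zeta>_pos: "\<zeta> > 0"
proof -
  obtain \<delta> where \<delta>: "\<delta> > 0" "\<And>n xs. xs \<in> paths W n \<Longrightarrow> real n * \<delta> \<le> path_sum \<phi> xs"
    using path_sum_ge by blast
  have "\<delta> \<le> Z n / real n" if "n \<ge> 1" for n
  proof -
    have "real n * \<delta> \<le> Z n" using \<delta>(2) Z_attained[of n] by metis
    then show ?thesis using that by (simp add: field_simps)
  qed
  then have "\<delta> \<le> \<zeta>" using LIMSEQ_le_const[OF Z_limit] by blast
  then show ?thesis using \<delta> by simp
qed

lemma leb_cell_pos: "xs \<in> paths W n \<Longrightarrow> leb (cell xs) > 0"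
  using cell_ivl[of xs n] by (auto simp: leb_ivl)

lemma path_sum_ln: "path_sum (\<lambda>\<sigma>. ln (r \<sigma>)) xs = - path_sum \<phi> xs"
  unfolding path_sum_def \<phi>_def by (simp add: uminus_sum_list_map o_def)

lemma leb_cell_ge:
  assumes "xs \<in> paths W n"
  shows "exp (- D - path_sum \<phi> xs) \<le> leb (cell xs)"
proof -
  have "- D - path_sum \<phi> xs \<le> ln (leb (cell xs))"
    using cell_size[OF assms] unfolding path_sum_ln by linarith
  then have "exp (- D - path_sum \<phi> xs) \<le> exp (ln (leb (cell xs)))" by simp
  then show ?thesis using leb_cell_pos[OF assms] by simp
qed

lemma leb_cell_le:
  assumes "xs \<in> paths W n"
  shows "leb (cell xs) \<le> exp (D - path_sum \<phi> xs)"
proof -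
  have "ln (leb (cell xs)) \<le> D - path_sum \<phi> xs"
    using cell_size[OF assms] unfolding path_sum_ln by linarith
  then have "exp (ln (leb (cell xs))) \<le> exp (D - path_sum \<phi> xs)" by simp
  then show ?thesis using leb_cell_pos[OF assms] by simp
qed

lemma lam_le_1: "lam \<alpha> \<le> 1"
  using cell_mass[of "[(\<alpha>, 0)]" 0] prob_le_1[of "cell [(\<alpha>, 0)]"] by auto

lemma cell_sets: "xs \<in> paths W n \<Longrightarrow> cell xs \<in> sets \<mu>"
  using cell_ivl[of xs n] by (auto simp: sets_\<mu>)

lemma measure_le_cells:
  assumes "Q \<subseteq> paths W n" "card Q \<le> 2" "A \<subseteq> (\<Union>xs\<in>Q. cell xs)"
  shows "measure \<mu> A \<le> 2 * exp (- (real n * \<rho>))"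
proof -
  have fin: "finite Q" using assms finite_paths finite_subset by blast
  have "measure \<mu> A \<le> measure \<mu> (\<Union>xs\<in>Q. cell xs)"
    using assms fin by (intro finite_measure_mono sets.finite_UN) (auto intro: cell_sets)
  also have "\<dots> \<le> (\<Sum>xs\<in>Q. measure \<mu> (cell xs))"
    using assms fin by (intro measure_UNION_le) (auto intro: cell_sets)
  also have "\<dots> \<le> (\<Sum>xs\<in>Q. exp (- (real n * \<rho>)))"
    using assms(1) lam_le_1 by (intro sum_mono) (auto simp: cell_mass)
  also have "\<dots> \<le> 2 * exp (- (real n * \<rho>))" using assms(2) by simp
  finally show ?thesis .
qed

text \<open>An exponent is tested from above on a shortest cell of each level. For the converse take
  the least level n at which some cell fits into the given interval: no cell of level n - 1 fits, so
  at most two of them meet the interval and bound its mass, while the fitting cell bounds its length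
  from below.\<close>

theorem holder_exponent_coded:
  assumes h: "\<And>x. x \<in> {0..1} \<Longrightarrow> h x = measure \<mu> {0..<x}"
  shows "holder_exponent h = ereal (\<rho> / \<zeta>)"
proof -
  let ?P = "\<lambda>a. 0 < a \<and> (\<exists>C>0. \<forall>x\<in>{0..1}. \<forall>y\<in>{0..1}. \<bar>h y - h x\<bar> \<le> C * \<bar>y - x\<bar> powr a)"
  have diff: "h y - h x = measure \<mu> {x..<y}" if "0 \<le> x" "x \<le> y" "y \<le> 1" for x y
  proof -
    have "measure \<mu> ({0..<x} \<union> {x..<y}) = measure \<mu> {0..<x} + measure \<mu> {x..<y}"
      by (rule finite_measure_Union) (auto simp: sets_\<mu>)
    moreover have "{0..<x} \<union> {x..<y} = {0..<y}" using that by auto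
    ultimately show ?thesis using h that by auto
  qed
  have upper: "a \<le> \<rho> / \<zeta>" if "?P a" for a
  proof (rule ccontr)
    assume "\<not> a \<le> \<rho> / \<zeta>"
    then have az: "a * \<zeta> - \<rho> > 0" using \<zeta>_pos by (simp add: field_simps)
    from that obtain C where C: "C > 0" and
      C': "\<forall>x\<in>{0..1}. \<forall>y\<in>{0..1}. \<bar>h y - h x\<bar> \<le> C * \<bar>y - x\<bar> powr a"
      by (elim conjE exE)
    define m where "m = Min (range lam)"
    have "m \<in> range lam" unfolding m_def by (rule Min_in) auto
    then have m: "m > 0" using lam_pos by auto
    have m_le: "m \<le> lam \<alpha>" for \<alpha> unfolding m_def by (rule Min_le) auto
    \<comment> \<open>The shortest cell of level n has mass of order exp (-n rho) and length at most
      of order exp (-n zeta). A Hoelder bound with a zeta > rho would keep this exponential bounded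
      in n.\<close>
    have le: "exp (real n * (a * \<zeta> - \<rho>)) \<le> C * exp ((D + c\<phi>) * a) / m" for n
    proof -
      obtain xs where xs: "xs \<in> paths W n" "path_sum \<phi> xs = Z n" using Z_attained by blast
      obtain u v where uv: "0 \<le> u" "u < v" "v \<le> 1" "cell xs = {u..<v}"
        using cell_ivl[OF xs(1)] by blast
      have "v - u \<le> exp (D - Z n)" using leb_cell_le[OF xs(1)] uv xs(2) by (simp add: leb_ivl)
      also have "\<dots> \<le> exp (D + c\<phi> - real n * \<zeta>)" using Z_bound[of n] by simp
      finally have vu: "(v - u) powr a \<le> exp ((D + c\<phi> - real n * \<zeta>) * a)"
        using uv that powr_mono2[of a "v - u" "exp (D + c\<phi> - real n * \<zeta>)"] by (simp add: powr_exp)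
      have "m * exp (- (real n * \<rho>)) \<le> measure \<mu> (cell xs)"
        using cell_mass[OF xs(1)] m_le by simp
      also have "\<dots> = h v - h u" using diff uv by simp
      also have "\<dots> \<le> C * (v - u) powr a" using C'[rule_format, of u v] uv by simp
      also have "\<dots> \<le> C * exp ((D + c\<phi> - real n * \<zeta>) * a)" using C vu by simp
      also have "\<dots> = C * exp ((D + c\<phi>) * a) * exp (- (real n * \<rho>)) * exp (- (real n * (a * \<zeta> - \<rho>)))"
        by (simp add: exp_add[symmetric] algebra_simps)
      finally have "m \<le> C * exp ((D + c\<phi>) * a) * exp (- (real n * (a * \<zeta> - \<rho>)))"
        by (simp add: mult.commute[of _ "exp (- (real n * \<rho>))"] mult.assoc)
      then have "m * exp (real n * (a * \<zeta> - \<rho>)) \<le> C * exp ((D + c\<phi>) * a) * exp (- (real n * (a * \<zeta> - \<rho>))) * exp (real n * (a * \<zeta> - \<rho>))"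
        by (rule mult_right_mono) simp
      also have "\<dots> = C * exp ((D + c\<phi>) * a)" by (simp add: exp_minus)
      finally show ?thesis using m by (simp add: pos_le_divide_eq mult.commute)
    qed
    obtain n :: nat where n: "real n * (a * \<zeta> - \<rho>) > ln (C * exp ((D + c\<phi>) * a) / m)"
      using ex_nat_mult_gt[OF az] by blast
    have "C * exp ((D + c\<phi>) * a) / m > 0" using C m by simp
    then have "C * exp ((D + c\<phi>) * a) / m < exp (real n * (a * \<zeta> - \<rho>))"
      using n by (metis exp_less_cancel_iff exp_ln)
    then show False using le[of n] by simp
  qed
  have attained: "?P (\<rho> / \<zeta>)"
  proof (intro conjI)
    show "0 < \<rho> / \<zeta>" using \<rho>_pos \<zeta>_pos by simp
    \<comment> \<open>The factor 2 counts cells, \<open>exp \<rho>\<close> pays for the step from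
      level n - 1 to n, and the last factor is the bounded error in cell lengths raised to the
      exponent.\<close>
    define C where "C = 2 * exp \<rho> * exp ((D + c\<phi>) * (\<rho> / \<zeta>))"
    have main: "h y - h x \<le> C * (y - x) powr (\<rho> / \<zeta>)" if xy: "0 \<le> x" "x < y" "y \<le> 1" for x y
    proof -
      let ?in = "\<lambda>n. \<exists>xs\<in>paths W n. cell xs \<subseteq> {x..<y}"
      have "\<exists>n. ?in n"
      proof -
        obtain \<delta> where \<delta>: "\<delta> > 0" "\<And>n xs. xs \<in> paths W n \<Longrightarrow> real n * \<delta> \<le> path_sum \<phi> xs"
          using path_sum_ge by blast
        \<comment> \<open>A cell that contains the midpoint and is shorter than half of the interval
          cannot stick out on either side.\<close>
        define z where "z = (x + y) / 2"
        obtain n :: nat where n: "real n * \<delta> > D - ln ((y - x) / 2)"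
          using ex_nat_mult_gt[OF \<delta>(1)] by blast
        have "z \<in> {0..<1}" using xy unfolding z_def by auto
        then obtain xs where xs: "xs \<in> paths W n" "z \<in> cell xs" using cell_cover[of n] by blast
        obtain u v where uv: "u < v" "cell xs = {u..<v}" using cell_ivl[OF xs(1)] by blast
        have "v - u \<le> exp (D - path_sum \<phi> xs)" using leb_cell_le[OF xs(1)] uv by (simp add: leb_ivl)
        also have "\<dots> \<le> exp (D - real n * \<delta>)" using \<delta>(2)[OF xs(1)] by simp
        also have "\<dots> < exp (ln ((y - x) / 2))" unfolding exp_less_cancel_iff using n by linarith
        also have "\<dots> = (y - x) / 2" using xy by simp
        finally have "cell xs \<subseteq> {x..<y}" using xs uv unfolding z_def by (auto simp: field_simps)
        then show ?thesis using xs by blast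
      qed
      then have "\<exists>n. ?in n \<and> (\<forall>k<n. \<not> ?in k)" by (rule exists_least_iff[THEN iffD1])
      then obtain n where n: "?in n" "\<And>k. k < n \<Longrightarrow> \<not> ?in k" by blast
      have up: "measure \<mu> {x..<y} \<le> 2 * exp \<rho> * exp (- (real n * \<rho>))"
      proof (cases n)
        \<comment> \<open>There is no coarser level to compare with; the total mass 1 is already
          small enough.\<close>
        case 0
        have "measure \<mu> {x..<y} \<le> 1" by simp
        also have "1 \<le> 2 * exp \<rho>" using \<rho>_pos one_le_exp_iff[of \<rho>] by linarith
        finally show ?thesis using 0 by simp
      next
        case (Suc k)
        let ?Q = "{xs \<in> paths W k. cell xs \<inter> {x..<y} \<noteq> {}}"
        have "card ?Q \<le> 2"
        proof (rule card_intersecting_intervals_le_2)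
          show "\<exists>u v. cell i = {u..<v}" if "i \<in> paths W k" for i using cell_ivl[OF that] by blast
          show "\<not> cell i \<subseteq> {x..<y}" if "i \<in> paths W k" for i
            using n(2)[of k] Suc that by blast
        qed (auto intro: finite_paths dest: cell_disj)
        moreover have "{x..<y} \<subseteq> (\<Union>xs\<in>?Q. cell xs)"
        proof
          fix t assume t: "t \<in> {x..<y}"
          then have "t \<in> {0..<1}" using xy by auto
          then obtain xs where "xs \<in> paths W k" "t \<in> cell xs" using cell_cover[of k] by blast
          then show "t \<in> (\<Union>xs\<in>?Q. cell xs)" using t by blast
        qed
        ultimately have "measure \<mu> {x..<y} \<le> 2 * exp (- (real k * \<rho>))"
          by (intro measure_le_cells[of ?Q]) simp_all
        also have "exp (- (real k * \<rho>)) = exp \<rho> * exp (- (real n * \<rho>))"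
          using Suc by (simp add: exp_add[symmetric] algebra_simps)
        finally show ?thesis by simp
      qed
      obtain xs where xs: "xs \<in> paths W n" "cell xs \<subseteq> {x..<y}" using n(1) by (elim bexE)
      obtain u v where uv: "u < v" "cell xs = {u..<v}" using cell_ivl[OF xs(1)] by blast
      have "exp (- D - c\<phi> - real n * \<zeta>) \<le> exp (- D - path_sum \<phi> xs)"
        using Z_ge[OF xs(1)] Z_bound[of n] by simp
      also have "\<dots> \<le> v - u" using leb_cell_ge[OF xs(1)] uv by (simp add: leb_ivl)
      also have "\<dots> \<le> y - x" using xs uv by auto
      finally have "exp ((- D - c\<phi> - real n * \<zeta>) * (\<rho> / \<zeta>)) \<le> (y - x) powr (\<rho> / \<zeta>)"
        using \<rho>_pos \<zeta>_pos powr_mono2[of "\<rho> / \<zeta>" "exp (- D - c\<phi> - real n * \<zeta>)" "y - x"]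
        by (simp add: powr_exp)
      moreover have "(- D - c\<phi> - real n * \<zeta>) * (\<rho> / \<zeta>) = - ((D + c\<phi>) * (\<rho> / \<zeta>)) - real n * \<rho>"
        using \<zeta>_pos by (simp add: field_simps)
      ultimately have "exp (- ((D + c\<phi>) * (\<rho> / \<zeta>)) - real n * \<rho>) \<le> (y - x) powr (\<rho> / \<zeta>)" by simp
      then have "C * exp (- ((D + c\<phi>) * (\<rho> / \<zeta>)) - real n * \<rho>) \<le> C * (y - x) powr (\<rho> / \<zeta>)"
        unfolding C_def by (intro mult_left_mono) auto
      moreover have "exp ((D + c\<phi>) * (\<rho> / \<zeta>)) * exp (- ((D + c\<phi>) * (\<rho> / \<zeta>)) - real n * \<rho>) = exp (- (real n * \<rho>))"
        unfolding exp_add[symmetric] by simp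
      then have "C * exp (- ((D + c\<phi>) * (\<rho> / \<zeta>)) - real n * \<rho>) = 2 * exp \<rho> * exp (- (real n * \<rho>))"
        unfolding C_def by (simp only: mult.assoc)
      ultimately show ?thesis using up diff xy by simp
    qed
    have C0: "C > 0" unfolding C_def by simp
    show "\<exists>C>0. \<forall>x\<in>{0..1}. \<forall>y\<in>{0..1}. \<bar>h y - h x\<bar> \<le> C * \<bar>y - x\<bar> powr (\<rho> / \<zeta>)"
    proof (intro exI[of _ C] conjI ballI C0)
      fix x y :: real assume xy: "x \<in> {0..1}" "y \<in> {0..1}"
      have pos: "h y - h x \<ge> 0" if "x \<le> y" "x \<in> {0..1}" "y \<in> {0..1}" for x y using diff[of x y] that by simp
      show "\<bar>h y - h x\<bar> \<le> C * \<bar>y - x\<bar> powr (\<rho> / \<zeta>)"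
      proof (cases x y rule: linorder_cases)
        case less
        then show ?thesis using main[of x y] pos[of x y] xy by simp
      next
        case greater
        then show ?thesis using main[of y x] pos[of y x] xy by simp
      qed simp
    qed
  qed
  show ?thesis unfolding holder_exponent_def
  proof (rule Sup_eqI)
    fix y assume "y \<in> ereal ` {a. ?P a}"
    then obtain a where a: "y = ereal a" "?P a" by (elim imageE CollectE)
    show "y \<le> ereal (\<rho> / \<zeta>)" using a(1) upper[OF a(2)] by simp
  next
    fix y assume "\<And>z. z \<in> ereal ` {a. ?P a} \<Longrightarrow> z \<le> y"
    moreover have "\<rho> / \<zeta> \<in> {a. ?P a}" using attained by (rule CollectI)
    ultimately show "ereal (\<rho> / \<zeta>) \<le> y" by (simp only: imageI)
  qed
qed

end

section \<open>Mass distribution relative to a set of positive measure\<close>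

section \<open>The dimension of a coded measure\<close>

text \<open>A cover of \<open>E\<close> by small sets with small t-th power sum, t < s, gives
  \<open>E \<inter> G\<close> arbitrarily small mass; but \<open>E\<close> has full measure, so this
  mass is that of \<open>G\<close>. The growth bound is asked only on \<open>G\<close> because in
  the application it fails on an exceptional set.\<close>

lemma mass_distribution:
  fixes \<mu> :: "real measure"
  assumes prob: "prob_space \<mu>" and sets: "sets \<mu> = sets borel"
    and G: "G \<in> sets borel" "measure \<mu> G > 0"
    and \<delta>: "\<delta> > 0" and C: "C \<ge> 0"
    and mass: "\<And>a b. a \<le> b \<Longrightarrow> b - a < \<delta> \<Longrightarrow> measure \<mu> ({a..b} \<inter> G) \<le> C * (b - a) powr s"
    and E: "E \<in> sets borel" "emeasure \<mu> E = 1"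
  shows "ereal s \<le> hausdorff_dim E"
proof -
  interpret prob_space \<mu> by fact
  have "s \<le> t" if t: "0 < t" "hausdorff_measure t E = 0" for t
  proof (rule ccontr)
    assume "\<not> s \<le> t"
    \<comment> \<open>Half of \<open>\<delta>\<close> makes the length bound strict; the cap 1 makes
      the s-th power of a diameter at most its t-th power.\<close>
    define d where "d = min (\<delta> / 2) 1"
    have d: "d > 0" "d < \<delta>" "d \<le> 1" using \<delta> unfolding d_def by auto
    have "hausdorff_pre t d E \<le> hausdorff_measure t E"
      unfolding hausdorff_measure_def using d by (intro SUP_upper) auto
    then have pre0: "hausdorff_pre t d E = 0" using t by simp
    have small: "emeasure \<mu> (E \<inter> G) \<le> ennreal (C * e)" if e: "e > 0" for e
    proof -
      have "hausdorff_pre t d E < ennreal e" using pre0 e by simp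
      then obtain U :: "nat \<Rightarrow> real set" where U: "E \<subseteq> (\<Union>i. U i)"
          "\<And>i. bounded (U i)" "\<And>i. diameter (U i) \<le> d"
          "(\<Sum>i. ennreal (diameter (U i) powr t)) < ennreal e"
        unfolding hausdorff_pre_def Inf_less_iff by auto
      \<comment> \<open>Covering sets are arbitrary, possibly not measurable, so each is enclosed in
        a closed interval no longer than its diameter.\<close>
      have "\<exists>a b. U i \<subseteq> {a..b} \<and> a \<le> b \<and> b - a \<le> diameter (U i)" for i
      proof (cases "U i = {}")
        case True
        then show ?thesis by (intro exI[of _ 0]) simp
      next
        case False
        have bd: "bdd_above (U i)" "bdd_below (U i)"
          by (simp_all add: U(2) bounded_imp_bdd_above bounded_imp_bdd_below)
        have le: "y - x \<le> diameter (U i)" if "x \<in> U i" "y \<in> U i" for x y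
          using diameter_bounded_bound[OF U(2) that(1) that(2)] by (simp add: dist_real_def)
        have "Sup (U i) \<le> diameter (U i) + Inf (U i)"
        proof (rule cSup_least[OF False])
          fix y assume y: "y \<in> U i"
          have "y - diameter (U i) \<le> Inf (U i)"
            by (rule cInf_greatest[OF False]) (use le[OF _ y] in force)
          then show "y \<le> diameter (U i) + Inf (U i)" by simp
        qed
        moreover have "U i \<subseteq> {Inf (U i)..Sup (U i)}"
          using bd by (auto intro: cInf_lower cSup_upper)
        ultimately show ?thesis using False by (intro exI[of _ "Inf (U i)"] exI[of _ "Sup (U i)"]) auto
      qed
      then obtain a b where ab: "\<And>i. U i \<subseteq> {a i..b i}" "\<And>i. a i \<le> b i"
          "\<And>i. b i - a i \<le> diameter (U i)" by metis
      have one: "emeasure \<mu> ({a i..b i} \<inter> G) \<le> ennreal C * ennreal (diameter (U i) powr t)" for i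
      proof -
        have "measure \<mu> ({a i..b i} \<inter> G) \<le> C * (b i - a i) powr s"
          using ab(2,3)[of i] U(3)[of i] d by (intro mass) auto
        also have "(b i - a i) powr s \<le> diameter (U i) powr s"
          using ab(2,3)[of i] t \<open>\<not> s \<le> t\<close> by (intro powr_mono2) auto
        also have "\<dots> \<le> diameter (U i) powr t"
          using U(3)[of i] d \<open>\<not> s \<le> t\<close> diameter_ge_0[OF U(2)] by (intro powr_mono') auto
        finally have "measure \<mu> ({a i..b i} \<inter> G) \<le> C * diameter (U i) powr t"
          using C by (simp add: mult_left_mono)
        then show ?thesis
          using C by (simp add: emeasure_eq_measure ennreal_mult[symmetric] ennreal_leI)
      qed
      have meas: "range (\<lambda>i. {a i..b i} \<inter> G) \<subseteq> sets \<mu>"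
        using G(1) by (simp add: sets image_subset_iff sets.Int)
      have sub: "E \<inter> G \<subseteq> (\<Union>i. {a i..b i} \<inter> G)"
      proof
        fix x assume x: "x \<in> E \<inter> G"
        then obtain i where "x \<in> U i" using U(1) by blast
        then have "x \<in> {a i..b i}" using ab(1)[of i] by blast
        then show "x \<in> (\<Union>i. {a i..b i} \<inter> G)" using x by blast
      qed
      have "emeasure \<mu> (E \<inter> G) \<le> emeasure \<mu> (\<Union>i. {a i..b i} \<inter> G)"
        by (rule emeasure_mono[OF sub sets.countable_nat_UN[OF meas]])
      also have "\<dots> \<le> (\<Sum>i. emeasure \<mu> ({a i..b i} \<inter> G))"
        by (rule emeasure_subadditive_countably[OF meas])
      also have "\<dots> \<le> (\<Sum>i. ennreal C * ennreal (diameter (U i) powr t))"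
        by (intro suminf_le one) auto
      also have "\<dots> = ennreal C * (\<Sum>i. ennreal (diameter (U i) powr t))"
        by (rule ennreal_suminf_cmult)
      also have "\<dots> \<le> ennreal C * ennreal e"
        using U(4) by (intro mult_left_mono) auto
      finally show ?thesis using C e by (simp add: ennreal_mult)
    qed
    have "measure \<mu> (E \<inter> G) \<le> e" if "e > 0" for e
    proof -
      have "emeasure \<mu> (E \<inter> G) \<le> ennreal (C * (e / (C + 1)))"
        using small[of "e / (C + 1)"] that C by simp
      then have "measure \<mu> (E \<inter> G) \<le> C * (e / (C + 1))"
        using C that by (simp add: emeasure_eq_measure)
      also have "\<dots> \<le> e" using C that by (simp add: field_simps)
      finally show ?thesis .
    qed
    then have "measure \<mu> (E \<inter> G) \<le> 0" using field_le_epsilon[of "measure \<mu> (E \<inter> G)" 0] by simp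
    \<comment> \<open>Almost every point lies in \<open>E\<close>, so intersecting with it does not
      change the mass.\<close>
    moreover have "measure \<mu> (E \<inter> G) = measure \<mu> G"
    proof -
      have "prob E = 1" using E by (simp add: measure_def)
      then have "AE x in \<mu>. x \<in> E" using E sets by (simp add: AE_in_set_eq_1)
      then show ?thesis
        using E G sets by (intro measure_eq_AE) (auto simp del: Int_iff elim!: eventually_mono)
    qed
    ultimately show False using G by simp
  qed
  then show ?thesis
    unfolding hausdorff_dim_def by (intro Inf_greatest) auto
qed

section \<open>The subaction, the weighted transfer operator and the strict dimension bound\<close>

context coded_measure
begin

interpretation prob_space \<mu> by (rule prob)

text \<open>A subaction for the normalised potential: \<open>\<phi> - \<zeta>\<close> is cohomologous to \<open>g \<le> 0\<close>.\<close>

definition V :: "'a \<Rightarrow> real" where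
  "V \<alpha> = Sup {path_sum \<phi> xs - real n * \<zeta> | n xs. xs \<in> paths W n \<and> fst (hd xs) = \<alpha>}"

definition g :: "'a \<times> nat \<Rightarrow> real" where
  "g \<sigma> = \<phi> \<sigma> - \<zeta> - V (fst \<sigma>) + V (sym_target W \<sigma>)"

text \<open>The supremum is finite because a maximal path sum exceeds n zeta by at most
  \<open>c\<phi>\<close>.\<close>

lemma V_upper:
  assumes "xs \<in> paths W n"
  shows "path_sum \<phi> xs - real n * \<zeta> \<le> V (fst (hd xs))"
  unfolding V_def
proof (rule cSup_upper)
  show "bdd_above {path_sum \<phi> xs' - real n * \<zeta> | n xs'. xs' \<in> paths W n \<and> fst (hd xs') = fst (hd xs)}"
  proof (rule bdd_aboveI[of _ c\<phi>])
    fix x assume "x \<in> {path_sum \<phi> xs' - real n * \<zeta> | n xs'. xs' \<in> paths W n \<and> fst (hd xs') = fst (hd xs)}"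
    then obtain n ys where "x = path_sum \<phi> ys - real n * \<zeta>" "ys \<in> paths W n" by blast
    then show "x \<le> c\<phi>" using Z_ge[of ys n] Z_bound[of n] by linarith
  qed
qed (use assms in blast)

text \<open>Prepending \<sigma> to a path that currently ends at its target yields a competitor for
  \<open>V (fst \<sigma>)\<close>, so \<open>V (fst \<sigma>)\<close> is at least
  \<open>\<phi> \<sigma> - \<zeta> + V (sym_target W \<sigma>)\<close>.\<close>

lemma g_nonpos:
  assumes "\<sigma> \<in> sym_index W"
  shows "g \<sigma> \<le> 0"
proof -
  have "V (sym_target W \<sigma>) \<le> V (fst \<sigma>) - \<phi> \<sigma> + \<zeta>"
    unfolding V_def[of "sym_target W \<sigma>"]
  proof (rule cSup_least)
    have "[(sym_target W \<sigma>, 0)] \<in> paths W 0" by simp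
    then show "{path_sum \<phi> xs - real n * \<zeta> | n xs. xs \<in> paths W n \<and> fst (hd xs) = sym_target W \<sigma>} \<noteq> {}"
      by fastforce
  next
    fix x assume "x \<in> {path_sum \<phi> xs - real n * \<zeta> | n xs. xs \<in> paths W n \<and> fst (hd xs) = sym_target W \<sigma>}"
    then obtain n xs where x: "x = path_sum \<phi> xs - real n * \<zeta>" "xs \<in> paths W n"
        "fst (hd xs) = sym_target W \<sigma>" by blast
    then have "\<sigma> # xs \<in> paths W (Suc n)" using assms by simp
    from V_upper[OF this] show "x \<le> V (fst \<sigma>) - \<phi> \<sigma> + \<zeta>"
      using x paths_not_Nil[OF x(2)] by (simp add: algebra_simps)
  qed
  then show ?thesis unfolding g_def by simp
qed

lemma path_sum_g:
  "xs \<in> paths W n \<Longrightarrow>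
     path_sum g xs = path_sum \<phi> xs - real n * \<zeta> - V (fst (hd xs)) + V (fst (last xs))"
proof (induction n arbitrary: xs)
  case (Suc n)
  then obtain \<sigma> ys where ys: "xs = \<sigma> # ys" "ys \<in> paths W n" "sym_target W \<sigma> = fst (hd ys)"
    by (auto elim!: paths_SucE)
  then show ?case using Suc.IH[OF ys(2)] paths_not_Nil[OF ys(2)] by (simp add: g_def algebra_simps)
qed auto

definition cV :: real where "cV = 2 * (\<Sum>\<alpha>\<in>UNIV. \<bar>V \<alpha>\<bar>)"

lemma path_sum_g_bound:
  assumes "xs \<in> paths W n"
  shows "path_sum \<phi> xs \<le> real n * \<zeta> + path_sum g xs + cV"
proof -
  have "\<bar>V \<alpha>\<bar> \<le> (\<Sum>\<alpha>\<in>UNIV. \<bar>V \<alpha>\<bar>)" for \<alpha> by (rule member_le_sum) auto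
  from this[of "fst (hd xs)"] this[of "fst (last xs)"] show ?thesis
    unfolding path_sum_g[OF assms] cV_def by linarith
qed

text \<open>The mass of a cell times the exponential of its g-sum. Summed over a level, this is the
  integral of \<open>exp (path_sum g)\<close>.\<close>

definition wt :: "('a \<times> nat) list \<Rightarrow> nat \<Rightarrow> real" where
  "wt xs n = exp (- (real n * \<rho>)) * lam (fst (hd xs)) * exp (path_sum g xs)"

text \<open>The factor before \<open>exp (g \<sigma>)\<close> is the Parry transition probability
  from \<open>sym_target W \<sigma>\<close> to \<open>fst \<sigma>\<close>.\<close>

definition tr :: "'a \<times> nat \<Rightarrow> real" where
  "tr \<sigma> = exp (- \<rho>) * lam (fst \<sigma>) / lam (sym_target W \<sigma>) * exp (g \<sigma>)"

abbreviation succs :: "'a \<Rightarrow> ('a \<times> nat) set" where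
  "succs \<beta> \<equiv> {\<sigma>. \<sigma> \<in> sym_index W \<and> sym_target W \<sigma> = \<beta>}"

definition R :: "'a \<Rightarrow> real" where "R \<beta> = (\<Sum>\<sigma>\<in>succs \<beta>. tr \<sigma>)"

text \<open>Two steps of the operator applied to the constant 1. One step need not contract: a
  symbol with g < 0 is available only from its own target. Every letter can move to that target
  first.\<close>

definition R2 :: "'a \<Rightarrow> real" where "R2 \<beta> = (\<Sum>\<sigma>\<in>succs \<beta>. tr \<sigma> * R (fst \<sigma>))"

lemma finite_succs: "finite (succs \<beta>)"
  using finite_sym_index by (rule finite_subset[rotated]) auto

lemma tr_pos: "tr \<sigma> > 0"
  unfolding tr_def using lam_pos by simp

text \<open>The left eigenvector equation for \<open>lam\<close> makes the Parry weights
  stochastic.\<close>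

lemma sum_parry: "(\<Sum>\<sigma>\<in>succs \<beta>. exp (- \<rho>) * lam (fst \<sigma>) / lam (sym_target W \<sigma>)) = 1"
proof -
  have "(\<Sum>\<sigma>\<in>succs \<beta>. exp (- \<rho>) * lam (fst \<sigma>) / lam (sym_target W \<sigma>))
    = (\<Sum>\<sigma>\<in>succs \<beta>. (exp (- \<rho>) / lam \<beta>) * lam (fst \<sigma>))" by (rule sum.cong) auto
  also have "\<dots> = (exp (- \<rho>) / lam \<beta>) * (exp \<rho> * lam \<beta>)"
    unfolding sum_distrib_left[symmetric] lam_eigen ..
  also have "\<dots> = 1" using lam_pos[of \<beta>] by (simp add: exp_minus)
  finally show ?thesis .
qed

lemma tr_le: "\<sigma> \<in> sym_index W \<Longrightarrow> tr \<sigma> \<le> exp (- \<rho>) * lam (fst \<sigma>) / lam (sym_target W \<sigma>)"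
  unfolding tr_def using g_nonpos[of \<sigma>] lam_pos[of "fst \<sigma>"] lam_pos[of "sym_target W \<sigma>"]
  by (intro mult_right_le_one_le) auto

lemma R_le_1: "R \<beta> \<le> 1"
  unfolding R_def sum_parry[of \<beta>, symmetric] by (intro sum_mono tr_le) auto

lemma R_nonneg: "R \<beta> \<ge> 0"
  unfolding R_def by (intro sum_nonneg less_imp_le tr_pos)

text \<open>The symbol with g < 0 makes R strictly smaller than 1 at its target, and from each
  letter some symbol of positive weight leads to that target.\<close>

lemma R2_less_1:
  assumes "\<sigma>\<^sub>0 \<in> sym_index W" "g \<sigma>\<^sub>0 < 0"
  shows "R2 \<beta> < 1"
proof -
  let ?\<beta> = "sym_target W \<sigma>\<^sub>0"
  have "R ?\<beta> < (\<Sum>\<sigma>\<in>succs ?\<beta>. exp (- \<rho>) * lam (fst \<sigma>) / lam (sym_target W \<sigma>))"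
    unfolding R_def
  proof (rule sum_strict_mono_ex1[OF finite_succs])
    show "\<forall>x\<in>succs ?\<beta>. tr x \<le> exp (- \<rho>) * lam (fst x) / lam (sym_target W x)"
      using tr_le by blast
    have "tr \<sigma>\<^sub>0 < exp (- \<rho>) * lam (fst \<sigma>\<^sub>0) / lam ?\<beta>"
      unfolding tr_def using assms lam_pos[of "fst \<sigma>\<^sub>0"] lam_pos[of ?\<beta>]
        mult_strict_left_mono[of "exp (g \<sigma>\<^sub>0)" 1 "exp (- \<rho>) * lam (fst \<sigma>\<^sub>0) / lam ?\<beta>"]
      by (simp del: times_divide_eq_left)
    then show "\<exists>a\<in>succs ?\<beta>. tr a < exp (- \<rho>) * lam (fst a) / lam (sym_target W a)"
      using assms by blast
  qed
  then have R0: "R ?\<beta> < 1" unfolding sum_parry .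
  obtain \<tau> where \<tau>: "\<tau> \<in> succs \<beta>" "fst \<tau> = ?\<beta>" using ex_symbol by blast
  have "R2 \<beta> < (\<Sum>\<sigma>\<in>succs \<beta>. tr \<sigma>)"
    unfolding R2_def
  proof (rule sum_strict_mono_ex1[OF finite_succs])
    show "\<forall>x\<in>succs \<beta>. tr x * R (fst x) \<le> tr x"
      using tr_pos R_le_1 R_nonneg by (auto intro!: mult_right_le_one_le simp: less_imp_le)
    show "\<exists>a\<in>succs \<beta>. tr a * R (fst a) < tr a"
      using R0 \<tau> tr_pos[of \<tau>] by (intro bexI[of _ \<tau>]) auto
  qed
  also have "\<dots> \<le> 1" using R_le_1[of \<beta>] unfolding R_def .
  finally show ?thesis .
qed

lemma wt_Cons:
  assumes "xs \<in> paths W n" "\<sigma> \<in> succs (fst (hd xs))"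
  shows "wt (\<sigma> # xs) (Suc n) = wt xs n * tr \<sigma>"
proof -
  have "exp (- (real (Suc n) * \<rho>)) = exp (- (real n * \<rho>)) * exp (- \<rho>)"
    by (simp add: exp_add[symmetric] algebra_simps)
  then show ?thesis
    using assms lam_pos[of "fst (hd xs)"] paths_not_Nil[OF assms(1)]
    by (simp add: wt_def tr_def exp_add)
qed

lemma wt_pos: "wt xs n > 0"
  unfolding wt_def using lam_pos by simp

text \<open>Extending all paths by one symbol acts on functions of the current letter as the
  transfer operator with weights \<open>tr\<close>.\<close>

lemma sum_wt_Suc:
  "(\<Sum>xs\<in>paths W (Suc n). wt xs (Suc n) * F (fst (hd xs)))
     = (\<Sum>xs\<in>paths W n. wt xs n * (\<Sum>\<sigma>\<in>succs (fst (hd xs)). tr \<sigma> * F (fst \<sigma>)))"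
  unfolding sum_paths_Suc
proof (rule sum.cong[OF refl])
  fix xs assume xs: "xs \<in> paths W n"
  show "(\<Sum>\<sigma>\<in>succs (fst (hd xs)). wt (\<sigma> # xs) (Suc n) * F (fst (hd (\<sigma> # xs))))
    = wt xs n * (\<Sum>\<sigma>\<in>succs (fst (hd xs)). tr \<sigma> * F (fst \<sigma>))"
    unfolding sum_distrib_left
  proof (rule sum.cong[OF refl])
    fix \<sigma> assume "\<sigma> \<in> succs (fst (hd xs))"
    from wt_Cons[OF xs this] show "wt (\<sigma> # xs) (Suc n) * F (fst (hd (\<sigma> # xs))) = wt xs n * (tr \<sigma> * F (fst \<sigma>))"
      by (simp only: list.sel mult.assoc)
  qed
qed

lemma sum_wt_even:
  assumes "\<And>\<beta>. R2 \<beta> \<le> \<theta>"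
  shows "(\<Sum>xs\<in>paths W (2 * k). wt xs (2 * k)) \<le> (\<Sum>xs\<in>paths W 0. wt xs 0) * \<theta> ^ k"
proof (induction k)
  case (Suc k)
  \<comment> \<open>Any letter would do; its only purpose is to see that \<theta> is
    nonnegative.\<close>
  have "0 \<le> R2 undefined"
    unfolding R2_def by (intro sum_nonneg mult_nonneg_nonneg R_nonneg less_imp_le tr_pos)
  then have \<theta>: "\<theta> \<ge> 0" using assms by (rule order_trans)
  have "(\<Sum>xs\<in>paths W (2 * Suc k). wt xs (2 * Suc k))
      = (\<Sum>xs\<in>paths W (Suc (2 * k)). wt xs (Suc (2 * k)) * R (fst (hd xs)))"
    using sum_wt_Suc[of "Suc (2 * k)" "\<lambda>_. 1"] by (simp add: R_def)
  also have "\<dots> = (\<Sum>xs\<in>paths W (2 * k). wt xs (2 * k) * R2 (fst (hd xs)))"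
    unfolding sum_wt_Suc R2_def ..
  also have "\<dots> \<le> (\<Sum>xs\<in>paths W (2 * k). wt xs (2 * k) * \<theta>)"
    by (intro sum_mono mult_left_mono assms less_imp_le wt_pos)
  also have "\<dots> = (\<Sum>xs\<in>paths W (2 * k). wt xs (2 * k)) * \<theta>" by (simp add: sum_distrib_right)
  also have "\<dots> \<le> (\<Sum>xs\<in>paths W 0. wt xs 0) * \<theta> ^ k * \<theta>" by (intro mult_right_mono Suc \<theta>)
  finally show ?case by (simp add: mult_ac)
qed simp

text \<open>Outside a set of measure below 1, and from some level on, the g-sum at level 2k is at
  most k ln \<eta> < 0, so the cells of typical points are exponentially longer than exp (-2 k
  zeta). Only these long cells are counted in the mass bound for short intervals.\<close>

theorem measure_dim_coded:
  assumes noncob: "\<not> (\<exists>V k. \<forall>\<sigma>\<in>sym_index W. ln (r \<sigma>) = k + V (fst \<sigma>) - V (sym_target W \<sigma>))"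
  shows "ereal (\<rho> / \<zeta>) < measure_dim \<mu>"
proof -
  \<comment> \<open>If g vanished on all symbols, \<open>ln (r \<sigma>)\<close> would be
    cohomologous to the constant -\<zeta> through -V.\<close>
  obtain \<sigma>\<^sub>0 where \<sigma>\<^sub>0: "\<sigma>\<^sub>0 \<in> sym_index W" "g \<sigma>\<^sub>0 < 0"
  proof (rule ccontr)
    assume "\<not> thesis"
    then have "g \<sigma> = 0" if "\<sigma> \<in> sym_index W" for \<sigma>
      using g_nonpos[OF that] \<open>\<And>\<sigma>\<^sub>0. \<sigma>\<^sub>0 \<in> sym_index W \<Longrightarrow> g \<sigma>\<^sub>0 < 0 \<Longrightarrow> thesis\<close> that by fastforce
    then have "\<forall>\<sigma>\<in>sym_index W. ln (r \<sigma>) = - \<zeta> + (- V (fst \<sigma>)) - (- V (sym_target W \<sigma>))"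
      unfolding g_def \<phi>_def by fastforce
    then show False using noncob by (elim notE) (intro exI[of _ "\<lambda>\<alpha>. - V \<alpha>"] exI[of _ "- \<zeta>"])
  qed
  define \<theta> where "\<theta> = Max (range R2)"
  have "\<theta> \<in> range R2" unfolding \<theta>_def by (rule Max_in) auto
  then have \<theta>1: "\<theta> < 1" using R2_less_1[OF \<sigma>\<^sub>0] by auto
  have \<theta>: "R2 \<beta> \<le> \<theta>" for \<beta> unfolding \<theta>_def by (rule Max_ge) auto
  \<comment> \<open>The square of \<eta> dominates \<open>R2\<close>, so Markov's inequality at
    threshold \<eta>^k still leaves a factor \<eta>^k. The term exp (-\<zeta>) keeps \<eta> positive
    and bounds ln \<eta> below by -\<zeta>, which keeps \<kappa> positive.\<close>
  define \<eta> where "\<eta> = max (sqrt (max \<theta> 0)) (exp (- \<zeta>))"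
  have \<eta>: "0 < \<eta>" "\<eta> < 1" "- \<zeta> \<le> ln \<eta>" "ln \<eta> < 0"
  proof -
    show "0 < \<eta>" unfolding \<eta>_def by (simp add: less_max_iff_disj)
    show "\<eta> < 1" unfolding \<eta>_def using \<theta>1 \<zeta>_pos by simp
    show "- \<zeta> \<le> ln \<eta>" using \<open>0 < \<eta>\<close> by (subst ln_ge_iff) (simp_all add: \<eta>_def)
    show "ln \<eta> < 0" using \<open>0 < \<eta>\<close> \<open>\<eta> < 1\<close> by simp
  qed
  have \<theta>\<eta>: "R2 \<beta> \<le> \<eta> * \<eta>" for \<beta>
  proof -
    have "R2 \<beta> \<le> sqrt (max \<theta> 0) * sqrt (max \<theta> 0)" using \<theta>[of \<beta>] by simp
    also have "\<dots> \<le> \<eta> * \<eta>" by (rule mult_mono) (auto simp: \<eta>_def le_max_iff_disj)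
    finally show ?thesis .
  qed
  define H where "H = (\<Sum>xs\<in>paths W 0. wt xs 0)"
  have H: "H \<ge> 0" unfolding H_def by (intro sum_nonneg less_imp_le wt_pos)
  \<comment> \<open>Cells whose g-sum is too close to 0; their total mass is estimated by Markov's
    inequality from the sums of \<open>wt\<close>.\<close>
  define bad where "bad k = {xs \<in> paths W (2 * k). exp (path_sum g xs) > \<eta> ^ k}" for k
  define B where "B k = (\<Union>xs\<in>bad k. cell xs)" for k
  have fin_bad: "finite (bad k)" for k
    unfolding bad_def by (rule finite_subset[OF _ finite_paths[of W "2 * k"]]) auto
  have B_sets: "B k \<in> sets \<mu>" for k
    unfolding B_def using fin_bad by (intro sets.finite_UN cell_sets) (auto simp: bad_def)
  have B_meas: "measure \<mu> (B k) \<le> H * \<eta> ^ k" for k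
  proof -
    have "measure \<mu> (B k) \<le> (\<Sum>xs\<in>bad k. measure \<mu> (cell xs))"
      unfolding B_def using fin_bad by (intro measure_UNION_le) (auto simp: bad_def intro: cell_sets)
    also have "\<dots> \<le> (\<Sum>xs\<in>bad k. wt xs (2 * k) / \<eta> ^ k)"
    proof (rule sum_mono)
      fix xs assume xs: "xs \<in> bad k"
      then have p: "xs \<in> paths W (2 * k)" and "exp (path_sum g xs) > \<eta> ^ k" unfolding bad_def by auto
      then have "1 \<le> exp (path_sum g xs) / \<eta> ^ k" using \<eta> by simp
      then have "measure \<mu> (cell xs) * 1 \<le> measure \<mu> (cell xs) * (exp (path_sum g xs) / \<eta> ^ k)"
        by (rule mult_left_mono) simp
      also have "\<dots> = wt xs (2 * k) / \<eta> ^ k" unfolding wt_def cell_mass[OF p] by simp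
      finally show "measure \<mu> (cell xs) \<le> wt xs (2 * k) / \<eta> ^ k" by simp
    qed
    also have "\<dots> \<le> (\<Sum>xs\<in>paths W (2 * k). wt xs (2 * k) / \<eta> ^ k)"
      using \<eta> wt_pos by (intro sum_mono2 finite_paths) (auto simp: bad_def less_imp_le)
    also have "\<dots> = (\<Sum>xs\<in>paths W (2 * k). wt xs (2 * k)) / \<eta> ^ k" by (simp add: sum_divide_distrib)
    also have "\<dots> \<le> H * (\<eta> * \<eta>) ^ k / \<eta> ^ k"
      unfolding H_def using \<eta> by (intro divide_right_mono sum_wt_even \<theta>\<eta>) auto
    also have "\<dots> = H * \<eta> ^ k" using \<eta> by (simp add: power_mult_distrib)
    finally show ?thesis .
  qed
  \<comment> \<open>A geometric tail: all bad sets of index at least K together have mass below 1,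
    so a good set of positive measure remains.\<close>
  obtain K where K: "H * \<eta> ^ K / (1 - \<eta>) < 1"
  proof -
    have "(\<lambda>K. H * \<eta> ^ K / (1 - \<eta>)) \<longlonglongrightarrow> H * 0 / (1 - \<eta>)"
      using \<eta> by (intro tendsto_intros LIMSEQ_power_zero) auto
    then have "\<forall>\<^sub>F K in sequentially. H * \<eta> ^ K / (1 - \<eta>) < 1"
      by (rule order_tendstoD(2)) simp
    then show ?thesis using that eventually_sequentially by auto
  qed
  define BK where "BK = (\<Union>k. B (K + k))"
  have BK_sets: "BK \<in> sets \<mu>" unfolding BK_def using B_sets by auto
  have BK_meas: "measure \<mu> BK < 1"
  proof -
    have le: "measure \<mu> (B (K + k)) \<le> H * \<eta> ^ K * \<eta> ^ k" for k
      using B_meas[of "K + k"] by (simp add: power_add mult.assoc)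
    have sm: "summable (\<lambda>k. H * \<eta> ^ K * \<eta> ^ k)" using \<eta> by (intro summable_mult summable_geometric) auto
    have sm2: "summable (\<lambda>k. measure \<mu> (B (K + k)))"
      using le by (intro summable_comparison_test'[OF sm, of 0]) auto
    have "measure \<mu> BK \<le> (\<Sum>k. measure \<mu> (B (K + k)))"
      unfolding BK_def using B_sets sm2 by (intro finite_measure_subadditive_countably) auto
    also have "\<dots> \<le> (\<Sum>k. H * \<eta> ^ K * \<eta> ^ k)" by (intro suminf_le le sm sm2)
    also have "\<dots> = H * \<eta> ^ K / (1 - \<eta>)"
      using \<eta> by (subst suminf_mult) (auto intro: summable_geometric simp: suminf_geometric)
    finally show ?thesis using K by simp
  qed
  define G where "G = {0..<1} - BK"
  have G_sets: "G \<in> sets borel" unfolding G_def using BK_sets by (simp add: sets_\<mu>)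
  have G_pos: "measure \<mu> G > 0"
  proof -
    have "measure \<mu> {0..<1} \<le> measure \<mu> (G \<union> BK)"
      using G_sets BK_sets by (intro finite_measure_mono) (auto simp: G_def sets_\<mu>)
    also have "\<dots> \<le> measure \<mu> G + measure \<mu> BK"
      using G_sets BK_sets by (intro measure_Un_le) (auto simp: sets_\<mu>)
    finally show ?thesis using BK_meas unit by simp
  qed
  \<comment> \<open>The decay rate of good cells per two levels. Since it is smaller than 2 \<zeta>,
    the exponent s = 2 \<rho> / \<kappa> exceeds \<rho> / \<zeta>.\<close>
  define \<kappa> where "\<kappa> = 2 * \<zeta> + ln \<eta>"
  have \<kappa>: "\<kappa> > 0" "\<kappa> < 2 * \<zeta>" unfolding \<kappa>_def using \<eta> \<zeta>_pos by auto
  define c where "c = exp (- D - cV)"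
  have c: "c > 0" unfolding c_def by simp
  define s where "s = 2 * \<rho> / \<kappa>"
  have s: "\<rho> / \<zeta> < s" "s > 0" unfolding s_def using \<kappa> \<rho>_pos \<zeta>_pos by (auto simp: field_simps)
  have good_size: "c * exp (- (real k * \<kappa>)) \<le> leb (cell xs)" if xs: "xs \<in> paths W (2 * k)" "xs \<notin> bad k" for k xs
  proof -
    have "exp (path_sum g xs) \<le> exp (ln (\<eta> ^ k))" using xs \<eta> unfolding bad_def by auto
    then have "path_sum g xs \<le> real k * ln \<eta>" using \<eta> by (simp add: ln_realpow)
    then have "path_sum \<phi> xs \<le> real k * \<kappa> + cV"
      using path_sum_g_bound[OF xs(1)] unfolding \<kappa>_def by (simp add: algebra_simps)
    then have "exp (- D - cV - real k * \<kappa>) \<le> exp (- D - path_sum \<phi> xs)" by simp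
    also have "\<dots> \<le> leb (cell xs)" by (rule leb_cell_ge[OF xs(1)])
    finally show ?thesis unfolding c_def exp_add[symmetric] by simp
  qed
  have short: "measure \<mu> ({a..b} \<inter> G) \<le> 2 * exp (- (real (2 * k) * \<rho>))"
    if "a \<le> b" "b - a < c * exp (- (real k * \<kappa>))" "K \<le> k" for a b k
  proof -
    let ?A = "paths W (2 * k) - bad k"
    let ?Q = "{xs \<in> ?A. cell xs \<inter> {a..b} \<noteq> {}}"
    have "card ?Q \<le> 2"
    proof (rule card_intersecting_intervals_le_2)
      show "\<exists>u v. cell i = {u..<v}" if "i \<in> ?A" for i using cell_ivl[of i "2 * k"] that by auto
      show "cell i \<inter> cell j = {}" if "i \<in> ?A" "j \<in> ?A" "i \<noteq> j" for i j
        using cell_disj[of i "2 * k" j] that by simp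
      show "finite ?A" using finite_paths by auto
      show "\<not> cell i \<subseteq> {a..b}" if i: "i \<in> ?A" for i
      proof
        assume sub: "cell i \<subseteq> {a..b}"
        from cell_ivl[OF DiffD1[OF i]] obtain u v where uv: "u < v" "cell i = {u..<v}"
          by (elim exE conjE)
        then have "leb (cell i) \<le> b - a"
          using sub by (simp add: leb_ivl atLeastLessThan_subseteq_atLeastAtMost_iff)
        moreover have "i \<notin> bad k" using i by simp
        ultimately show False using good_size[OF DiffD1[OF i]]
            \<open>b - a < c * exp (- (real k * \<kappa>))\<close> by linarith
      qed
    qed auto
    moreover have "{a..b} \<inter> G \<subseteq> (\<Union>xs\<in>?Q. cell xs)"
    proof
      fix x assume x: "x \<in> {a..b} \<inter> G"
      then have "x \<in> {0..<1}" unfolding G_def by blast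
      then obtain xs where xs: "xs \<in> paths W (2 * k)" "x \<in> cell xs" using cell_cover[of "2 * k"] by blast
      have "xs \<notin> bad k"
      proof
        assume "xs \<in> bad k"
        then have "x \<in> B (K + (k - K))" unfolding B_def using xs \<open>K \<le> k\<close> by auto
        then show False using x unfolding G_def BK_def by blast
      qed
      then show "x \<in> (\<Union>xs\<in>?Q. cell xs)" using xs x by blast
    qed
    ultimately show ?thesis by (intro measure_le_cells[of ?Q]) auto
  qed
  \<comment> \<open>Two cells give the 2, the two levels between index k and k + 1 give exp (2
    \<rho>), and \<open>c powr s\<close> compensates the constant in the length of good
    cells.\<close>
  define C where "C = 2 * exp (2 * \<rho>) / c powr s"
  have C: "C \<ge> 0" unfolding C_def by simp
  have vanish: "(\<lambda>k. c * exp (- (real k * \<kappa>))) \<longlonglongrightarrow> 0" "(\<lambda>k. 2 * exp (- (real (2 * k) * \<rho>))) \<longlonglongrightarrow> 0"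
  proof -
    have e: "(\<lambda>k. a * exp (- (real k * x))) \<longlonglongrightarrow> 0" if "x > 0" for a x
    proof -
      have "(\<lambda>k. a * exp (- x) ^ k) \<longlonglongrightarrow> a * 0"
        using that by (intro tendsto_intros LIMSEQ_power_zero) auto
      then show ?thesis by (simp add: exp_of_nat_mult[symmetric])
    qed
    show "(\<lambda>k. c * exp (- (real k * \<kappa>))) \<longlonglongrightarrow> 0" using e \<kappa> by blast
    show "(\<lambda>k. 2 * exp (- (real (2 * k) * \<rho>))) \<longlonglongrightarrow> 0"
      using e[of "2 * \<rho>" 2] \<rho>_pos by (simp add: mult_ac)
  qed
  have mass: "measure \<mu> ({a..b} \<inter> G) \<le> C * (b - a) powr s"
    if ab: "a \<le> b" "b - a < c * exp (- (real K * \<kappa>))" for a b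
  proof (cases "a = b")
    \<comment> \<open>Here \<open>(b - a) powr s\<close> is 0, so a point of \<open>G\<close> must
      be shown to have no mass; this follows from arbitrarily deep levels.\<close>
    case True
    have "measure \<mu> ({a..b} \<inter> G) \<le> 2 * exp (- (real (2 * k) * \<rho>))" if "k \<ge> K" for k
      using that True c by (intro short) auto
    then have "measure \<mu> ({a..b} \<inter> G) \<le> 0" by (intro LIMSEQ_le_const[OF vanish(2)]) auto
    then show ?thesis using True by simp
  next
    case False
    then have pos: "b - a > 0" using ab by simp
    then have "\<forall>\<^sub>F k in sequentially. c * exp (- (real k * \<kappa>)) < b - a"
      using order_tendstoD(2)[OF vanish(1)] by blast
    then obtain k0 where "c * exp (- (real k0 * \<kappa>)) < b - a" using eventually_sequentially by auto
    then have "\<exists>k. c * exp (- (real k * \<kappa>)) \<le> b - a" by (intro exI[of _ k0]) simp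
    then have "\<exists>k. c * exp (- (real k * \<kappa>)) \<le> b - a \<and> (\<forall>j<k. \<not> c * exp (- (real j * \<kappa>)) \<le> b - a)"
      by (rule exists_least_iff[THEN iffD1])
    then obtain m where m: "c * exp (- (real m * \<kappa>)) \<le> b - a"
        "\<And>j. j < m \<Longrightarrow> b - a < c * exp (- (real j * \<kappa>))" by (auto simp: not_le)
    have "K < m"
    proof (rule ccontr)
      assume "\<not> K < m"
      then have "c * exp (- (real K * \<kappa>)) \<le> c * exp (- (real m * \<kappa>))" using c \<kappa> by simp
      then show False using m(1) ab by linarith
    qed
    then obtain k where k: "m = Suc k" "K \<le> k" by (cases m) auto
    have up: "measure \<mu> ({a..b} \<inter> G) \<le> 2 * exp (- (real (2 * k) * \<rho>))"
      using m(2)[of k] k ab by (intro short) auto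
    have "(c * exp (- (real m * \<kappa>))) powr s \<le> (b - a) powr s"
      using m(1) c s by (intro powr_mono2) auto
    then have "c powr s * exp (- (real m * \<kappa>) * s) \<le> (b - a) powr s"
      using c by (simp add: powr_mult powr_exp)
    moreover have "- (real m * \<kappa>) * s = - (real (2 * k) * \<rho>) - 2 * \<rho>"
      unfolding s_def k(1) using \<kappa> by (simp add: field_simps)
    ultimately have "c powr s * exp (- (real (2 * k) * \<rho>) - 2 * \<rho>) \<le> (b - a) powr s" by simp
    then have "C * (c powr s * exp (- (real (2 * k) * \<rho>) - 2 * \<rho>)) \<le> C * (b - a) powr s"
      using C by (rule mult_left_mono)
    also have "C * (c powr s * exp (- (real (2 * k) * \<rho>) - 2 * \<rho>)) = 2 * (exp (2 * \<rho>) * exp (- (real (2 * k) * \<rho>) - 2 * \<rho>))"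
      unfolding C_def using c by simp
    also have "exp (2 * \<rho>) * exp (- (real (2 * k) * \<rho>) - 2 * \<rho>) = exp (- (real (2 * k) * \<rho>))"
      unfolding exp_add[symmetric] by simp
    finally show ?thesis using up by linarith
  qed
  have "ereal s \<le> hausdorff_dim E" if "E \<in> sets borel" "emeasure \<mu> E = 1" for E
    using c by (intro mass_distribution[OF prob sets_\<mu> G_sets G_pos _ C mass that]) auto
  then have "ereal s \<le> measure_dim \<mu>"
    unfolding measure_dim_def by (intro Inf_greatest) auto
  then show ?thesis using s by (meson ereal_less_le less_ereal.simps(1) less_le_trans)
qed

end

section \<open>Exchanges of intervals in permutation-free form, and their first return\<close>

section \<open>One step of Rauzy--Veech induction\<close>

text \<open>The interval with the largest left end reaches L: otherwise its right end would lie in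
  an interval that starts no later and hence overlaps it.\<close>

lemma last_letter_order_position:
  fixes K :: "'a::finite \<Rightarrow> real set"
  assumes iv: "\<And>\<alpha>. \<exists>a b. a < b \<and> K \<alpha> = {a..<b}"
    and dj: "\<And>\<alpha> \<beta>. \<alpha> \<noteq> \<beta> \<Longrightarrow> K \<alpha> \<inter> K \<beta> = {}"
    and un: "(\<Union>\<alpha>. K \<alpha>) = {0..<L}"
  shows "\<exists>c. 0 \<le> c \<and> c < L \<and> K (last_letter (order_position K)) = {c..<L}"
proof -
  obtain a b where ab: "\<And>\<alpha>. a \<alpha> < b \<alpha>" "\<And>\<alpha>. K \<alpha> = {a \<alpha>..<b \<alpha>}"
    using iv by metis
  have Inf_K: "Inf (K \<alpha>) = a \<alpha>" for \<alpha> using ab by simp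
  have a_in: "a \<alpha> \<in> K \<alpha>" for \<alpha> using ab by simp
  have inj: "\<alpha> = \<beta>" if "a \<alpha> = a \<beta>" for \<alpha> \<beta>
    using dj[of \<alpha> \<beta>] a_in[of \<alpha>] a_in[of \<beta>] that by (cases "\<alpha> = \<beta>") auto
  have "Max (range a) \<in> range a" by (rule Max_in) auto
  then obtain l where "a l = Max (range a)" by (metis imageE)
  then have l: "a \<beta> \<le> a l" for \<beta> by simp
  have pos_l: "order_position K l = CARD('a)"
    unfolding order_position_def Inf_K using l by simp
  \<comment> \<open>\<open>inv\<close> is a choice operator, so the letter of rank
    \<open>CARD('a)\<close> has to be shown unique before it can be identified.\<close>
  have uniq: "\<alpha> = l" if "order_position K \<alpha> = CARD('a)" for \<alpha>
  proof -
    have "{\<beta>. a \<beta> \<le> a \<alpha>} = UNIV"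
      using that unfolding order_position_def Inf_K by (intro card_subset_eq) auto
    then have "a l \<le> a \<alpha>" by blast
    then show ?thesis using inj[of \<alpha> l] l[of \<alpha>] by linarith
  qed
  have last: "last_letter (order_position K) = l"
    unfolding last_letter_def inv_def by (rule some_equality) (simp_all add: pos_l uniq)
  have "K l \<subseteq> {0..<L}" using un by blast
  then have bd: "0 \<le> a l" "b l \<le> L" using ab[of l] by (auto simp: atLeastLessThan_subseteq_atLeastAtMost_iff)
  moreover have "b l = L"
  proof (rule ccontr)
    assume "b l \<noteq> L"
    then have "b l \<in> {0..<L}" using bd ab(1)[of l] by simp
    then obtain \<beta> where \<beta>: "b l \<in> K \<beta>" using un by blast
    then have "\<beta> \<noteq> l" using ab(2) by auto
    moreover have "a l \<in> K \<beta>" using \<beta> ab(1)[of l] ab(2)[of \<beta>] l[of \<beta>] by simp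
    ultimately show False using dj[of \<beta> l] a_in[of l] by blast
  qed
  ultimately show ?thesis unfolding last using ab[of l] by auto
qed

text \<open>An orbit that enters \<open>D\<close> leaves it at the next step, so the return time to
  the complement is 1 or 2.\<close>

lemma
  assumes bij: "bij_betw F I I" and D: "D \<subseteq> I" and disj: "F ` D \<inter> D = {}"
  shows first_return_two:
    "x \<in> I - D \<Longrightarrow> first_return F (I - D) x = (if F x \<in> D then F (F x) else F x)"
    and bij_betw_first_return_two: "bij_betw (first_return F (I - D)) (I - D) (I - D)"
proof -
  have maps: "F x \<in> I" if "x \<in> I" for x using bij that by (auto simp: bij_betw_def)
  have inj: "x = y" if "F x = F y" "x \<in> I" "y \<in> I" for x y
    using bij that by (auto simp: bij_betw_def inj_on_def)
  have DD: "F x \<notin> D" if "x \<in> D" for x using disj that by blast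
  show fr: "first_return F (I - D) x = (if F x \<in> D then F (F x) else F x)" if x: "x \<in> I - D" for x
  proof (cases "F x \<in> D")
    case True
    have "(LEAST k. 0 < k \<and> (F ^^ k) x \<in> I - D) = 2"
    proof (rule Least_equality)
      show "0 < (2::nat) \<and> (F ^^ 2) x \<in> I - D"
        using True x maps DD by (simp add: numeral_2_eq_2)
      fix k assume k: "0 < k \<and> (F ^^ k) x \<in> I - D"
      then have "k \<noteq> 1" using True by auto
      then show "2 \<le> k" using k by linarith
    qed
    then show ?thesis using True unfolding first_return_def by (simp add: numeral_2_eq_2)
  next
    case False
    have "(LEAST k. 0 < k \<and> (F ^^ k) x \<in> I - D) = 1"
      using False x maps by (intro Least_equality) auto
    then show ?thesis using False unfolding first_return_def by simp
  qed
  show "bij_betw (first_return F (I - D)) (I - D) (I - D)"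
    unfolding bij_betw_def
  proof
    show "inj_on (first_return F (I - D)) (I - D)"
    proof (rule inj_onI)
      fix x y assume x: "x \<in> I - D" and y: "y \<in> I - D"
        and e: "first_return F (I - D) x = first_return F (I - D) y"
      then have e': "(if F x \<in> D then F (F x) else F x) = (if F y \<in> D then F (F y) else F y)"
        using fr by simp
      show "x = y"
      proof (cases "F x \<in> D")
        case True
        have "F y \<in> D"
        proof (rule ccontr)
          assume "F y \<notin> D"
          then have "F (F x) = F y" using True e' by simp
          then have "F x = y" using inj maps x y by simp
          then show False using True y by simp
        qed
        then have "F (F x) = F (F y)" using True e' by simp
        then show ?thesis using inj maps x y by simp
      next
        case False
        have "F y \<notin> D"
        proof
          assume "F y \<in> D"
          then have "F (F y) = F x" using False e' by simp
          then have "F y = x" using inj maps x y by simp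
          then show False using \<open>F y \<in> D\<close> x by simp
        qed
        then have "F x = F y" using False e' by simp
        then show ?thesis using inj x y by simp
      qed
    qed
    show "first_return F (I - D) ` (I - D) = I - D"
    proof (intro equalityI subsetI)
      fix z assume "z \<in> first_return F (I - D) ` (I - D)"
      then obtain x where "x \<in> I - D" "z = first_return F (I - D) x" by auto
      then show "z \<in> I - D" using fr[of x] maps DD by auto
    next
      fix z assume z: "z \<in> I - D"
      then obtain y where y: "y \<in> I" "F y = z" using bij by (metis DiffD1 bij_betw_def imageE)
      show "z \<in> first_return F (I - D) ` (I - D)"
      proof (cases "y \<in> D")
        case True
        obtain x where x: "x \<in> I" "F x = y" using bij y by (metis bij_betw_def imageE)
        then have "x \<in> I - D" using True DD by blast
        then show ?thesis using fr[of x] x True y by (intro image_eqI[of _ _ x]) auto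
      next
        case False
        then show ?thesis using fr[of y] y z by (intro image_eqI[of _ _ y]) auto
      qed
    qed
  qed
qed

lemma Un_remove:
  fixes K :: "'b \<Rightarrow> real set"
  assumes "\<And>\<alpha> \<beta>. \<alpha> \<noteq> \<beta> \<Longrightarrow> K \<alpha> \<inter> K \<beta> = {}" "(\<Union>\<alpha>. K \<alpha>) = {0..<L}" "K l = {a..<L}" "0 \<le> a" "a < L"
  shows "(\<Union>\<alpha>\<in>UNIV - {l}. K \<alpha>) = {0..<a}"
proof -
  have "(\<Union>\<alpha>\<in>UNIV - {l}. K \<alpha>) = (\<Union>\<alpha>. K \<alpha>) - K l" using assms(1) by blast
  then show ?thesis using assms(2-5) by auto
qed

text \<open>\<open>irred\<close> is irreducibility without permutations: no proper nonempty set of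
  letters fills an initial segment both with its intervals and with their images. As the
  permutations of a state are read off from positions, this form can be carried through a step
  directly.\<close>

locale exchange =
  fixes J :: "'a::finite \<Rightarrow> real set" and F :: "real \<Rightarrow> real" and L :: real and \<omega> :: "'a \<Rightarrow> real"
  assumes J_ivl: "\<exists>a b. a < b \<and> J \<alpha> = {a..<b}"
    and J_disj: "\<alpha> \<noteq> \<beta> \<Longrightarrow> J \<alpha> \<inter> J \<beta> = {}"
    and J_Un: "(\<Union>\<alpha>. J \<alpha>) = {0..<L}"
    and F_bij: "bij_betw F {0..<L} {0..<L}"
    and F_affine: "\<exists>c. \<forall>x\<in>J \<alpha>. F x = exp (\<omega> \<alpha>) * x + c"
    and irred: "A \<noteq> {} \<Longrightarrow> A \<noteq> UNIV \<Longrightarrow> (\<Union>\<alpha>\<in>A. J \<alpha>) = {0..<x} \<Longrightarrow> (\<Union>\<alpha>\<in>A. F ` J \<alpha>) \<noteq> {0..<y}"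
begin

lemma J_sub: "J \<alpha> \<subseteq> {0..<L}"
  using J_Un by blast

lemma J_nonempty: "J \<alpha> \<noteq> {}"
  using J_ivl[of \<alpha>] by auto

lemma F_inj: "F x = F y \<Longrightarrow> x \<in> {0..<L} \<Longrightarrow> y \<in> {0..<L} \<Longrightarrow> x = y"
  using F_bij by (auto simp: bij_betw_def inj_on_def)

lemma F_maps: "x \<in> {0..<L} \<Longrightarrow> F x \<in> {0..<L}"
  using F_bij by (auto simp: bij_betw_def)

lemma F_surj: "y \<in> {0..<L} \<Longrightarrow> \<exists>x\<in>{0..<L}. F x = y"
  using F_bij unfolding bij_betw_def by (metis imageE)

lemma image_ivl:
  assumes "{u..<v} \<subseteq> J \<alpha>" "u < v"
  shows "F ` {u..<v} = {F u..<F u + exp (\<omega> \<alpha>) * (v - u)}"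
proof -
  obtain c where c: "\<And>x. x \<in> J \<alpha> \<Longrightarrow> F x = exp (\<omega> \<alpha>) * x + c" using F_affine by blast
  have "F ` {u..<v} = (\<lambda>x. exp (\<omega> \<alpha>) * x + c) ` {u..<v}"
    using assms c by (intro image_cong) auto
  also have "\<dots> = {exp (\<omega> \<alpha>) * u + c..<exp (\<omega> \<alpha>) * v + c}"
  proof (intro equalityI subsetI)
    fix y assume "y \<in> {exp (\<omega> \<alpha>) * u + c..<exp (\<omega> \<alpha>) * v + c}"
    then show "y \<in> (\<lambda>x. exp (\<omega> \<alpha>) * x + c) ` {u..<v}"
      by (intro image_eqI[of _ _ "(y - c) / exp (\<omega> \<alpha>)"]) (auto simp: field_simps)
  qed auto
  also have "\<dots> = {F u..<F u + exp (\<omega> \<alpha>) * (v - u)}"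
    using c[of u] assms by (auto simp: algebra_simps)
  finally show ?thesis .
qed

lemma F_mono: "x \<in> J \<alpha> \<Longrightarrow> y \<in> J \<alpha> \<Longrightarrow> x < y \<Longrightarrow> F x < F y"
  using F_affine[of \<alpha>] by auto

lemma image_J_ivl: "\<exists>a b. a < b \<and> F ` J \<alpha> = {a..<b}"
proof -
  obtain a b where "a < b" "J \<alpha> = {a..<b}" using J_ivl by blast
  then show ?thesis using image_ivl[of a b \<alpha>]
    by (intro exI[of _ "F a"] exI[of _ "F a + exp (\<omega> \<alpha>) * (b - a)"]) auto
qed

lemma image_disj:
  assumes "\<alpha> \<noteq> \<beta>"
  shows "F ` J \<alpha> \<inter> F ` J \<beta> = {}"
proof -
  have "inj_on F {0..<L}" using F_bij unfolding bij_betw_def by blast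
  then have "F ` J \<alpha> \<inter> F ` J \<beta> = F ` (J \<alpha> \<inter> J \<beta>)"
    using J_sub by (intro inj_on_image_Int[symmetric])
  then show ?thesis using J_disj[OF assms] by simp
qed

lemma image_Un: "(\<Union>\<alpha>. F ` J \<alpha>) = {0..<L}"
  using F_bij unfolding bij_betw_def J_Un[symmetric] image_UN by (rule conjunct2)

lemma letter_unique: "x \<in> J \<alpha> \<Longrightarrow> x \<in> J \<beta> \<Longrightarrow> \<alpha> = \<beta>"
  using J_disj by blast

lemma image_letter_unique: "F x \<in> F ` J \<alpha> \<Longrightarrow> x \<in> {0..<L} \<Longrightarrow> x \<in> J \<alpha>"
  using F_inj J_sub by (metis imageE subsetD)

lemma last_t_J: "\<exists>a. 0 \<le> a \<and> a < L \<and> J (last_t (J, F)) = {a..<L}"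
  unfolding last_t_def state_perm_def fst_conv snd_conv
  by (rule last_letter_order_position[OF J_ivl J_disj J_Un])

lemma last_b_J: "\<exists>c. 0 \<le> c \<and> c < L \<and> F ` J (last_b (J, F)) = {c..<L}"
  unfolding last_b_def state_perm_def fst_conv snd_conv
  by (rule last_letter_order_position[where K = "\<lambda>\<alpha>. F ` J \<alpha>", OF image_J_ivl image_disj image_Un])

text \<open>If one letter were last on both sides, all other letters would fill an initial segment
  above and below, against irreducibility.\<close>

lemma last_neq:
  assumes "CARD('a) \<ge> 2"
  shows "last_t (J, F) \<noteq> last_b (J, F)"
proof
  assume e: "last_t (J, F) = last_b (J, F)"
  obtain a where a: "0 \<le> a" "a < L" "J (last_t (J, F)) = {a..<L}" using last_t_J by blast
  obtain c where c: "0 \<le> c" "c < L" "F ` J (last_t (J, F)) = {c..<L}" using last_b_J e by metis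
  let ?A = "UNIV - {last_t (J, F)}"
  have "card ?A = CARD('a) - 1" by (rule card_Diff_singleton) auto
  then have "card ?A > 0" using assms by simp
  then have "?A \<noteq> {}" by (rule card_gt_0_iff[THEN iffD1, THEN conjunct1])
  moreover have "?A \<noteq> UNIV" by blast
  ultimately have "(\<Union>\<alpha>\<in>?A. F ` J \<alpha>) \<noteq> {0..<c}"
    by (rule irred[OF _ _ Un_remove[OF J_disj J_Un a(3,1,2)]])
  then show False
    using Un_remove[where K = "\<lambda>\<alpha>. F ` J \<alpha>", OF image_disj image_Un c(3,1,2)] by (rule notE)
qed

end

text \<open>\<open>W \<alpha>\<close> is the itinerary of \<open>fst S' \<alpha>\<close> under the map of \<open>S\<close> until the return to the domain of \<open>S'\<close>.\<close>

definition tower :: "('a::finite) state \<Rightarrow> 'a state \<Rightarrow> ('a \<Rightarrow> 'a list) \<Rightarrow> bool" where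
  "tower S S' W \<longleftrightarrow>
     (\<forall>\<alpha>. W \<alpha> \<noteq> []) \<and>
     (\<forall>\<alpha>. \<forall>y\<in>fst S' \<alpha>. \<forall>i<length (W \<alpha>). (snd S ^^ i) y \<in> fst S (W \<alpha> ! i)) \<and>
     (\<forall>\<alpha>. \<forall>y\<in>fst S' \<alpha>. \<forall>i<length (W \<alpha>). 0 < i \<longrightarrow> (snd S ^^ i) y \<notin> (\<Union>\<beta>. fst S' \<beta>)) \<and>
     (\<forall>\<alpha>. \<forall>y\<in>fst S' \<alpha>. snd S' y = (snd S ^^ length (W \<alpha>)) y) \<and>
     (\<forall>x\<in>(\<Union>\<alpha>. fst S \<alpha>). \<exists>\<alpha>. \<exists>y\<in>fst S' \<alpha>. \<exists>i<length (W \<alpha>). x = (snd S ^^ i) y)"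

text \<open>The loser gets the word \<open>[lb, lt]\<close> for both types. For the top type it is
  \<open>lb\<close>, whose image falls into the interval of \<open>lt\<close>; for the bottom type
  it is \<open>lt\<close>, which receives the part of \<open>lb\<close> mapped onto the interval of
  \<open>lt\<close>.\<close>

definition step_word :: "(('a::finite \<Rightarrow> nat) \<times> ('a \<Rightarrow> nat)) \<times> rtype \<Rightarrow> 'a \<Rightarrow> 'a list" where
  "step_word \<gamma> \<alpha> =
     (let lt = last_letter (fst (fst \<gamma>)); lb = last_letter (snd (fst \<gamma>)) in
      if \<alpha> = (case snd \<gamma> of Top \<Rightarrow> lb | Bottom \<Rightarrow> lt) then [lb, lt] else [\<alpha>])"

text \<open>The sum of log-slopes along the itinerary, which is the log-slope of the induced
  map.\<close>

definition sum_word :: "('a \<Rightarrow> real) \<Rightarrow> ('a \<Rightarrow> 'a list) \<Rightarrow> 'a \<Rightarrow> real" where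
  "sum_word \<omega> W \<alpha> = sum_list (map \<omega> (W \<alpha>))"

text \<open>The removed segment lies in the last top interval and in the last bottom image. Their
  letters differ, so the segment is disjoint from its own image and the first return takes at most
  two steps, two exactly on the preimage of the segment.\<close>

lemma (in exchange) rv_step_exchange:
  assumes card: "CARD('a) \<ge> 2" and neq: "len_t (J, F) \<noteq> len_b (J, F)"
  defines "W \<equiv> step_word (state_perm (J, F), step_type (J, F))"
  shows "\<exists>L'. exchange (fst (rv_step (J, F))) (snd (rv_step (J, F))) L' (sum_word \<omega> W)"
    and "tower (J, F) (rv_step (J, F)) W"
proof -
  define p where "p = last_b (J, F)"
  define q where "q = last_t (J, F)"
  have pq: "p \<noteq> q" unfolding p_def q_def using last_neq[OF card] by simp
  obtain a where a: "0 \<le> a" "a < L" "J q = {a..<L}" using last_t_J unfolding q_def by blast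
  obtain c where c: "0 \<le> c" "c < L" "F ` J p = {c..<L}" using last_b_J unfolding p_def by blast
  have len: "len_t (J, F) = L - a" "len_b (J, F) = L - c"
    using a c unfolding len_t_def len_b_def p_def q_def leb_def by simp_all
  \<comment> \<open>Both types are treated together: \<open>D\<close> is the shorter of the two last
    pieces, which is cut off, \<open>B\<close> is its preimage and \<open>\<kappa>\<close> is the
    loser, to which \<open>B\<close> is assigned.\<close>
  define m where "m = max a c"
  define D where "D = {m..<L}"
  define B where "B = {x \<in> {0..<L}. F x \<in> D}"
  define \<kappa> where "\<kappa> = (if a < c then p else q)"
  define J' where "J' \<alpha> = (if \<alpha> = \<kappa> then B else J \<alpha> - B - D)" for \<alpha>
  define F' where "F' = first_return F ({0..<L} - D)"
  have ac: "a \<noteq> c" using neq len by auto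
  have m: "0 \<le> m" "m < L" "{0..<L} - D = {0..<m}" using a c unfolding m_def D_def by auto
  have mD: "x \<in> {0..<m} \<longleftrightarrow> x \<in> {0..<L} \<and> x \<notin> D" for x unfolding m(3)[symmetric] by simp
  have D_Jq: "D \<subseteq> J q" unfolding a(3) D_def m_def by auto
  have D_Fp: "D \<subseteq> F ` J p" unfolding c(3) D_def m_def by auto
  have B_Jp: "B \<subseteq> J p"
  proof
    fix x assume "x \<in> B"
    then have x: "x \<in> {0..<L}" "F x \<in> D" unfolding B_def by simp_all
    show "x \<in> J p" by (rule image_letter_unique[OF subsetD[OF D_Fp x(2)] x(1)])
  qed
  have D_sub: "D \<subseteq> {0..<L}" using m unfolding D_def by auto
  have disjDF: "F ` D \<inter> D = {}"
  proof -
    have "F ` D \<inter> D \<subseteq> F ` J q \<inter> F ` J p" by (intro Int_mono image_mono D_Jq D_Fp)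
    then show ?thesis using image_disj[OF pq] by (simp add: Int_commute)
  qed
  have BD: "B \<inter> D = {}" using B_Jp D_Jq J_disj[OF pq] by blast
  \<comment> \<open>The old interval of the loser is \<open>B\<close> for the top type and
    \<open>D\<close> for the bottom type, so none of its points must be given to another
    letter.\<close>
  have \<kappa>_sub: "J \<kappa> \<subseteq> B \<union> D"
  proof (cases "a < c")
    case True
    have "J p \<subseteq> B"
    proof
      fix x assume x: "x \<in> J p"
      then have "F x \<in> {c..<L}" using c(3) imageI[OF x, of F] by simp
      then show "x \<in> B" using True subsetD[OF J_sub x] unfolding B_def D_def m_def by simp
    qed
    then show ?thesis using True unfolding \<kappa>_def by auto
  next
    case False
    then show ?thesis using a(3) unfolding \<kappa>_def D_def m_def by auto
  qed
  have JqB: "J q - B = J q" and JpBD: "J p - B - D = J p - B"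
    using B_Jp D_Jq J_disj[OF pq] by blast+
  have J'_top: "J' p = B" "J' q = J q - D" if "a < c"
    using that pq JqB unfolding J'_def \<kappa>_def by simp_all
  have J'q_top: "J' q = {a..<c}" if "a < c"
  proof -
    have "{a..<L} - D = {a..<c}" using that c(2) unfolding D_def m_def by auto
    then show ?thesis using J'_top[OF that] a(3) by simp
  qed
  have J'_bot: "J' q = B" "J' p = J p - B" if "\<not> a < c"
    using that pq JpBD unfolding J'_def \<kappa>_def by simp_all
  have Jp_top: "J p = B" if "a < c"
    using that \<kappa>_sub B_Jp JpBD unfolding \<kappa>_def by auto
  have fr: "F' x = (if F x \<in> D then F (F x) else F x)" if "x \<in> {0..<m}" for x
    unfolding F'_def using first_return_two[OF F_bij D_sub disjDF, of x] that unfolding mD by simp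
  have F'_bij: "bij_betw F' {0..<m} {0..<m}"
    using bij_betw_first_return_two[OF F_bij D_sub disjDF] unfolding F'_def m(3) .
  have F'_inj: "x = y" if "F' x = F' y" "x \<in> {0..<m}" "y \<in> {0..<m}" for x y
    using F'_bij that by (auto simp: bij_betw_def inj_on_def)
  have F'_maps: "F' x \<in> {0..<m}" if "x \<in> {0..<m}" for x
    using F'_bij that by (auto simp: bij_betw_def)
  have J'_Un: "(\<Union>\<alpha>. J' \<alpha>) = {0..<m}"
  proof (intro equalityI subsetI)
    fix x assume "x \<in> (\<Union>\<alpha>. J' \<alpha>)"
    then obtain \<alpha> where x: "x \<in> J' \<alpha>" by blast
    have "x \<in> {0..<L} - D"
    proof (cases "\<alpha> = \<kappa>")
      case True
      then have "x \<in> B" using x unfolding J'_def by simp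
      moreover have "x \<notin> D" using BD calculation by (rule disjoint_iff[THEN iffD1, rule_format])
      ultimately show ?thesis unfolding B_def by simp
    next
      case False
      then have "x \<in> J \<alpha>" "x \<notin> D" using x unfolding J'_def by simp_all
      then show ?thesis using subsetD[OF J_sub, of x \<alpha>] by (intro DiffI)
    qed
    then show "x \<in> {0..<m}" unfolding m(3) .
  next
    fix x assume x: "x \<in> {0..<m}"
    then have xD: "x \<in> {0..<L}" "x \<notin> D" unfolding mD by simp_all
    then obtain \<alpha> where \<alpha>: "x \<in> J \<alpha>" using J_Un by blast
    show "x \<in> (\<Union>\<alpha>. J' \<alpha>)"
    proof (cases "x \<in> B")
      case True
      then have "x \<in> J' \<kappa>" unfolding J'_def by simp
      then show ?thesis by blast
    next
      case False
      then have "\<alpha> \<noteq> \<kappa>" using \<alpha> \<kappa>_sub xD by blast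
      then have "x \<in> J' \<alpha>" unfolding J'_def using False xD \<alpha> by simp
      then show ?thesis by blast
    qed
  qed
  have J'_disj: "J' \<alpha> \<inter> J' \<beta> = {}" if "\<alpha> \<noteq> \<beta>" for \<alpha> \<beta>
    using J_disj[OF that] that unfolding J'_def by auto
  have J'_other: "J' \<alpha> = J \<alpha>" if "\<alpha> \<noteq> p" "\<alpha> \<noteq> q" for \<alpha>
    using that J_disj[OF that(1)] J_disj[OF that(2)] B_Jp D_Jq unfolding J'_def \<kappa>_def by auto
  have rv: "rv_step (J, F) = (J', F')"
  proof (cases "a < c")
    case True
    then have ty: "step_type (J, F) = Top" unfolding step_type_def using len by simp
    have D: "F ` J p = D" using True c(3) unfolding D_def m_def by simp
    have "J(q := J q - F ` J p) = J'"
    proof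
      fix \<alpha>
      have "J' p = J p" "J' q = J q - D" using J'_top[OF True] Jp_top[OF True] by simp_all
      then show "(J(q := J q - F ` J p)) \<alpha> = J' \<alpha>"
        using J'_other[of \<alpha>] D pq by (cases "\<alpha> = p"; cases "\<alpha> = q") auto
    qed
    then show ?thesis
      unfolding rv_step_def Let_def ty fst_conv snd_conv J_Un F'_def D[symmetric]
      by (simp add: p_def q_def)
  next
    case False
    then have ca: "c < a" using ac by simp
    then have ty: "step_type (J, F) = Bottom" unfolding step_type_def using len by simp
    have D: "J q = D" using ca a(3) unfolding D_def m_def by simp
    have "J(q := B, p := J p - B) = J'"
    proof
      fix \<alpha>
      from J'_bot[OF False] show "(J(q := B, p := J p - B)) \<alpha> = J' \<alpha>"
        using J'_other[of \<alpha>] pq by (cases "\<alpha> = p"; cases "\<alpha> = q") auto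
    qed
    moreover have "B = {x \<in> {0..<L}. F x \<in> J q}" unfolding B_def D ..
    ultimately show ?thesis
      unfolding rv_step_def Let_def ty fst_conv snd_conv J_Un F'_def D[symmetric]
      by (simp add: p_def q_def)
  qed
  have W: "W \<kappa> = [p, q]" "\<And>\<alpha>. \<alpha> \<noteq> \<kappa> \<Longrightarrow> W \<alpha> = [\<alpha>]"
    unfolding W_def step_word_def Let_def \<kappa>_def p_def q_def last_t_def last_b_def step_type_def len
    by auto
  have J'\<kappa>: "F x \<in> D" "x \<in> J p" "F x \<in> J q" "F' x = F (F x)" if "x \<in> J' \<kappa>" for x
  proof -
    have "x \<in> B" using that unfolding J'_def by simp
    then show *: "F x \<in> D" "x \<in> J p" using B_Jp unfolding B_def by auto
    then show "F x \<in> J q" using D_Jq by blast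
    have "x \<in> {0..<m}" using that J'_Un by blast
    then show "F' x = F (F x)" using fr * by simp
  qed
  have J'n\<kappa>: "F x \<notin> D" "x \<in> J \<alpha>" "F' x = F x" if "x \<in> J' \<alpha>" "\<alpha> \<noteq> \<kappa>" for x \<alpha>
  proof -
    have "x \<in> J \<alpha> - B" using that unfolding J'_def by simp
    then have "x \<in> J \<alpha>" "x \<notin> B" by simp_all
    then show *: "F x \<notin> D" "x \<in> J \<alpha>" using subsetD[OF J_sub, of x \<alpha>] unfolding B_def by simp_all
    have "x \<in> {0..<m}" using that J'_Un by blast
    then show "F' x = F x" using fr * by simp
  qed
  have J'_ivl: "\<exists>u v. u < v \<and> J' \<alpha> = {u..<v}" for \<alpha>
  proof -
    have ivp: "\<exists>u v. u < v \<and> J' p = {u..<v}" and ivq: "\<exists>u v. u < v \<and> J' q = {u..<v}"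
    proof -
      obtain u v where uv: "u < v" "J p = {u..<v}" using J_ivl by blast
      have "(\<exists>u v. u < v \<and> J' p = {u..<v}) \<and> (\<exists>u v. u < v \<and> J' q = {u..<v})"
      proof (cases "a < c")
        case True
        have "J' p = {u..<v}"
          using J'_top[OF True] Jp_top[OF True] uv by simp
        then show ?thesis using uv(1) True J'q_top[OF True] by (intro conjI exI) auto
      next
        case False
        then have ca: "c < a" using ac by simp
        have Dq: "J q = D" using ca a(3) unfolding D_def m_def by simp
        \<comment> \<open>The point \<open>w\<close> sent to a cuts \<open>J p\<close> into the left
          part, which keeps the letter p, and the right part \<open>B\<close>, which takes the
          letter q.\<close>
        have "a \<in> F ` J p" using ca a unfolding c(3) by simp
        then obtain w where w: "w \<in> J p" "F w = a" by (elim imageE) simp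
        have "c \<in> F ` J p" unfolding c(3) using c(2) by simp
        then obtain u' where u': "u' \<in> J p" "F u' = c" by (elim imageE) simp
        have Fu: "F u < a"
        proof -
          have "u \<le> u'" using u' uv by simp
          then have "F u \<le> F u'" using F_mono[of u p u'] u'(1) uv by (cases "u = u'") auto
          then show ?thesis using u' ca by simp
        qed
        have ge: "x \<in> B \<longleftrightarrow> w \<le> x" if "x \<in> J p" for x
        proof -
          have xL: "x \<in> {0..<L}" using that J_sub by blast
          then have "x \<in> B \<longleftrightarrow> a \<le> F x" using F_maps[OF xL] ca unfolding B_def D_def m_def by simp
          also have "\<dots> \<longleftrightarrow> w \<le> x"
            using F_mono[OF that w(1)] F_mono[OF w(1) that] w(2) by (cases x w rule: linorder_cases) auto
          finally show ?thesis .
        qed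
        have uw: "u < w" "w < v" using Fu w uv by (auto simp: less_le)
        have "J' q = {w..<v}"
        proof -
          have "J' q = B" by (rule J'_bot[OF False])
          also have "\<dots> = {x \<in> J p. w \<le> x}" using ge B_Jp by blast
          also have "\<dots> = {w..<v}" using uw uv by auto
          finally show ?thesis .
        qed
        moreover have "J' p = {u..<w}"
        proof -
          have "J' p = J p - B" by (rule J'_bot[OF False])
          also have "\<dots> = {x \<in> J p. x < w}" using ge by auto
          also have "\<dots> = {u..<w}" using uw uv by auto
          finally show ?thesis .
        qed
        ultimately show ?thesis using uw by blast
      qed
      then show "\<exists>u v. u < v \<and> J' p = {u..<v}" "\<exists>u v. u < v \<and> J' q = {u..<v}" by simp_all
    qed
    show ?thesis
    proof (cases "\<alpha> = p \<or> \<alpha> = q")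
      case True
      then show ?thesis using ivp ivq by blast
    next
      case False
      then show ?thesis using J'_other J_ivl by simp
    qed
  qed
  have J'_ne: "\<exists>t. t \<in> J' \<alpha>" for \<alpha> using J'_ivl[of \<alpha>] by auto
  have J'_uniq: "\<alpha> = \<beta>" if "x \<in> J' \<alpha>" "x \<in> J' \<beta>" for x \<alpha> \<beta> using J'_disj[of \<alpha> \<beta>] that by blast
  have J'_in: "x \<in> {0..<m}" if "x \<in> J' \<alpha>" for x \<alpha> using that J'_Un by blast
  show "\<exists>L'. exchange (fst (rv_step (J, F))) (snd (rv_step (J, F))) L' (sum_word \<omega> W)"
    unfolding rv fst_conv snd_conv
  proof (intro exI[of _ m], unfold_locales)
    show "\<exists>a b. a < b \<and> J' \<alpha> = {a..<b}" for \<alpha> by (rule J'_ivl)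
    show "J' \<alpha> \<inter> J' \<beta> = {}" if "\<alpha> \<noteq> \<beta>" for \<alpha> \<beta> using J'_disj[OF that] .
    show "(\<Union>\<alpha>. J' \<alpha>) = {0..<m}" by (rule J'_Un)
    show "bij_betw F' {0..<m} {0..<m}" by (rule F'_bij)
    show "\<exists>c. \<forall>x\<in>J' \<alpha>. F' x = exp (sum_word \<omega> W \<alpha>) * x + c" for \<alpha>
    proof (cases "\<alpha> = \<kappa>")
      case True
      obtain c1 where c1: "\<And>x. x \<in> J p \<Longrightarrow> F x = exp (\<omega> p) * x + c1" using F_affine by blast
      obtain c2 where c2: "\<And>x. x \<in> J q \<Longrightarrow> F x = exp (\<omega> q) * x + c2" using F_affine by blast
      have "F' x = exp (sum_word \<omega> W \<alpha>) * x + (exp (\<omega> q) * c1 + c2)" if "x \<in> J' \<alpha>" for x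
        using J'\<kappa>[of x] that c1[of x] c2[of "F x"] W(1) unfolding True sum_word_def
        by (simp add: exp_add algebra_simps)
      then show ?thesis by blast
    next
      case False
      obtain c1 where c1: "\<And>x. x \<in> J \<alpha> \<Longrightarrow> F x = exp (\<omega> \<alpha>) * x + c1" using F_affine by blast
      have "F' x = exp (sum_word \<omega> W \<alpha>) * x + c1" if "x \<in> J' \<alpha>" for x
        using J'n\<kappa>[OF that False] c1[of x] W(2)[OF False] unfolding sum_word_def by simp
      then show ?thesis by blast
    qed
    fix A x y
    assume A: "A \<noteq> {}" "A \<noteq> UNIV" and X: "(\<Union>\<alpha>\<in>A. J' \<alpha>) = {0..<x}"
    show "(\<Union>\<alpha>\<in>A. F' ` J' \<alpha>) \<noteq> {0..<y}"
    proof
      assume Y: "(\<Union>\<alpha>\<in>A. F' ` J' \<alpha>) = {0..<y}"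
      have inX: "\<beta> \<in> A" if t: "t \<in> J' \<beta>" "t \<in> {0..<x}" for t \<beta>
      proof -
        obtain \<gamma> where "\<gamma> \<in> A" "t \<in> J' \<gamma>" using t(2) unfolding X[symmetric] by blast
        then show ?thesis using J'_uniq[OF t(1)] by simp
      qed
      have inY: "\<beta> \<in> A" if t: "t \<in> J' \<beta>" "F' t \<in> {0..<y}" for t \<beta>
      proof -
        obtain \<gamma> s where s: "\<gamma> \<in> A" "s \<in> J' \<gamma>" "F' t = F' s" using t(2) unfolding Y[symmetric] by blast
        then have "t = s" using F'_inj J'_in t(1) by blast
        then show ?thesis using J'_uniq[OF t(1)] s by simp
      qed
      \<comment> \<open>The winner is last in the new domain (top type) or last among the new images
        (bottom type), so a segment containing its piece contains everything. The loser lies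
        immediately to the right of the winner on the opposite side, inside one former piece, so a
        segment reaching it also meets the winner. All other letters keep intervals and images,
        which reduces to \<open>irred\<close> before the step.\<close>
      have "p \<notin> A \<and> q \<notin> A"
      proof (cases "a < c")
        case True
        then have mc: "m = c" "\<kappa> = p" unfolding m_def \<kappa>_def by auto
        note J'q = J'q_top[OF True]
        have q: "q \<notin> A"
        proof
          assume "q \<in> A"
          then have sub: "{a..<c} \<subseteq> {0..<x}" using X J'q by blast
          have "\<beta> \<in> A" for \<beta>
          proof -
            obtain t where t: "t \<in> J' \<beta>" using J'_ne by blast
            then have "t \<in> {0..<c}" using J'_in mc by blast
            then have "max t a \<in> {a..<c}" using True by auto
            then have "max t a < x" using sub by auto
            then show ?thesis using inX[OF t] \<open>t \<in> {0..<c}\<close> by simp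
          qed
          then show False using A by blast
        qed
        moreover have "p \<notin> A"
        proof
          assume pA: "p \<in> A"
          have aJ: "a \<in> J' q" using J'q True by simp
          have Fa: "F' a = F a" using J'n\<kappa>[OF aJ] pq mc by simp
          obtain t where t: "t \<in> J' p" using J'_ne by blast
          then have Ft: "F t \<in> D" "F' t = F (F t)" using J'\<kappa>[of t] mc by auto
          have "F a < F (F t)"
            using Ft(1) a True mc D_Jq by (intro F_mono[of a q]) (auto simp: D_def)
          moreover have "F' t \<in> {0..<y}" using t pA Y by blast
          moreover have "F' a \<in> {0..<m}" using F'_maps[OF J'_in[OF aJ]] .
          ultimately have "F' a \<in> {0..<y}" using Fa Ft by auto
          then show False using inY[OF aJ] q by blast
        qed
        ultimately show ?thesis by blast
      next
        case False
        then have ca: "c < a" "m = a" "\<kappa> = q" using ac unfolding m_def \<kappa>_def by auto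
        have p: "p \<notin> A"
        proof
          assume pA: "p \<in> A"
          have hit: "t' \<in> {0..<y}" if "t' \<in> {c..<a}" for t'
          proof -
            have "t' \<in> F ` J p" using that a unfolding c(3) by auto
            then obtain s where s: "s \<in> J p" "F s = t'" by auto
            then have "F s \<notin> D" using that ca unfolding D_def by simp
            then have "s \<notin> B" unfolding B_def by simp
            then have sJ: "s \<in> J' p" using s J'_bot[OF False] by simp
            have "F' s = t'" using J'n\<kappa>[OF sJ] pq ca s by simp
            then show ?thesis using sJ pA Y by blast
          qed
          have "\<beta> \<in> A" for \<beta>
          proof -
            obtain t where t: "t \<in> J' \<beta>" using J'_ne by blast
            then have Ft: "F' t \<in> {0..<a}" using F'_maps J'_in ca by blast
            then have "max (F' t) c \<in> {c..<a}" using ca by auto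
            from hit[OF this] show ?thesis using inY[OF t] Ft by simp
          qed
          then show False using A by blast
        qed
        moreover have "q \<notin> A"
        proof
          assume qA: "q \<in> A"
          obtain t where t: "t \<in> J' q" using J'_ne by blast
          obtain s where s: "s \<in> J' p" using J'_ne by blast
          have t1: "F t \<in> D" "t \<in> J p" using J'\<kappa>[of t] t ca by auto
          have s1: "F s \<notin> D" "s \<in> J p" using J'n\<kappa>[OF s] pq ca by auto
          have "F s < F t"
          proof -
            have "F s < L" using F_maps J_sub s1 by (meson atLeastLessThan_iff subsetD)
            then show ?thesis using s1 t1 unfolding D_def by auto
          qed
          then have "s < t" using F_mono[OF t1(2) s1(2)] by (cases s t rule: linorder_cases) auto
          moreover have "t \<in> {0..<x}" using t qA X by blast
          moreover have "0 \<le> s" using J'_in[OF s] by simp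
          ultimately have "s \<in> {0..<x}" by auto
          then show False using inX[OF s] p by blast
        qed
        ultimately show ?thesis by blast
      qed
      then have nA: "\<alpha> \<noteq> p" "\<alpha> \<noteq> q" if "\<alpha> \<in> A" for \<alpha> using that by auto
      have e1: "J' \<alpha> = J \<alpha>" if "\<alpha> \<in> A" for \<alpha> using J'_other nA[OF that] by simp
      have e2: "F' ` J' \<alpha> = F ` J \<alpha>" if "\<alpha> \<in> A" for \<alpha>
      proof -
        have "\<alpha> \<noteq> \<kappa>" using nA[OF that] unfolding \<kappa>_def by simp
        then have "F' ` J' \<alpha> = F ` J' \<alpha>" using J'n\<kappa>(3) by (intro image_cong) auto
        then show ?thesis using e1[OF that] by simp
      qed
      have "(\<Union>\<alpha>\<in>A. J \<alpha>) = {0..<x}" using X e1 by simp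
      moreover have "(\<Union>\<alpha>\<in>A. F ` J \<alpha>) = {0..<y}" using Y e2 by simp
      ultimately show False using irred[OF A] by simp
    qed
  qed
  show "tower (J, F) (rv_step (J, F)) W"
    unfolding rv tower_def fst_conv snd_conv J'_Un J_Un
  proof (intro conjI allI ballI impI)
    show "W \<alpha> \<noteq> []" for \<alpha> using W by (cases "\<alpha> = \<kappa>") auto
    fix \<alpha> y assume y: "y \<in> J' \<alpha>"
    show "F' y = (F ^^ length (W \<alpha>)) y"
      using J'\<kappa>[of y] J'n\<kappa>[OF y] y W by (cases "\<alpha> = \<kappa>") auto
    fix i assume i: "i < length (W \<alpha>)"
    show "(F ^^ i) y \<in> J (W \<alpha> ! i)"
      using J'\<kappa>[of y] J'n\<kappa>[OF y] y W i by (cases "\<alpha> = \<kappa>"; cases i) auto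
    assume "0 < i"
    then have i1: "i = 1" "\<alpha> = \<kappa>" using i W by (cases "\<alpha> = \<kappa>"; auto)+
    then have "F y \<in> D" using J'\<kappa> y by blast
    then show "(F ^^ i) y \<notin> {0..<m}" using i1 unfolding D_def by simp
  next
    fix x assume x: "x \<in> {0..<L}"
    show "\<exists>\<alpha>. \<exists>y\<in>J' \<alpha>. \<exists>i<length (W \<alpha>). x = (F ^^ i) y"
    proof (cases "x \<in> D")
      case True
      obtain y where "y \<in> {0..<L}" "F y = x" using F_surj[OF x] by blast
      then have "y \<in> J' \<kappa>" "x = (F ^^ 1) y" using True unfolding J'_def B_def by auto
      moreover have "1 < length (W \<kappa>)" using W by simp
      ultimately show ?thesis by blast
    next
      case False
      then have "x \<in> (\<Union>\<alpha>. J' \<alpha>)" unfolding J'_Un mD using x by simp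
      then obtain \<alpha> where "x \<in> J' \<alpha>" by blast
      moreover have "0 < length (W \<alpha>)" using W by (cases "\<alpha> = \<kappa>") auto
      moreover have "x = (F ^^ 0) x" by simp
      ultimately show ?thesis by blast
    qed
  qed
qed

section \<open>Composition of towers and the substitution words of the induction\<close>

section \<open>Towers along the induction\<close>

lemma funpow_shift: "(f ^^ (i + n)) x = (f ^^ i) ((f ^^ n) x)"
  by (simp add: funpow_add)

lemma towerD:
  assumes "tower S S' W"
  shows "W \<alpha> \<noteq> []"
    and "y \<in> fst S' \<alpha> \<Longrightarrow> i < length (W \<alpha>) \<Longrightarrow> (snd S ^^ i) y \<in> fst S (W \<alpha> ! i)"
    and "y \<in> fst S' \<alpha> \<Longrightarrow> i < length (W \<alpha>) \<Longrightarrow> 0 < i \<Longrightarrow> (snd S ^^ i) y \<notin> (\<Union>\<beta>. fst S' \<beta>)"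
    and "y \<in> fst S' \<alpha> \<Longrightarrow> snd S' y = (snd S ^^ length (W \<alpha>)) y"
    and "x \<in> fst S \<beta> \<Longrightarrow> \<exists>\<alpha>. \<exists>y\<in>fst S' \<alpha>. \<exists>i<length (W \<alpha>). x = (snd S ^^ i) y"
  using assms unfolding tower_def UN_iff by (elim conjE; simp; fail | elim conjE; blast)+

text \<open>Following an intermediate itinerary \<open>vs\<close> means running through the words
  \<open>W v\<close> one after another. Visits to the intermediate domain happen only at the
  beginnings of these blocks, which is what transfers the avoidance property to a
  composition.\<close>

lemma tower_walk:
  fixes S S' :: "('a::finite) state"
  assumes T: "tower S S' W"
    and walk: "\<And>k. k < length vs \<Longrightarrow> (snd S' ^^ k) z \<in> fst S' (vs ! k)"
  defines "C \<equiv> concat (map W vs)"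
  shows "(snd S' ^^ length vs) z = (snd S ^^ length C) z \<and>
    (\<forall>i<length C. (snd S ^^ i) z \<in> fst S (C ! i)) \<and>
    (\<forall>i<length C. (snd S ^^ i) z \<in> (\<Union>\<beta>. fst S' \<beta>) \<longrightarrow>
       (\<exists>k<length vs. (snd S ^^ i) z = (snd S' ^^ k) z \<and> (0 < i \<longrightarrow> 0 < k))) \<and>
    (\<forall>k<length vs. \<forall>j<length (W (vs ! k)). \<exists>i<length C. (snd S ^^ i) z = (snd S ^^ j) ((snd S' ^^ k) z))"
  using walk unfolding C_def
proof (induction vs arbitrary: z)
  case Nil
  show ?case by simp
next
  case (Cons v vs)
  let ?F = "snd S" and ?F' = "snd S'" and ?C = "concat (map W vs)" and ?w = "length (W v)"
  have z: "z \<in> fst S' v" using Cons.prems[of 0] by simp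
  have T1: "(?F ^^ i) z \<in> fst S (W v ! i)" if "i < ?w" for i
    using towerD(2)[OF T z that] .
  have T2: "(?F ^^ i) z \<notin> (\<Union>\<beta>. fst S' \<beta>)" if "i < ?w" "0 < i" for i
    using towerD(3)[OF T z that] .
  have T3: "?F' z = (?F ^^ ?w) z" by (rule towerD(4)[OF T z])
  have sh: "(?F' ^^ k) (?F' z) = (?F' ^^ Suc k) z" for k by (simp add: funpow_swap1)
  have "(?F' ^^ k) (?F' z) \<in> fst S' (vs ! k)" if "k < length vs" for k
    unfolding sh using Cons.prems[of "Suc k"] that by simp
  note IH = Cons.IH[OF this]
  have shF: "(?F ^^ (i + ?w)) z = (?F ^^ i) (?F' z)" for i unfolding funpow_shift T3 ..
  show ?case
  proof (intro conjI allI impI)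
    show "(?F' ^^ length (v # vs)) z = (?F ^^ length (concat (map W (v # vs)))) z"
      using IH shF[of "length ?C"] sh[of "length vs"] by (simp add: add.commute)
  next
    fix i assume i: "i < length (concat (map W (v # vs)))"
    show "(?F ^^ i) z \<in> fst S (concat (map W (v # vs)) ! i)"
    proof (cases "i < ?w")
      case True
      then show ?thesis using T1[of i] by (simp add: nth_append)
    next
      case False
      then obtain j where j: "i = j + ?w" by (metis le_add_diff_inverse2 not_less)
      then have "j < length ?C" using i by simp
      then show ?thesis using IH shF[of j] j by (simp add: nth_append)
    qed
  next
    fix i assume i: "i < length (concat (map W (v # vs)))" and hit: "(?F ^^ i) z \<in> (\<Union>\<beta>. fst S' \<beta>)"
    show "\<exists>k<length (v # vs). (?F ^^ i) z = (?F' ^^ k) z \<and> (0 < i \<longrightarrow> 0 < k)"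
    proof (cases "i < ?w")
      case True
      then have "i = 0" using T2 hit by blast
      then show ?thesis by auto
    next
      case False
      then obtain j where j: "i = j + ?w" by (metis le_add_diff_inverse2 not_less)
      then have jC: "j < length ?C" using i by simp
      have hj: "(?F ^^ j) (?F' z) \<in> (\<Union>\<beta>. fst S' \<beta>)" using hit unfolding j shF .
      obtain k where k: "k < length vs" "(?F ^^ j) (?F' z) = (?F' ^^ k) (?F' z)"
        using IH jC hj by blast
      then have "(?F ^^ i) z = (?F' ^^ Suc k) z" unfolding j shF sh by simp
      then show ?thesis using k(1) by (intro exI[of _ "Suc k"]) simp
    qed
  next
    fix k j assume k: "k < length (v # vs)" and j: "j < length (W ((v # vs) ! k))"
    show "\<exists>i<length (concat (map W (v # vs))). (?F ^^ i) z = (?F ^^ j) ((?F' ^^ k) z)"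
    proof (cases k)
      case 0
      then show ?thesis using j by (intro exI[of _ j]) simp
    next
      case (Suc k')
      then have "k' < length vs" "j < length (W (vs ! k'))" using k j by simp_all
      then obtain i where i: "i < length ?C" "(?F ^^ i) (?F' z) = (?F ^^ j) ((?F' ^^ k') (?F' z))"
        using IH by blast
      have "(?F ^^ (i + ?w)) z = (?F ^^ j) ((?F' ^^ k) z)" unfolding shF i(2) sh Suc ..
      then show ?thesis using i(1) by (intro exI[of _ "i + ?w"]) simp
    qed
  qed
qed

text \<open>Itineraries compose by substitution. A premature visit to the innermost domain would
  also be a visit to the intermediate one, hence a point of the intermediate orbit at a positive
  time, excluded by the second tower.\<close>

lemma tower_comp:
  fixes S S' S'' :: "('a::finite) state"
  assumes T: "tower S S' W" and T': "tower S' S'' V"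
    and disj: "\<And>\<alpha> \<beta>. \<alpha> \<noteq> \<beta> \<Longrightarrow> fst S' \<alpha> \<inter> fst S' \<beta> = {}"
  shows "tower S S'' (\<lambda>\<alpha>. concat (map W (V \<alpha>)))"
proof -
  let ?C = "\<lambda>\<alpha>. concat (map W (V \<alpha>))"
  have V_ne: "V \<alpha> \<noteq> []" and W_ne: "W \<alpha> \<noteq> []" for \<alpha> by (rule towerD(1)[OF T'], rule towerD(1)[OF T])
  have walk: "(snd S' ^^ k) y \<in> fst S' (V \<alpha> ! k)" if "y \<in> fst S'' \<alpha>" "k < length (V \<alpha>)" for y \<alpha> k
    by (rule towerD(2)[OF T' that])
  note tw = tower_walk[OF T walk]
  have sub: "(\<Union>\<beta>. fst S'' \<beta>) \<subseteq> (\<Union>\<beta>. fst S' \<beta>)"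
  proof
    fix y assume "y \<in> (\<Union>\<beta>. fst S'' \<beta>)"
    then obtain \<alpha> where "y \<in> fst S'' \<alpha>" by blast
    from walk[OF this, of 0] show "y \<in> (\<Union>\<beta>. fst S' \<beta>)" using V_ne[of \<alpha>] by auto
  qed
  show ?thesis
    unfolding tower_def
  proof (intro conjI allI ballI impI)
    show "?C \<alpha> \<noteq> []" for \<alpha> using V_ne[of \<alpha>] W_ne by (cases "V \<alpha>") auto
    fix \<alpha> y assume y: "y \<in> fst S'' \<alpha>"
    have "snd S'' y = (snd S' ^^ length (V \<alpha>)) y" by (rule towerD(4)[OF T' y])
    then show "snd S'' y = (snd S ^^ length (?C \<alpha>)) y" using tw[OF y] by simp
    fix i assume i: "i < length (?C \<alpha>)"
    show "(snd S ^^ i) y \<in> fst S (?C \<alpha> ! i)" using tw[OF y] i by blast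
    assume i0: "0 < i"
    show "(snd S ^^ i) y \<notin> (\<Union>\<beta>. fst S'' \<beta>)"
    proof
      assume h: "(snd S ^^ i) y \<in> (\<Union>\<beta>. fst S'' \<beta>)"
      then have "(snd S ^^ i) y \<in> (\<Union>\<beta>. fst S' \<beta>)" using sub by blast
      then obtain k where k: "k < length (V \<alpha>)" "(snd S ^^ i) y = (snd S' ^^ k) y" "0 < k"
        using tw[OF y] i i0 by blast
      have "(snd S' ^^ k) y \<notin> (\<Union>\<beta>. fst S'' \<beta>)" by (rule towerD(3)[OF T' y k(1,3)])
      then show False using h k by simp
    qed
  next
    fix x assume "x \<in> (\<Union>\<alpha>. fst S \<alpha>)"
    then obtain \<delta> where "x \<in> fst S \<delta>" by blast
    from towerD(5)[OF T this] obtain \<beta> z j where z: "z \<in> fst S' \<beta>" "j < length (W \<beta>)" "x = (snd S ^^ j) z"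
      by blast
    from towerD(5)[OF T' z(1)] obtain \<alpha> y k where y: "y \<in> fst S'' \<alpha>" "k < length (V \<alpha>)" "z = (snd S' ^^ k) y"
      by blast
    have "z \<in> fst S' (V \<alpha> ! k)" using walk[OF y(1,2)] y(3) by simp
    then have "\<beta> = V \<alpha> ! k" using disj[of \<beta> "V \<alpha> ! k"] z(1) by blast
    then have "\<exists>i<length (?C \<alpha>). (snd S ^^ i) y = (snd S ^^ j) ((snd S' ^^ k) y)"
      using tw[OF y(1)] y(2) z(2) by blast
    then show "\<exists>\<alpha>. \<exists>y\<in>fst S'' \<alpha>. \<exists>i<length (?C \<alpha>). x = (snd S ^^ i) y"
      using y(1) unfolding z(3) y(3) by metis
  qed
qed

text \<open>Only the rotation number enters; this is why all maps of \<open>Aff T \<omega>\<close>,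
  for every \<omega>, share their words with T.\<close>

fun words :: "('a::finite) rotation_number \<Rightarrow> nat \<Rightarrow> 'a \<Rightarrow> 'a list" where
  "words \<gamma> 0 = (\<lambda>\<alpha>. [\<alpha>])"
| "words \<gamma> (Suc n) = (\<lambda>\<alpha>. concat (map (words \<gamma> n) (step_word (\<gamma> n) \<alpha>)))"

lemma sum_word_comp: "sum_word (sum_word \<omega> W) V = sum_word \<omega> (\<lambda>\<alpha>. concat (map W (V \<alpha>)))"
proof
  fix \<alpha>
  have "sum_list (map (sum_word \<omega> W) vs) = sum_list (map \<omega> (concat (map W vs)))" for vs
    by (induction vs) (auto simp: sum_word_def)
  then show "sum_word (sum_word \<omega> W) V \<alpha> = sum_word \<omega> (\<lambda>\<alpha>. concat (map W (V \<alpha>))) \<alpha>"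
    by (simp add: sum_word_def[of _ V] sum_word_def[of \<omega> "\<lambda>\<alpha>. concat (map W (V \<alpha>))"])
qed

lemma tower_refl: "tower S S (\<lambda>\<alpha>. [\<alpha>])"
  unfolding tower_def by auto

lemma rv_chain:
  fixes S :: "('a::finite) state"
  assumes card: "CARD('a) \<ge> 2"
    and ex: "exchange (fst S) (snd S) L \<omega>"
    and neq: "\<And>j. j < n \<Longrightarrow> len_t ((rv_step ^^ j) S) \<noteq> len_b ((rv_step ^^ j) S)"
    and \<gamma>: "\<And>j. j < n \<Longrightarrow> \<gamma> j = (state_perm ((rv_step ^^ j) S), step_type ((rv_step ^^ j) S))"
  shows "(\<exists>L'. exchange (fst ((rv_step ^^ n) S)) (snd ((rv_step ^^ n) S)) L' (sum_word \<omega> (words \<gamma> n))) \<and>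
         tower S ((rv_step ^^ n) S) (words \<gamma> n)"
  using neq \<gamma>
proof (induction n)
  case 0
  have "sum_word \<omega> (\<lambda>\<alpha>. [\<alpha>]) = \<omega>" by (auto simp: sum_word_def)
  then show ?case using ex tower_refl[of S] by auto
next
  case (Suc n)
  let ?S = "(rv_step ^^ n) S"
  obtain L' where ih: "exchange (fst ?S) (snd ?S) L' (sum_word \<omega> (words \<gamma> n))" "tower S ?S (words \<gamma> n)"
    using Suc by auto
  have g: "step_word (state_perm ?S, step_type ?S) = step_word (\<gamma> n)" using Suc.prems(2)[of n] by simp
  have ne: "len_t ?S \<noteq> len_b ?S" using Suc.prems(1)[of n] by simp
  note st = exchange.rv_step_exchange[OF ih(1) card, unfolded prod.collapse, OF ne, unfolded g]
  obtain L'' where "exchange (fst (rv_step ?S)) (snd (rv_step ?S)) L'' (sum_word (sum_word \<omega> (words \<gamma> n)) (step_word (\<gamma> n)))"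
    using st(1) by blast
  then have "exchange (fst ((rv_step ^^ Suc n) S)) (snd ((rv_step ^^ Suc n) S)) L'' (sum_word \<omega> (words \<gamma> (Suc n)))"
    by (simp add: sum_word_comp)
  moreover have "tower S ((rv_step ^^ Suc n) S) (words \<gamma> (Suc n))"
    using tower_comp[OF ih(2) st(2) exchange.J_disj[OF ih(1)]] by simp
  ultimately show ?case by blast
qed

text \<open>The cardinality of the set determines the initial segment, so sets that are down-closed
  for both rankings produce the same k on top and bottom.\<close>

lemma down_closed_vimage:
  fixes p :: "'a::finite \<Rightarrow> nat"
  assumes p: "bij_betw p UNIV {1..CARD('a)}"
    and down: "\<And>\<alpha> \<beta>. \<alpha> \<in> A \<Longrightarrow> p \<beta> < p \<alpha> \<Longrightarrow> \<beta> \<in> A"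
  shows "A = p -` {1..card A}"
proof (cases "A = {}")
  case False
  have inj: "inj p" using p by (rule bij_betw_imp_inj_on)
  have rng: "p \<alpha> \<in> {1..CARD('a)}" for \<alpha> using p by (auto simp: bij_betw_def)
  have "Max (p ` A) \<in> p ` A" using False by (intro Max_in) auto
  then obtain \<alpha> where \<alpha>: "Max (p ` A) = p \<alpha>" "\<alpha> \<in> A" by (rule imageE)
  have le: "p \<beta> \<le> p \<alpha>" if "\<beta> \<in> A" for \<beta> using that \<alpha>(1)[symmetric] by simp
  have A: "A = p -` {1..p \<alpha>}"
  proof (intro equalityI subsetI)
    fix \<beta> assume "\<beta> \<in> A"
    then show "\<beta> \<in> p -` {1..p \<alpha>}" using le rng[of \<beta>] by simp
  next
    fix \<beta> assume "\<beta> \<in> p -` {1..p \<alpha>}"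
    then have "p \<beta> < p \<alpha> \<or> \<beta> = \<alpha>" using inj by (auto simp: less_le inj_def)
    then show "\<beta> \<in> A" using down \<alpha>(2) by blast
  qed
  have "p ` A = {1..p \<alpha>}"
  proof -
    have "{1..p \<alpha>} \<subseteq> range p" using p rng[of \<alpha>] by (auto simp: bij_betw_def)
    then show ?thesis using A using image_vimage_eq[of p "{1..p \<alpha>}"] by (metis inf.absorb1)
  qed
  then have "card (p ` A) = p \<alpha>" by simp
  then have "card A = p \<alpha>" using card_image[OF inj_on_subset[OF inj subset_UNIV], of A] by simp
  then show ?thesis using A by simp
qed simp

text \<open>A set of letters filling an initial segment is down-closed in the corresponding order.
  If this happened for intervals and images alike, the two preimages of {1..card A} would agree,
  against irreducibility of the permutation.\<close>

lemma exchange_aiet: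
  fixes f :: "('a::finite) aiet"
  assumes f: "is_aiet f" "on_unit_interval f"
  shows "exchange (ivl f) (amap f) 1 (($) (logslope f))"
proof -
  let ?p = "pi_t f" and ?l = "left_end f" and ?n = "\<lambda>\<alpha>. lens f $ \<alpha>"
  have dom: "dom_ivl f = {0..<1}" using f unfolding dom_ivl_def on_unit_interval_def by simp
  have pt: "bij_betw ?p UNIV {1..CARD('a)}" and pb: "bij_betw (pi_b f) UNIV {1..CARD('a)}"
    and irr: "\<And>k. 1 \<le> k \<Longrightarrow> k < CARD('a) \<Longrightarrow> ?p -` {1..k} \<noteq> pi_b f -` {1..k}"
    using f(1) unfolding is_aiet_def irreducible_perm_def by blast+
  have n_pos: "?n \<alpha> > 0" for \<alpha> using f(1) unfolding is_aiet_def by blast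
  have bij: "bij_betw (amap f) {0..<1} {0..<1}" using f(1) dom unfolding is_aiet_def by simp
  have aff: "\<exists>c. \<forall>x\<in>ivl f \<alpha>. amap f x = exp (logslope f $ \<alpha>) * x + c" for \<alpha>
    using f(1) unfolding is_aiet_def by blast
  have ord: "x < y" if "pi_b f \<alpha> < pi_b f \<beta>" "x \<in> amap f ` ivl f \<alpha>" "y \<in> amap f ` ivl f \<beta>" for x y \<alpha> \<beta>
    using f(1) that unfolding is_aiet_def by blast
  have injt: "inj ?p" using pt by (rule bij_betw_imp_inj_on)
  have rng: "?p \<alpha> \<in> {1..CARD('a)}" for \<alpha> using pt by (auto simp: bij_betw_def)
  have total: "(\<Sum>\<alpha>\<in>UNIV. ?n \<alpha>) = 1" using f(2) unfolding on_unit_interval_def .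
  have right_end: "?l \<alpha> + ?n \<alpha> = (\<Sum>\<beta> | ?p \<beta> \<le> ?p \<alpha>. ?n \<beta>)" for \<alpha>
  proof -
    have "{\<beta>. ?p \<beta> \<le> ?p \<alpha>} = insert \<alpha> {\<beta>. ?p \<beta> < ?p \<alpha>}" using injt by (auto simp: le_less inj_def)
    then show ?thesis unfolding left_end_def by simp
  qed
  have l0: "0 \<le> ?l \<alpha>" for \<alpha> unfolding left_end_def using n_pos by (intro sum_nonneg) (simp add: less_imp_le)
  have r1: "?l \<alpha> + ?n \<alpha> \<le> 1" for \<alpha>
    unfolding right_end total[symmetric] using n_pos by (intro sum_mono2) (auto simp: less_imp_le)
  have sep: "?l \<alpha> + ?n \<alpha> \<le> ?l \<beta>" if "?p \<alpha> < ?p \<beta>" for \<alpha> \<beta>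
    unfolding right_end unfolding left_end_def using n_pos that by (intro sum_mono2) (auto simp: less_imp_le)
  have disj: "ivl f \<alpha> \<inter> ivl f \<beta> = {}" if "\<alpha> \<noteq> \<beta>" for \<alpha> \<beta>
  proof -
    have "?p \<alpha> < ?p \<beta> \<or> ?p \<beta> < ?p \<alpha>" using that injt by (metis injD linorder_neqE_nat)
    then show ?thesis using sep[of \<alpha> \<beta>] sep[of \<beta> \<alpha>] unfolding ivl_def by auto
  qed
  have cover: "(\<Union>\<alpha>. ivl f \<alpha>) = {0..<1}"
  proof (intro equalityI subsetI)
    fix x assume "x \<in> (\<Union>\<alpha>. ivl f \<alpha>)"
    then obtain \<alpha> where "x \<in> ivl f \<alpha>" by blast
    then show "x \<in> {0..<1}" using l0[of \<alpha>] r1[of \<alpha>] unfolding ivl_def by simp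
  next
    fix x :: real assume x: "x \<in> {0..<1}"
    \<comment> \<open>The letter sought is the last one, in the top order, whose interval starts at
      or before x; the next interval starts exactly where it ends.\<close>
    let ?K = "{\<alpha>. ?l \<alpha> \<le> x}"
    have "1 \<in> range ?p" using pt by (auto simp: bij_betw_def)
    then obtain \<alpha>0 where "?p \<alpha>0 = 1" by (metis imageE)
    moreover have "\<not> ?p \<beta> < 1" for \<beta> using rng[of \<beta>] by simp
    ultimately have "{\<beta>. ?p \<beta> < ?p \<alpha>0} = {}" by simp
    then have "?l \<alpha>0 = 0" unfolding left_end_def by simp
    then have "\<alpha>0 \<in> ?K" using x by simp
    then have "Max (?p ` ?K) \<in> ?p ` ?K" by (intro Max_in) auto
    then obtain \<alpha> where \<alpha>: "?l \<alpha> \<le> x" "?p \<alpha> = Max (?p ` ?K)" by auto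
    have max: "?p \<beta> \<le> ?p \<alpha>" if "?l \<beta> \<le> x" for \<beta> using that \<alpha>(2) by simp
    have "x < ?l \<alpha> + ?n \<alpha>"
    proof (cases "?p \<alpha> = CARD('a)")
      case True
      then have "{\<beta>. ?p \<beta> \<le> ?p \<alpha>} = UNIV" using rng by auto
      then show ?thesis using x total unfolding right_end by simp
    next
      case False
      then have "Suc (?p \<alpha>) \<in> range ?p" using pt rng[of \<alpha>] by (auto simp: bij_betw_def)
      then obtain \<beta> where \<beta>: "?p \<beta> = Suc (?p \<alpha>)" by (metis imageE)
      then have "\<not> ?l \<beta> \<le> x" using max[of \<beta>] by auto
      moreover have "?l \<beta> = ?l \<alpha> + ?n \<alpha>"
        unfolding right_end unfolding left_end_def \<beta> by (simp add: less_Suc_eq_le)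
      ultimately show ?thesis by simp
    qed
    then have "x \<in> ivl f \<alpha>" using \<alpha>(1) unfolding ivl_def by simp
    then show "x \<in> (\<Union>\<alpha>. ivl f \<alpha>)" by blast
  qed
  have l_in: "?l \<alpha> \<in> ivl f \<alpha>" for \<alpha> using n_pos[of \<alpha>] unfolding ivl_def by simp
  have sub: "ivl f \<alpha> \<subseteq> {0..<1}" for \<alpha> using cover by blast
  show ?thesis
  proof (unfold_locales)
    show "\<exists>a b. a < b \<and> ivl f \<alpha> = {a..<b}" for \<alpha>
      unfolding ivl_def using n_pos[of \<alpha>] by (intro exI[of _ "?l \<alpha>"] exI[of _ "?l \<alpha> + ?n \<alpha>"]) simp
    show "ivl f \<alpha> \<inter> ivl f \<beta> = {}" if "\<alpha> \<noteq> \<beta>" for \<alpha> \<beta> by (rule disj[OF that])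
    show "(\<Union>\<alpha>. ivl f \<alpha>) = {0..<1}" by (rule cover)
    show "bij_betw (amap f) {0..<1} {0..<1}" by (rule bij)
    show "\<exists>c. \<forall>x\<in>ivl f \<alpha>. amap f x = exp (logslope f $ \<alpha>) * x + c" for \<alpha> by (rule aff)
    fix A x y
    assume A: "A \<noteq> {}" "A \<noteq> UNIV" and X: "(\<Union>\<alpha>\<in>A. ivl f \<alpha>) = {0..<x}"
    show "(\<Union>\<alpha>\<in>A. amap f ` ivl f \<alpha>) \<noteq> {0..<y}"
    proof
      assume Y: "(\<Union>\<alpha>\<in>A. amap f ` ivl f \<alpha>) = {0..<y}"
      have "A = ?p -` {1..card A}"
      proof (rule down_closed_vimage[OF pt])
        fix \<alpha> \<beta> assume ab: "\<alpha> \<in> A" "?p \<beta> < ?p \<alpha>"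
        have "?l \<alpha> \<in> {0..<x}" using l_in[of \<alpha>] ab(1) X by blast
        then have "?l \<beta> \<in> {0..<x}" using sep[OF ab(2)] n_pos[of \<beta>] l0[of \<beta>] by auto
        then obtain \<gamma> where \<gamma>: "\<gamma> \<in> A" "?l \<beta> \<in> ivl f \<gamma>" unfolding X[symmetric] by blast
        then have "\<gamma> = \<beta>" using disj[of \<gamma> \<beta>] l_in[of \<beta>] by (cases "\<gamma> = \<beta>") auto
        then show "\<beta> \<in> A" using \<gamma> by simp
      qed
      moreover have "A = pi_b f -` {1..card A}"
      proof (rule down_closed_vimage[OF pb])
        fix \<alpha> \<beta> assume ab: "\<alpha> \<in> A" "pi_b f \<beta> < pi_b f \<alpha>"
        have "amap f (?l \<alpha>) \<in> amap f ` ivl f \<alpha>" using l_in[of \<alpha>] by (rule imageI)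
        then have "amap f (?l \<alpha>) \<in> {0..<y}" using ab(1) unfolding Y[symmetric] by (intro UN_I)
        then have a: "amap f (?l \<alpha>) < y" by simp
        have "amap f (?l \<beta>) < amap f (?l \<alpha>)"
          by (rule ord[OF ab(2)]) (rule imageI, rule l_in)+
        moreover have "amap f (?l \<beta>) \<in> {0..<1}"
          using bij subsetD[OF sub l_in[of \<beta>]] unfolding bij_betw_def by (metis imageI)
        ultimately have "amap f (?l \<beta>) \<in> {0..<y}" using a by simp
        then obtain \<gamma> s where \<gamma>: "\<gamma> \<in> A" "s \<in> ivl f \<gamma>" "amap f (?l \<beta>) = amap f s"
          unfolding Y[symmetric] by blast
        have "?l \<beta> = s"
          using bij subsetD[OF sub l_in[of \<beta>]] subsetD[OF sub \<gamma>(2)] \<gamma>(3)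
          unfolding bij_betw_def by (metis inj_onD)
        then have "\<gamma> = \<beta>" using disj[of \<gamma> \<beta>] l_in[of \<beta>] \<gamma>(2) by (cases "\<gamma> = \<beta>") auto
        then show "\<beta> \<in> A" using \<gamma> by simp
      qed
      ultimately have e: "?p -` {1..card A} = pi_b f -` {1..card A}" by simp
      have "card A \<ge> 1" using A(1) by (simp add: Suc_leI card_gt_0_iff)
      moreover have "card A < CARD('a)" using A(2) by (intro psubset_card_mono) auto
      ultimately show False using irr e by blast
    qed
  qed
qed

section \<open>Floors of one tower, and cells nested through all levels\<close>

section \<open>Nested cells of a renormalisable map\<close>

lemma affine_image_ivl:
  assumes "0 < (e::real)" "\<And>x. x \<in> {a..<b} \<Longrightarrow> G x = e * x + c" "a < b"
  shows "G ` {a..<b} = {e * a + c..<e * b + c}"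
proof -
  have "G ` {a..<b} = (\<lambda>x. e * x + c) ` {a..<b}" using assms(2) by (rule image_cong[OF refl])
  also have "\<dots> = {e * a + c..<e * b + c}"
  proof (intro equalityI subsetI)
    fix y assume "y \<in> {e * a + c..<e * b + c}"
    then show "y \<in> (\<lambda>x. e * x + c) ` {a..<b}"
      using assms(1) by (intro image_eqI[of _ _ "(y - c) / e"]) (auto simp: field_simps)
  qed (use assms(1) in auto)
  finally show ?thesis .
qed

lemma affine_image_borel:
  assumes "0 < (e::real)" "\<And>x. x \<in> A \<Longrightarrow> G x = e * x + c" "A \<in> sets borel"
  shows "G ` A \<in> sets borel"
proof -
  have "G ` A = (\<lambda>x. e * x + c) ` A" using assms(2) by (rule image_cong[OF refl])
  also have "\<dots> = (\<lambda>y. (y - c) / e) -` A \<inter> space borel"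
  proof (intro equalityI subsetI)
    fix y assume "y \<in> (\<lambda>y. (y - c) / e) -` A \<inter> space borel"
    then show "y \<in> (\<lambda>x. e * x + c) ` A"
      using assms(1) by (intro image_eqI[of _ _ "(y - c) / e"]) (auto simp: field_simps)
  qed (use assms(1) in auto)
  also have "\<dots> \<in> sets borel" using assms(3) by (intro measurable_sets[OF _ assms(3)]) measurable
  finally show ?thesis .
qed

text \<open>The log-slope of the iterate that carries the base to the floor; the letter of the floor
  itself is not yet included.\<close>

definition floor_slope :: "('a \<Rightarrow> real) \<Rightarrow> ('a \<Rightarrow> 'a list) \<Rightarrow> 'a \<times> nat \<Rightarrow> real" where
  "floor_slope \<omega> W \<sigma> = sum_list (map \<omega> (take (snd \<sigma>) (W (fst \<sigma>))))"

locale tower_pair = E: exchange J F L \<omega> + E': exchange J' F' L' \<omega>'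
  for J :: "'a::finite \<Rightarrow> real set" and F L \<omega> J' F' L' \<omega>' +
  fixes W :: "'a \<Rightarrow> 'a list"
  assumes tw: "tower (J, F) (J', F') W"
begin

definition fl :: "'a \<times> nat \<Rightarrow> real set" where
  "fl \<sigma> = (F ^^ snd \<sigma>) ` J' (fst \<sigma>)"

lemma in_J: "y \<in> J' \<alpha> \<Longrightarrow> i < length (W \<alpha>) \<Longrightarrow> (F ^^ i) y \<in> J (W \<alpha> ! i)"
  using towerD(2)[OF tw] by simp

lemma avoid: "y \<in> J' \<alpha> \<Longrightarrow> i < length (W \<alpha>) \<Longrightarrow> 0 < i \<Longrightarrow> (F ^^ i) y \<notin> J' \<beta>"
  using towerD(3)[OF tw] by simp

lemma F'_eq: "y \<in> J' \<alpha> \<Longrightarrow> F' y = (F ^^ length (W \<alpha>)) y"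
  using towerD(4)[OF tw] by simp

lemma fl_sub: "\<sigma> \<in> sym_index W \<Longrightarrow> fl \<sigma> \<subseteq> J (sym_target W \<sigma>)"
  unfolding fl_def sym_index_def sym_target_def using in_J by auto

lemma iterates_in: "x \<in> {0..<L} \<Longrightarrow> (F ^^ i) x \<in> {0..<L}"
  by (induction i) (use E.F_maps in auto)

lemma iterates_inj: "(F ^^ i) x = (F ^^ i) y \<Longrightarrow> x \<in> {0..<L} \<Longrightarrow> y \<in> {0..<L} \<Longrightarrow> x = y"
proof (induction i)
  case (Suc i)
  then have "(F ^^ i) x = (F ^^ i) y" using E.F_inj[OF _ iterates_in iterates_in] by simp
  then show ?case using Suc by blast
qed simp

lemma J'_sub: "J' \<alpha> \<subseteq> {0..<L}"
proof
  fix y assume "y \<in> J' \<alpha>"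
  then have "(F ^^ 0) y \<in> J (W \<alpha> ! 0)" using in_J[of y \<alpha> 0] towerD(1)[OF tw, of \<alpha>] by simp
  then show "y \<in> {0..<L}" using subsetD[OF E.J_sub] by simp
qed

text \<open>By injectivity a common point of two floors can be pulled back until the lower one is in
  the base. The other orbit would then visit the base before its return, unless the heights
  agree.\<close>

lemma fl_unique:
  assumes "\<sigma> \<in> sym_index W" "\<tau> \<in> sym_index W" "x \<in> fl \<sigma>" "x \<in> fl \<tau>"
  shows "\<sigma> = \<tau>"
proof -
  have aux: "i = j \<and> \<alpha> = \<beta>"
    if h: "y \<in> J' \<alpha>" "z \<in> J' \<beta>" "j < length (W \<beta>)" "i \<le> j" "(F ^^ i) y = (F ^^ j) z" for \<alpha> \<beta> i j y z
  proof -
    obtain k where k: "j = i + k" using h(4) le_Suc_ex by blast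
    have zI: "z \<in> {0..<L}" and yI: "y \<in> {0..<L}" using h J'_sub by blast+
    have "(F ^^ i) y = (F ^^ i) ((F ^^ k) z)" using h(5) unfolding k funpow_shift .
    then have y: "y = (F ^^ k) z" by (rule iterates_inj) (use yI iterates_in[OF zI] in auto)
    have "k = 0"
    proof (rule ccontr)
      assume "k \<noteq> 0"
      then show False using avoid[OF h(2), of k \<alpha>] h(1,3) k y by simp
    qed
    then show ?thesis using y k E'.letter_unique[OF h(1), of \<beta>] h(2) by simp
  qed
  obtain y z where yz: "y \<in> J' (fst \<sigma>)" "z \<in> J' (fst \<tau>)" "x = (F ^^ snd \<sigma>) y" "x = (F ^^ snd \<tau>) z"
    using assms(3,4) unfolding fl_def by blast
  have lt: "snd \<sigma> < length (W (fst \<sigma>))" "snd \<tau> < length (W (fst \<tau>))"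
    using assms(1,2) unfolding sym_index_def by auto
  show ?thesis
  proof (cases "snd \<sigma> \<le> snd \<tau>")
    case True
    then show ?thesis using aux[OF yz(1,2) lt(2) True] yz(3,4) by (simp add: prod_eq_iff)
  next
    case False
    then show ?thesis using aux[OF yz(2,1) lt(1), of "snd \<tau>"] False yz(3,4) by (simp add: prod_eq_iff)
  qed
qed

lemma fl_cover: "J \<beta> = (\<Union>\<sigma>\<in>{\<sigma>. \<sigma> \<in> sym_index W \<and> sym_target W \<sigma> = \<beta>}. fl \<sigma>)"
proof (intro equalityI subsetI)
  fix x assume x: "x \<in> J \<beta>"
  then obtain \<alpha> y i where y: "y \<in> J' \<alpha>" "i < length (W \<alpha>)" "x = (F ^^ i) y"
    using towerD(5)[OF tw, of x \<beta>] by auto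
  then have "sym_target W (\<alpha>, i) = \<beta>"
    unfolding sym_target_def using E.letter_unique[OF in_J[OF y(1,2)]] x by simp
  moreover have "(\<alpha>, i) \<in> sym_index W" using y(2) unfolding sym_index_def by simp
  moreover have "x \<in> fl (\<alpha>, i)" unfolding fl_def using y by simp
  ultimately show "x \<in> (\<Union>\<sigma>\<in>{\<sigma>. \<sigma> \<in> sym_index W \<and> sym_target W \<sigma> = \<beta>}. fl \<sigma>)" by blast
next
  fix x assume "x \<in> (\<Union>\<sigma>\<in>{\<sigma>. \<sigma> \<in> sym_index W \<and> sym_target W \<sigma> = \<beta>}. fl \<sigma>)"
  then show "x \<in> J \<beta>" using fl_sub by blast
qed

lemma floor_affine:
  assumes "i \<le> length (W \<alpha>)"
  shows "\<exists>c. \<forall>y\<in>J' \<alpha>. (F ^^ i) y = exp (floor_slope \<omega> W (\<alpha>, i)) * y + c"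
  using assms
proof (induction i)
  case 0
  show ?case by (intro exI[of _ 0]) (simp add: floor_slope_def)
next
  case (Suc i)
  then obtain c where c: "\<And>y. y \<in> J' \<alpha> \<Longrightarrow> (F ^^ i) y = exp (floor_slope \<omega> W (\<alpha>, i)) * y + c" by auto
  obtain d where d: "\<And>x. x \<in> J (W \<alpha> ! i) \<Longrightarrow> F x = exp (\<omega> (W \<alpha> ! i)) * x + d"
    using E.F_affine by blast
  have sl: "floor_slope \<omega> W (\<alpha>, Suc i) = floor_slope \<omega> W (\<alpha>, i) + \<omega> (W \<alpha> ! i)"
    using Suc.prems by (simp add: floor_slope_def take_Suc_conv_app_nth)
  have "(F ^^ Suc i) y = exp (floor_slope \<omega> W (\<alpha>, Suc i)) * y + (exp (\<omega> (W \<alpha> ! i)) * c + d)"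
    if "y \<in> J' \<alpha>" for y
    using d[OF in_J[OF that]] c[OF that] Suc.prems unfolding sl by (simp add: exp_add algebra_simps)
  then show ?case by blast
qed

lemma
  assumes "\<sigma> \<in> sym_index W"
  shows fl_ivl: "\<exists>u v. u < v \<and> fl \<sigma> = {u..<v}"
    and leb_fl: "leb (fl \<sigma>) = exp (floor_slope \<omega> W \<sigma>) * leb (J' (fst \<sigma>))"
proof -
  obtain a b where ab: "a < b" "J' (fst \<sigma>) = {a..<b}" using E'.J_ivl by blast
  have "snd \<sigma> \<le> length (W (fst \<sigma>))" using assms unfolding sym_index_def by auto
  from floor_affine[OF this] obtain c where
    c: "\<And>y. y \<in> J' (fst \<sigma>) \<Longrightarrow> (F ^^ snd \<sigma>) y = exp (floor_slope \<omega> W \<sigma>) * y + c" by auto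
  have f: "fl \<sigma> = {exp (floor_slope \<omega> W \<sigma>) * a + c..<exp (floor_slope \<omega> W \<sigma>) * b + c}"
    unfolding fl_def ab(2) using c ab by (intro affine_image_ivl) simp_all
  moreover have lt: "exp (floor_slope \<omega> W \<sigma>) * a + c < exp (floor_slope \<omega> W \<sigma>) * b + c" using ab by simp
  ultimately show "\<exists>u v. u < v \<and> fl \<sigma> = {u..<v}" by blast
  show "leb (fl \<sigma>) = exp (floor_slope \<omega> W \<sigma>) * leb (J' (fst \<sigma>))"
    unfolding f ab(2) leb_def using lt ab by (simp add: algebra_simps)
qed

lemma finite_succs: "finite {\<sigma>. \<sigma> \<in> sym_index W \<and> sym_target W \<sigma> = \<beta>}"
  by (rule finite_subset[OF _ finite_sym_index[of W]]) auto

lemma fl_disjoint: "disjoint_family_on fl {\<sigma>. \<sigma> \<in> sym_index W \<and> sym_target W \<sigma> = \<beta>}"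
  unfolding disjoint_family_on_def
proof (intro ballI impI)
  fix \<sigma> \<tau> assume "\<sigma> \<in> {\<sigma>. \<sigma> \<in> sym_index W \<and> sym_target W \<sigma> = \<beta>}"
    and "\<tau> \<in> {\<sigma>. \<sigma> \<in> sym_index W \<and> sym_target W \<sigma> = \<beta>}" and "\<sigma> \<noteq> \<tau>"
  then show "fl \<sigma> \<inter> fl \<tau> = {}" using fl_unique[of \<sigma> \<tau>] by auto
qed

lemma measure_cover:
  assumes "finite_measure \<nu>" "sets \<nu> = sets borel"
  shows "measure \<nu> (J \<beta>) = (\<Sum>\<sigma> | \<sigma> \<in> sym_index W \<and> sym_target W \<sigma> = \<beta>. measure \<nu> (fl \<sigma>))"
proof -
  interpret finite_measure \<nu> by fact
  let ?A = "{\<sigma>. \<sigma> \<in> sym_index W \<and> sym_target W \<sigma> = \<beta>}"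
  have "fl ` ?A \<subseteq> sets \<nu>"
  proof
    fix x assume "x \<in> fl ` ?A"
    then obtain \<sigma> where "\<sigma> \<in> sym_index W" "x = fl \<sigma>" by blast
    then obtain u v where "x = {u..<v}" using fl_ivl[of \<sigma>] by blast
    then show "x \<in> sets \<nu>" using assms(2) by simp
  qed
  then have "measure \<nu> (\<Union>\<sigma>\<in>?A. fl \<sigma>) = (\<Sum>\<sigma>\<in>?A. measure \<nu> (fl \<sigma>))"
    by (rule finite_measure_finite_Union[OF finite_succs _ fl_disjoint])
  with arg_cong[where f = "measure \<nu>", OF fl_cover[of \<beta>]] show ?thesis by (rule trans)
qed

lemma leb_cover:
  "leb (J \<beta>) = (\<Sum>\<sigma> | \<sigma> \<in> sym_index W \<and> sym_target W \<sigma> = \<beta>. exp (floor_slope \<omega> W \<sigma>) * leb (J' (fst \<sigma>)))"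
proof -
  let ?A = "{\<sigma>. \<sigma> \<in> sym_index W \<and> sym_target W \<sigma> = \<beta>}"
  have s: "fl \<sigma> \<in> sets lborel \<and> emeasure lborel (fl \<sigma>) \<noteq> \<infinity>" if "\<sigma> \<in> ?A" for \<sigma>
  proof -
    from that have "\<sigma> \<in> sym_index W" by simp
    from fl_ivl[OF this] obtain u v where "u < v" "fl \<sigma> = {u..<v}" by (elim exE conjE)
    then show ?thesis by simp
  qed
  have "measure lborel (\<Union>\<sigma>\<in>?A. fl \<sigma>) = (\<Sum>\<sigma>\<in>?A. measure lborel (fl \<sigma>))"
    using s by (intro measure_finite_Union finite_succs fl_disjoint) auto
  also have "\<dots> = (\<Sum>\<sigma>\<in>?A. exp (floor_slope \<omega> W \<sigma>) * leb (J' (fst \<sigma>)))"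
    using leb_fl unfolding leb_def by (intro sum.cong) auto
  finally have "leb (\<Union>\<sigma>\<in>?A. fl \<sigma>) = (\<Sum>\<sigma>\<in>?A. exp (floor_slope \<omega> W \<sigma>) * leb (J' (fst \<sigma>)))"
    by (simp only: leb_def)
  with arg_cong[where f = leb, OF fl_cover[of \<beta>]] show ?thesis by (rule trans)
qed

text \<open>Invariance is carried as equality of the measures of images. The iterates are affine on
  a base interval, so images of Borel sets stay Borel and can be followed from floor to
  floor.\<close>

lemma invariance_step:
  assumes inv: "\<And>\<alpha> A. A \<in> sets borel \<Longrightarrow> A \<subseteq> J \<alpha> \<Longrightarrow> measure \<nu> (F ` A) = measure \<nu> A"
    and A: "A \<in> sets borel" "A \<subseteq> J' \<alpha>" and i: "i \<le> length (W \<alpha>)"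
  shows "measure \<nu> ((F ^^ i) ` A) = measure \<nu> A" "(F ^^ i) ` A \<in> sets borel"
proof -
  have bor: "(F ^^ i) ` A \<in> sets borel" if i: "i \<le> length (W \<alpha>)" for i
  proof -
    from floor_affine[OF i] obtain c where
      c: "\<And>y. y \<in> J' \<alpha> \<Longrightarrow> (F ^^ i) y = exp (floor_slope \<omega> W (\<alpha>, i)) * y + c" by auto
    show ?thesis
      by (rule affine_image_borel[OF _ _ A(1), of "exp (floor_slope \<omega> W (\<alpha>, i))" _ c]) (use c A(2) in auto)
  qed
  then show "(F ^^ i) ` A \<in> sets borel" using i .
  show "measure \<nu> ((F ^^ i) ` A) = measure \<nu> A"
    using i
  proof (induction i)
    case (Suc i)
    have "(F ^^ i) ` A \<subseteq> J (W \<alpha> ! i)" using in_J A(2) Suc.prems by auto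
    then have "measure \<nu> (F ` ((F ^^ i) ` A)) = measure \<nu> ((F ^^ i) ` A)"
      using inv bor[of i] Suc.prems by simp
    then show ?case using Suc by (simp add: image_image)
  qed simp
qed

end

text \<open>One index step is one full period of the induction, so the same words \<open>W\<close>
  serve at every level, while the log-slopes \<open>om n\<close> may change.\<close>

locale renorm_chain =
  fixes S :: "nat \<Rightarrow> ('a::finite) state" and Ls :: "nat \<Rightarrow> real"
    and om :: "nat \<Rightarrow> 'a \<Rightarrow> real" and W :: "'a \<Rightarrow> 'a list"
  assumes ex: "exchange (fst (S n)) (snd (S n)) (Ls n) (om n)"
    and Ls_0: "Ls 0 = 1"
    and tws: "tower (S n) (S (Suc n)) W"
begin

sublocale tp: tower_pair "fst (S n)" "snd (S n)" "Ls n" "om n"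
    "fst (S (Suc n))" "snd (S (Suc n))" "Ls (Suc n)" "om (Suc n)" W for n
proof -
  interpret E: exchange "fst (S n)" "snd (S n)" "Ls n" "om n" by (rule ex)
  interpret E': exchange "fst (S (Suc n))" "snd (S (Suc n))" "Ls (Suc n)" "om (Suc n)" by (rule ex)
  show "tower_pair (fst (S n)) (snd (S n)) (Ls n) (om n) (fst (S (Suc n))) (snd (S (Suc n))) (Ls (Suc n)) (om (Suc n)) W"
    by unfold_locales (simp add: tws)
qed

text \<open>The head symbol belongs to the finest level. A path of level n has n + 1 entries, so
  \<open>length xs - 1\<close> is the level of the tail, whose map moves the base to its floor; the
  rest carries this floor down to level 0.\<close>

fun trans_map :: "('a \<times> nat) list \<Rightarrow> real \<Rightarrow> real" where
  "trans_map [] = id"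
| "trans_map (\<sigma> # xs) = (if xs = [] then id else trans_map xs \<circ> (snd (S (length xs - 1)) ^^ snd \<sigma>))"

fun slope :: "('a \<times> nat) list \<Rightarrow> real" where
  "slope [] = 0"
| "slope (\<sigma> # xs) = (if xs = [] then 0 else floor_slope (om (length xs - 1)) W \<sigma> + slope xs)"

definition cell :: "('a \<times> nat) list \<Rightarrow> real set" where
  "cell xs = trans_map xs ` fst (S (length xs - 1)) (fst (hd xs))"

lemma cell_path: "xs \<in> paths W n \<Longrightarrow> cell xs = trans_map xs ` fst (S n) (fst (hd xs))"
  unfolding cell_def by (simp add: paths_length)

lemma trans_map_Cons:
  "xs \<in> paths W n \<Longrightarrow> trans_map (\<sigma> # xs) = trans_map xs \<circ> (snd (S n) ^^ snd \<sigma>)"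
  using paths_not_Nil[of xs W n] by (simp add: paths_length)

lemma slope_Cons: "xs \<in> paths W n \<Longrightarrow> slope (\<sigma> # xs) = floor_slope (om n) W \<sigma> + slope xs"
  using paths_not_Nil[of xs W n] by (simp add: paths_length)

lemma cell_Cons:
  assumes "xs \<in> paths W n" "\<sigma> \<in> sym_index W" "sym_target W \<sigma> = fst (hd xs)"
  shows "cell (\<sigma> # xs) = trans_map xs ` tp.fl n \<sigma>"
proof -
  have "\<sigma> # xs \<in> paths W (Suc n)" using assms by simp
  from cell_path[OF this] show ?thesis
    unfolding trans_map_Cons[OF assms(1)] tp.fl_def by (simp only: image_comp list.sel)
qed

lemma trans_affine:
  "xs \<in> paths W n \<Longrightarrow> \<exists>c. \<forall>x\<in>fst (S n) (fst (hd xs)). trans_map xs x = exp (slope xs) * x + c"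
proof (induction n arbitrary: xs)
  case 0
  then obtain \<alpha> where "xs = [(\<alpha>, 0)]" by auto
  then show ?case by (intro exI[of _ 0]) simp
next
  case (Suc n)
  then obtain \<sigma> ys where xs: "xs = \<sigma> # ys" "\<sigma> \<in> sym_index W" "ys \<in> paths W n"
      "sym_target W \<sigma> = fst (hd ys)" by (auto elim!: paths_SucE)
  obtain c where c: "\<And>x. x \<in> fst (S n) (fst (hd ys)) \<Longrightarrow> trans_map ys x = exp (slope ys) * x + c"
    using Suc.IH[OF xs(3)] by blast
  have "snd \<sigma> \<le> length (W (fst \<sigma>))" using xs(2) unfolding sym_index_def by auto
  from tp.floor_affine[OF this, of n] obtain d where
    d: "\<And>y. y \<in> fst (S (Suc n)) (fst \<sigma>) \<Longrightarrow> (snd (S n) ^^ snd \<sigma>) y = exp (floor_slope (om n) W \<sigma>) * y + d"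
    by auto
  have "trans_map xs y = exp (slope xs) * y + (exp (slope ys) * d + c)" if y: "y \<in> fst (S (Suc n)) (fst (hd xs))" for y
  proof -
    have y': "y \<in> fst (S (Suc n)) (fst \<sigma>)" using y xs(1) by simp
    then have "(snd (S n) ^^ snd \<sigma>) y \<in> tp.fl n \<sigma>" unfolding tp.fl_def by (rule imageI)
    then have "(snd (S n) ^^ snd \<sigma>) y \<in> fst (S n) (fst (hd ys))"
      using tp.fl_sub[OF xs(2), of n] xs(4) by auto
    from c[OF this] show ?thesis
      unfolding xs(1) trans_map_Cons[OF xs(3)] slope_Cons[OF xs(3)] o_apply d[OF y']
      by (simp add: exp_add algebra_simps)
  qed
  then show ?case by blast
qed

lemma trans_inj:
  assumes "xs \<in> paths W n"
  shows "inj_on (trans_map xs) (fst (S n) (fst (hd xs)))"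
proof -
  obtain c where "\<forall>x\<in>fst (S n) (fst (hd xs)). trans_map xs x = exp (slope xs) * x + c"
    using trans_affine[OF assms] by blast
  then show ?thesis by (intro inj_onI) simp
qed

abbreviation succs :: "'a \<Rightarrow> ('a \<times> nat) set" where
  "succs \<beta> \<equiv> {\<sigma>. \<sigma> \<in> sym_index W \<and> sym_target W \<sigma> = \<beta>}"

lemma cell_split:
  assumes "xs \<in> paths W n"
  shows "cell xs = (\<Union>\<sigma>\<in>succs (fst (hd xs)). cell (\<sigma> # xs))"
proof -
  have "cell xs = trans_map xs ` (\<Union>\<sigma>\<in>succs (fst (hd xs)). tp.fl n \<sigma>)"
    unfolding cell_path[OF assms] by (rule arg_cong[OF tp.fl_cover])
  also have "\<dots> = (\<Union>\<sigma>\<in>succs (fst (hd xs)). trans_map xs ` tp.fl n \<sigma>)" by (rule image_UN)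
  also have "\<dots> = (\<Union>\<sigma>\<in>succs (fst (hd xs)). cell (\<sigma> # xs))"
    using cell_Cons[OF assms] by (intro SUP_cong refl) simp
  finally show ?thesis .
qed

lemma cell_0: "cell [(\<alpha>, 0)] = fst (S 0) \<alpha>"
  unfolding cell_def by simp

lemma cell_cover: "(\<Union>xs\<in>paths W n. cell xs) = {0..<1}"
proof (induction n)
  case 0
  have "(\<Union>xs\<in>paths W 0. cell xs) = (\<Union>\<alpha>. fst (S 0) \<alpha>)" using cell_0 by auto
  then show ?case using exchange.J_Un[OF ex[of 0]] Ls_0 by simp
next
  case (Suc n)
  have "(\<Union>xs\<in>paths W (Suc n). cell xs) = (\<Union>xs\<in>paths W n. \<Union>\<sigma>\<in>succs (fst (hd xs)). cell (\<sigma> # xs))"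
    unfolding paths.simps by blast
  also have "\<dots> = (\<Union>xs\<in>paths W n. cell xs)"
    using cell_split by (intro SUP_cong refl) simp
  finally show ?case using Suc by simp
qed

lemma cell_disj:
  "xs \<in> paths W n \<Longrightarrow> ys \<in> paths W n \<Longrightarrow> xs \<noteq> ys \<Longrightarrow> cell xs \<inter> cell ys = {}"
proof (induction n arbitrary: xs ys)
  case 0
  then obtain \<alpha> \<beta> where "xs = [(\<alpha>, 0)]" "ys = [(\<beta>, 0)]" by auto
  then show ?case using 0 exchange.J_disj[OF ex[of 0]] by (simp add: cell_0)
next
  case (Suc n)
  obtain \<sigma> xs' where x: "xs = \<sigma> # xs'" "\<sigma> \<in> sym_index W" "xs' \<in> paths W n" "sym_target W \<sigma> = fst (hd xs')"
    using Suc.prems(1) by (rule paths_SucE)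
  obtain \<tau> ys' where y: "ys = \<tau> # ys'" "\<tau> \<in> sym_index W" "ys' \<in> paths W n" "sym_target W \<tau> = fst (hd ys')"
    using Suc.prems(2) by (rule paths_SucE)
  show ?case
  proof (cases "xs' = ys'")
    case True
    then have st: "\<sigma> \<noteq> \<tau>" using Suc.prems(3) x y by simp
    have "cell xs \<inter> cell ys = trans_map xs' ` tp.fl n \<sigma> \<inter> trans_map xs' ` tp.fl n \<tau>"
      using cell_Cons[OF x(3,2,4)] cell_Cons[OF y(3,2,4)] x(1) y(1) True by simp
    also have "\<dots> = trans_map xs' ` (tp.fl n \<sigma> \<inter> tp.fl n \<tau>)"
    proof (rule inj_on_image_Int[OF trans_inj[OF x(3)], symmetric])
      show "tp.fl n \<sigma> \<subseteq> fst (S n) (fst (hd xs'))" using tp.fl_sub[OF x(2), of n] x(4) by simp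
      show "tp.fl n \<tau> \<subseteq> fst (S n) (fst (hd xs'))" using tp.fl_sub[OF y(2), of n] y(4) True by simp
    qed
    also have "tp.fl n \<sigma> \<inter> tp.fl n \<tau> = {}"
      using tp.fl_unique[OF x(2) y(2), of _ n] st by auto
    finally show ?thesis by simp
  next
    case False
    have "cell xs \<subseteq> cell xs'"
      unfolding cell_split[OF x(3)] x(1) using x(2,4) by (intro UN_upper) simp
    moreover have "cell ys \<subseteq> cell ys'"
      unfolding cell_split[OF y(3)] y(1) using y(2,4) by (intro UN_upper) simp
    ultimately show ?thesis using Suc.IH[OF x(3) y(3) False] by blast
  qed
qed

lemma
  assumes "xs \<in> paths W n"
  shows cell_ivl: "\<exists>u v. 0 \<le> u \<and> u < v \<and> v \<le> 1 \<and> cell xs = {u..<v}"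
    and leb_cell: "leb (cell xs) = exp (slope xs) * leb (fst (S n) (fst (hd xs)))"
proof -
  obtain a b where ab: "a < b" "fst (S n) (fst (hd xs)) = {a..<b}" using exchange.J_ivl[OF ex] by blast
  obtain c where c: "\<And>x. x \<in> fst (S n) (fst (hd xs)) \<Longrightarrow> trans_map xs x = exp (slope xs) * x + c"
    using trans_affine[OF assms] by blast
  have f: "cell xs = {exp (slope xs) * a + c..<exp (slope xs) * b + c}"
    unfolding cell_path[OF assms] ab(2) using c ab by (intro affine_image_ivl) simp_all
  have lt: "exp (slope xs) * a + c < exp (slope xs) * b + c" using ab by simp
  have "cell xs \<subseteq> {0..<1}" using cell_cover[of n] assms by blast
  then have "{exp (slope xs) * a + c..<exp (slope xs) * b + c} \<subseteq> {0..1}" unfolding f by auto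
  then have "0 \<le> exp (slope xs) * a + c" "exp (slope xs) * b + c \<le> 1"
    using lt by (simp_all add: atLeastLessThan_subseteq_atLeastAtMost_iff)
  with f lt show "\<exists>u v. 0 \<le> u \<and> u < v \<and> v \<le> 1 \<and> cell xs = {u..<v}" by (intro exI conjI)
  show "leb (cell xs) = exp (slope xs) * leb (fst (S n) (fst (hd xs)))"
    unfolding f ab(2) leb_def using lt ab by (simp add: algebra_simps)
qed

lemma J_borel: "fst (S n) \<alpha> \<in> sets borel"
proof -
  from exchange.J_ivl[OF ex, of n \<alpha>] obtain a b where "fst (S n) \<alpha> = {a..<b}" by (elim exE conjE)
  then show ?thesis by simp
qed

context
  fixes \<nu> :: "real measure"
  assumes inv0: "\<And>\<alpha> A. A \<in> sets borel \<Longrightarrow> A \<subseteq> fst (S 0) \<alpha> \<Longrightarrow> measure \<nu> (snd (S 0) ` A) = measure \<nu> A"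
begin

text \<open>On each base interval the next induced map is an iterate of the present one, so it
  inherits invariance.\<close>

lemma inv_level:
  "A \<in> sets borel \<Longrightarrow> A \<subseteq> fst (S n) \<alpha> \<Longrightarrow> measure \<nu> (snd (S n) ` A) = measure \<nu> A"
proof (induction n arbitrary: \<alpha> A)
  case 0
  then show ?case using inv0 by blast
next
  case (Suc n)
  have "snd (S (Suc n)) ` A = (snd (S n) ^^ length (W \<alpha>)) ` A"
    using tp.F'_eq[where n = n] Suc.prems(2) by (intro image_cong refl) auto
  then show ?case
    using tp.invariance_step(1)[where n = n, OF Suc.IH Suc.prems order_refl] by simp
qed

lemma measure_trans_map:
  "xs \<in> paths W n \<Longrightarrow> A \<in> sets borel \<Longrightarrow> A \<subseteq> fst (S n) (fst (hd xs)) \<Longrightarrow>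
     measure \<nu> (trans_map xs ` A) = measure \<nu> A"
proof (induction n arbitrary: xs A)
  case 0
  then obtain \<alpha> where "xs = [(\<alpha>, 0)]" by auto
  then show ?case by simp
next
  case (Suc n)
  obtain \<sigma> ys where xs: "xs = \<sigma> # ys" "\<sigma> \<in> sym_index W" "ys \<in> paths W n" "sym_target W \<sigma> = fst (hd ys)"
    using Suc.prems(1) by (rule paths_SucE)
  let ?B = "(snd (S n) ^^ snd \<sigma>) ` A"
  have A: "A \<subseteq> fst (S (Suc n)) (fst \<sigma>)" using Suc.prems(3) xs(1) by simp
  have i: "snd \<sigma> \<le> length (W (fst \<sigma>))" using xs(2) unfolding sym_index_def by auto
  note B = tp.invariance_step[where n = n, OF inv_level Suc.prems(2) A i]
  have "?B \<subseteq> tp.fl n \<sigma>" unfolding tp.fl_def using A by (rule image_mono)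
  then have Bs: "?B \<subseteq> fst (S n) (fst (hd ys))" using tp.fl_sub[OF xs(2), of n] xs(4) by simp
  have "trans_map xs ` A = trans_map ys ` ?B"
    unfolding xs(1) trans_map_Cons[OF xs(3)] by (simp only: image_comp)
  then show ?case using Suc.IH[OF xs(3) B(2) Bs] B(1) by simp
qed

lemma measure_cell: "xs \<in> paths W n \<Longrightarrow> measure \<nu> (cell xs) = measure \<nu> (fst (S n) (fst (hd xs)))"
  unfolding cell_path by (rule measure_trans_map[OF _ J_borel order_refl])

text \<open>Every floor has the mass of its base. Adding the floors inside a coarser base gives the
  recursion to which Perron-Frobenius uniqueness is applied.\<close>

lemma measure_level:
  assumes "finite_measure \<nu>" "sets \<nu> = sets borel"
  shows "measure \<nu> (fst (S n) \<beta>) = (\<Sum>\<sigma>\<in>succs \<beta>. measure \<nu> (fst (S (Suc n)) (fst \<sigma>)))"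
proof -
  have "measure \<nu> (tp.fl n \<sigma>) = measure \<nu> (fst (S (Suc n)) (fst \<sigma>))" if "\<sigma> \<in> succs \<beta>" for \<sigma>
  proof -
    from that have i: "snd \<sigma> \<le> length (W (fst \<sigma>))" unfolding sym_index_def by auto
    show ?thesis unfolding tp.fl_def
      by (rule tp.invariance_step(1)[where n = n, OF inv_level J_borel order_refl i])
  qed
  then show ?thesis unfolding tp.measure_cover[OF assms, of n \<beta>] by (intro sum.cong refl) 
qed

end

end

section \<open>Positive recursions, their summable perturbations, and the spectral radius\<close>

section \<open>Perron--Frobenius theory\<close>

context
  fixes A :: "'a::finite \<Rightarrow> 'a \<Rightarrow> real"
  assumes A_pos: "\<And>\<alpha> \<beta>. A \<alpha> \<beta> > 0"
begin

text \<open>The smallest entry divided by the largest entry serves as constant.\<close>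

lemma harnack_positive: "\<exists>c>0. \<forall>w \<beta> \<gamma>. (\<forall>\<alpha>. 0 \<le> w \<alpha>) \<longrightarrow> c * (\<Sum>\<alpha>\<in>UNIV. w \<alpha> * A \<alpha> \<gamma>) \<le> (\<Sum>\<alpha>\<in>UNIV. w \<alpha> * A \<alpha> \<beta>)"
proof -
  define a where "a = Min (range (\<lambda>(\<alpha>, \<beta>). A \<alpha> \<beta>))"
  define b where "b = Max (range (\<lambda>(\<alpha>, \<beta>). A \<alpha> \<beta>))"
  have a_le: "a \<le> A \<alpha> \<beta>" for \<alpha> \<beta>
    unfolding a_def by (rule Min_le) (auto intro: image_eqI[of _ _ "(\<alpha>, \<beta>)"])
  have b_ge: "A \<alpha> \<beta> \<le> b" for \<alpha> \<beta>
    unfolding b_def by (rule Max_ge) (auto intro: image_eqI[of _ _ "(\<alpha>, \<beta>)"])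
  have "a \<in> range (\<lambda>(\<alpha>, \<beta>). A \<alpha> \<beta>)" unfolding a_def by (rule Min_in) auto
  then have a: "a > 0" using A_pos by auto
  then have b: "b > 0" using a_le b_ge by (meson less_le_trans order_trans)
  have "(a / b) * (\<Sum>\<alpha>\<in>UNIV. w \<alpha> * A \<alpha> \<gamma>) \<le> (\<Sum>\<alpha>\<in>UNIV. w \<alpha> * A \<alpha> \<beta>)"
    if w: "\<forall>\<alpha>. 0 \<le> w \<alpha>" for w \<beta> \<gamma>
    unfolding sum_distrib_left
  proof (rule sum_mono)
    fix \<alpha>
    have "(a / b) * A \<alpha> \<gamma> \<le> (a / b) * b" using a b b_ge by (intro mult_left_mono) auto
    also have "\<dots> \<le> A \<alpha> \<beta>" using b a_le by simp
    finally have "w \<alpha> * ((a / b) * A \<alpha> \<gamma>) \<le> w \<alpha> * A \<alpha> \<beta>" using w by (intro mult_left_mono) auto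
    then show "(a / b) * (w \<alpha> * A \<alpha> \<gamma>) \<le> w \<alpha> * A \<alpha> \<beta>" by (simp add: mult_ac)
  qed
  then show ?thesis using a b by (intro exI[of _ "a / b"]) auto
qed

text \<open>For the quotients q = v / u, averaging makes the minimum decrease and the maximum
  increase with n, so the gap never falls below its value at level 0. Positivity forces the minimum
  to drop at each level by a fixed multiple of this gap; as it stays nonnegative, the gap is
  0.\<close>

lemma perron_unique_0:
  fixes u v :: "nat \<Rightarrow> 'a \<Rightarrow> real"
  assumes u: "\<And>n \<beta>. u n \<beta> = (\<Sum>\<alpha>\<in>UNIV. u (Suc n) \<alpha> * A \<alpha> \<beta>)" and u_pos: "\<And>n \<alpha>. u n \<alpha> > 0"
    and v: "\<And>n \<beta>. v n \<beta> = (\<Sum>\<alpha>\<in>UNIV. v (Suc n) \<alpha> * A \<alpha> \<beta>)" and v_nonneg: "\<And>n \<alpha>. v n \<alpha> \<ge> 0"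
  shows "\<exists>c. \<forall>\<alpha>. v 0 \<alpha> = c * u 0 \<alpha>"
proof -
  define q where "q n \<alpha> = v n \<alpha> / u n \<alpha>" for n \<alpha>
  define m where "m n = Min (range (q n))" for n
  define M where "M n = Max (range (q n))" for n
  have m_le: "m n \<le> q n \<alpha>" for n \<alpha> unfolding m_def by (rule Min_le) auto
  have M_ge: "q n \<alpha> \<le> M n" for n \<alpha> unfolding M_def by (rule Max_ge) auto
  have "m n \<in> range (q n)" for n unfolding m_def by (rule Min_in) auto
  then have m_at: "\<exists>\<alpha>. m n = q n \<alpha>" for n by blast
  have "M n \<in> range (q n)" for n unfolding M_def by (rule Max_in) auto
  then have M_at: "\<exists>\<alpha>. M n = q n \<alpha>" for n by blast
  have qv: "v n \<alpha> = q n \<alpha> * u n \<alpha>" for n \<alpha> unfolding q_def using u_pos[of n \<alpha>] by simp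
  have m0: "m n \<ge> 0" for n
  proof -
    obtain \<alpha> where "m n = q n \<alpha>" using m_at by blast
    then show ?thesis unfolding q_def using u_pos[of n \<alpha>] v_nonneg[of n \<alpha>] by simp
  qed
  obtain c where c: "c > 0" "\<And>w \<beta> \<gamma>. (\<forall>\<alpha>. 0 \<le> w \<alpha>) \<Longrightarrow> c * (\<Sum>\<alpha>\<in>UNIV. w \<alpha> * A \<alpha> \<gamma>) \<le> (\<Sum>\<alpha>\<in>UNIV. w \<alpha> * A \<alpha> \<beta>)"
    using harnack_positive by blast
  have w_eq: "(q n \<beta> - t) * u n \<beta> = (\<Sum>\<alpha>\<in>UNIV. ((q (Suc n) \<alpha> - t) * u (Suc n) \<alpha>) * A \<alpha> \<beta>)" for n \<beta> t
  proof -
    have "(\<Sum>\<alpha>\<in>UNIV. ((q (Suc n) \<alpha> - t) * u (Suc n) \<alpha>) * A \<alpha> \<beta>)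
        = (\<Sum>\<alpha>\<in>UNIV. v (Suc n) \<alpha> * A \<alpha> \<beta> - t * (u (Suc n) \<alpha> * A \<alpha> \<beta>))"
      unfolding qv by (rule sum.cong) (simp_all add: algebra_simps)
    also have "\<dots> = v n \<beta> - t * u n \<beta>"
      unfolding sum_subtractf sum_distrib_left[symmetric] v[of n \<beta>, symmetric] u[of n \<beta>, symmetric] ..
    finally show ?thesis unfolding qv by (simp add: algebra_simps)
  qed
  have nn: "0 \<le> (q (Suc n) \<alpha> - m (Suc n)) * u (Suc n) \<alpha>" for n \<alpha>
    using m_le[of "Suc n" \<alpha>] u_pos[of "Suc n" \<alpha>] by simp
  have q_ge: "m (Suc n) \<le> q n \<beta>" for n \<beta>
  proof -
    have "0 \<le> (q n \<beta> - m (Suc n)) * u n \<beta>"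
      unfolding w_eq[of n] by (rule sum_nonneg, rule mult_nonneg_nonneg[OF nn less_imp_le[OF A_pos]])
    then show ?thesis using u_pos[of n \<beta>] by (simp add: zero_le_mult_iff)
  qed
  have q_le: "q n \<beta> \<le> M (Suc n)" for n \<beta>
  proof -
    have "(q n \<beta> - M (Suc n)) * u n \<beta> \<le> 0"
      unfolding w_eq[of n]
    proof (rule sum_nonpos)
      fix \<alpha>
      have "(q (Suc n) \<alpha> - M (Suc n)) * u (Suc n) \<alpha> \<le> 0"
        using M_ge[of "Suc n" \<alpha>] u_pos[of "Suc n" \<alpha>] by (simp add: mult_le_0_iff)
      then show "(q (Suc n) \<alpha> - M (Suc n)) * u (Suc n) \<alpha> * A \<alpha> \<beta> \<le> 0"
        using A_pos[of \<alpha> \<beta>] by (rule mult_nonpos_nonneg[OF _ less_imp_le])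
    qed
    then show ?thesis using u_pos[of n \<beta>] by (simp add: mult_le_0_iff)
  qed
  have m_dec: "m (Suc n) \<le> m n" for n using m_at[of n] q_ge by metis
  have M_inc: "M n \<le> M (Suc n)" for n using M_at[of n] q_le by metis
  have m_0: "m n \<le> m 0" for n by (induction n) (use m_dec order_trans in auto)
  have M_0: "M 0 \<le> M n" for n by (induction n) (use M_inc order_trans in auto)
  \<comment> \<open>The Harnack estimate enters twice, for the nonnegative weights (q - min) u and
    for u itself; hence \<open>c * c\<close>.\<close>
  have drop: "c * c * (M 0 - m 0) \<le> m n - m (Suc n)" for n
  proof -
    obtain \<beta> where \<beta>: "m n = q n \<beta>" using m_at by blast
    obtain \<gamma> where \<gamma>: "M n = q n \<gamma>" using M_at by blast
    have h1: "c * ((q n \<gamma> - m (Suc n)) * u n \<gamma>) \<le> (q n \<beta> - m (Suc n)) * u n \<beta>"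
      unfolding w_eq[of n] using nn by (intro c(2)) auto
    have h2: "c * u n \<beta> \<le> u n \<gamma>"
      unfolding u[of n] using u_pos by (intro c(2)) (simp add: less_imp_le)
    have "c * c * (M 0 - m 0) * u n \<beta> \<le> c * c * (q n \<gamma> - m (Suc n)) * u n \<beta>"
      using M_0[of n] m_0[of "Suc n"] \<gamma> c(1) u_pos[of n \<beta>] by (intro mult_right_mono mult_left_mono) auto
    also have "\<dots> = c * (q n \<gamma> - m (Suc n)) * (c * u n \<beta>)" by simp
    also have "\<dots> \<le> c * (q n \<gamma> - m (Suc n)) * u n \<gamma>"
      using c(1) q_ge[of n \<gamma>] by (intro mult_left_mono[OF h2]) auto
    also have "\<dots> \<le> (m n - m (Suc n)) * u n \<beta>" using h1 unfolding \<beta> by (simp add: mult.assoc)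
    finally show ?thesis using u_pos[of n \<beta>] by simp
  qed
  have tele: "real n * (c * c * (M 0 - m 0)) \<le> m 0 - m n" for n
  proof (induction n)
    case (Suc n)
    then show ?case using drop[of n] by (simp add: algebra_simps)
  qed simp
  have "M 0 - m 0 \<le> 0"
  proof (rule ccontr)
    assume "\<not> M 0 - m 0 \<le> 0"
    then have "c * c * (M 0 - m 0) > 0" using c(1) by simp
    then obtain n :: nat where "m 0 < real n * (c * c * (M 0 - m 0))"
      using reals_Archimedean3 by blast
    then show False using tele[of n] m0[of n] by linarith
  qed
  then have "q 0 \<alpha> = m 0" for \<alpha> using m_le[of 0 \<alpha>] M_ge[of 0 \<alpha>] by linarith
  then show ?thesis using qv[of 0] by auto
qed

lemma perron_unique:
  fixes u v :: "nat \<Rightarrow> 'a \<Rightarrow> real"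
  assumes u: "\<And>n \<beta>. u n \<beta> = (\<Sum>\<alpha>\<in>UNIV. u (Suc n) \<alpha> * A \<alpha> \<beta>)" and u_pos: "\<And>n \<alpha>. u n \<alpha> > 0"
    and v: "\<And>n \<beta>. v n \<beta> = (\<Sum>\<alpha>\<in>UNIV. v (Suc n) \<alpha> * A \<alpha> \<beta>)" and v_nonneg: "\<And>n \<alpha>. v n \<alpha> \<ge> 0"
  shows "\<exists>c. \<forall>n \<alpha>. v n \<alpha> = c * u n \<alpha>"
proof -
  have "\<exists>c. \<forall>\<alpha>. v n \<alpha> = c * u n \<alpha>" for n
  proof -
    have "\<exists>c. \<forall>\<alpha>. v (n + 0) \<alpha> = c * u (n + 0) \<alpha>"
    proof (rule perron_unique_0[of "\<lambda>k. u (n + k)" "\<lambda>k. v (n + k)"])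
      show "u (n + k) \<beta> = (\<Sum>\<alpha>\<in>UNIV. u (n + Suc k) \<alpha> * A \<alpha> \<beta>)" for k \<beta>
        unfolding add_Suc_right by (rule u)
      show "v (n + k) \<beta> = (\<Sum>\<alpha>\<in>UNIV. v (n + Suc k) \<alpha> * A \<alpha> \<beta>)" for k \<beta>
        unfolding add_Suc_right by (rule v)
    qed (rule u_pos v_nonneg)+
    then show ?thesis by simp
  qed
  then obtain c where c: "\<And>n \<alpha>. v n \<alpha> = c n * u n \<alpha>" by metis
  have "c (Suc n) = c n" for n
  proof -
    have "v n undefined = c (Suc n) * u n undefined"
      unfolding v[of n] u[of n] c[of "Suc n"] sum_distrib_left by (simp add: mult.assoc)
    then show ?thesis using c[of n undefined] u_pos[of n undefined] by simp
  qed
  then have "c n = c 0" for n by (induction n) auto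
  then show ?thesis using c by metis
qed

text \<open>The shifted family solves the same recursion, so uniqueness makes it a multiple of the
  original one.\<close>

lemma perron_scaling:
  fixes u :: "nat \<Rightarrow> 'a \<Rightarrow> real"
  assumes u: "\<And>n \<beta>. u n \<beta> = (\<Sum>\<alpha>\<in>UNIV. u (Suc n) \<alpha> * A \<alpha> \<beta>)" and u_pos: "\<And>n \<alpha>. u n \<alpha> > 0"
  shows "\<exists>t>0. \<forall>n \<alpha>. u n \<alpha> = t ^ n * u 0 \<alpha>"
proof -
  obtain t where t: "\<And>n \<alpha>. u (Suc n) \<alpha> = t * u n \<alpha>"
    using perron_unique[of u "\<lambda>n. u (Suc n)"] u u_pos less_imp_le by metis
  have "t > 0" using t[of 0 undefined] u_pos[of 0 undefined] u_pos[of 1 undefined] by (simp add: zero_less_mult_iff)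
  moreover have "u n \<alpha> = t ^ n * u 0 \<alpha>" for n \<alpha> by (induction n) (simp_all add: t)
  ultimately show ?thesis by blast
qed

end

text \<open>Without perturbation each level averages the next, so the maximum cannot decrease and
  the minimum cannot increase with n. Summable errors keep this up to exp E. It bounds the maximum
  from below and the minimum from above; a Harnack estimate between consecutive levels turns this
  into two-sided bounds for all components.\<close>

lemma perturbed_average:
  fixes x :: "nat \<Rightarrow> 'a::finite \<Rightarrow> real" and P :: "nat \<Rightarrow> 'a \<Rightarrow> 'a \<Rightarrow> real" and Q :: "'a \<Rightarrow> 'a \<Rightarrow> real"
  assumes x: "\<And>n \<beta>. x n \<beta> = (\<Sum>\<alpha>\<in>UNIV. x (Suc n) \<alpha> * P n \<alpha> \<beta>)" and x_pos: "\<And>n \<alpha>. x n \<alpha> > 0"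
    and P: "\<And>n \<alpha> \<beta>. exp (- e n) * Q \<alpha> \<beta> \<le> P n \<alpha> \<beta>" "\<And>n \<alpha> \<beta>. P n \<alpha> \<beta> \<le> exp (e n) * Q \<alpha> \<beta>"
    and Q: "\<And>\<alpha> \<beta>. Q \<alpha> \<beta> > 0" "\<And>\<beta>. (\<Sum>\<alpha>\<in>UNIV. Q \<alpha> \<beta>) = 1"
    and e: "\<And>n. e n \<ge> 0" "\<And>n. (\<Sum>j<n. e j) \<le> E"
  shows "\<exists>B. \<forall>n \<alpha>. \<bar>ln (x n \<alpha>)\<bar> \<le> B"
proof -
  define m where "m n = Min (range (x n))" for n
  define M where "M n = Max (range (x n))" for n
  have m_le: "m n \<le> x n \<alpha>" for n \<alpha> unfolding m_def by (rule Min_le) auto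
  have M_ge: "x n \<alpha> \<le> M n" for n \<alpha> unfolding M_def by (rule Max_ge) auto
  have "m n \<in> range (x n)" for n unfolding m_def by (rule Min_in) auto
  then have m_at: "\<exists>\<alpha>. m n = x n \<alpha>" for n by blast
  have "M n \<in> range (x n)" for n unfolding M_def by (rule Max_in) auto
  then have M_at: "\<exists>\<alpha>. M n = x n \<alpha>" for n by blast
  have m_pos: "m n > 0" for n using m_at[of n] x_pos by metis
  have M_pos: "M n > 0" for n using M_at[of n] x_pos by metis
  have e_E: "e n \<le> E" for n
  proof -
    have "(\<Sum>j<n. e j) \<ge> 0" using e(1) by (rule sum_nonneg)
    then show ?thesis using e(2)[of "Suc n"] by simp
  qed
  have up: "x n \<beta> \<le> exp (e n) * M (Suc n)" for n \<beta>
  proof -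
    have "x n \<beta> \<le> (\<Sum>\<alpha>\<in>UNIV. M (Suc n) * (exp (e n) * Q \<alpha> \<beta>))"
      unfolding x[of n \<beta>]
    proof (rule sum_mono)
      fix \<alpha>
      have "x (Suc n) \<alpha> * P n \<alpha> \<beta> \<le> x (Suc n) \<alpha> * (exp (e n) * Q \<alpha> \<beta>)"
        using P(2) x_pos[of "Suc n" \<alpha>] by (intro mult_left_mono) auto
      also have "\<dots> \<le> M (Suc n) * (exp (e n) * Q \<alpha> \<beta>)"
        using M_ge Q(1)[of \<alpha> \<beta>] by (intro mult_right_mono) auto
      finally show "x (Suc n) \<alpha> * P n \<alpha> \<beta> \<le> M (Suc n) * (exp (e n) * Q \<alpha> \<beta>)" .
    qed
    also have "\<dots> = M (Suc n) * exp (e n) * (\<Sum>\<alpha>\<in>UNIV. Q \<alpha> \<beta>)"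
      unfolding sum_distrib_left by (simp add: mult.assoc)
    finally show ?thesis unfolding Q(2) by (simp add: mult.commute)
  qed
  have low: "exp (- e n) * m (Suc n) \<le> x n \<beta>" for n \<beta>
  proof -
    have "exp (- e n) * m (Suc n) = (\<Sum>\<alpha>\<in>UNIV. m (Suc n) * (exp (- e n) * Q \<alpha> \<beta>))"
      unfolding sum_distrib_left[symmetric] Q(2) by simp
    also have "\<dots> \<le> x n \<beta>"
      unfolding x[of n \<beta>]
    proof (rule sum_mono)
      fix \<alpha>
      have "m (Suc n) * (exp (- e n) * Q \<alpha> \<beta>) \<le> x (Suc n) \<alpha> * (exp (- e n) * Q \<alpha> \<beta>)"
        using m_le Q(1)[of \<alpha> \<beta>] by (intro mult_right_mono) auto
      also have "\<dots> \<le> x (Suc n) \<alpha> * P n \<alpha> \<beta>"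
        using P(1) x_pos[of "Suc n" \<alpha>] by (intro mult_left_mono) auto
      finally show "m (Suc n) * (exp (- e n) * Q \<alpha> \<beta>) \<le> x (Suc n) \<alpha> * P n \<alpha> \<beta>" .
    qed
    finally show ?thesis .
  qed
  have M_iter: "M 0 \<le> exp (\<Sum>j<n. e j) * M n" for n
  proof (induction n)
    case (Suc n)
    obtain \<beta> where "M n = x n \<beta>" using M_at by blast
    then have "exp (\<Sum>j<n. e j) * M n \<le> exp (\<Sum>j<n. e j) * (exp (e n) * M (Suc n))"
      using up[of n \<beta>] by simp
    from order_trans[OF Suc this] show ?case by (simp add: exp_add mult.assoc)
  qed simp
  have m_iter: "exp (- (\<Sum>j<n. e j)) * m n \<le> m 0" for n
  proof (induction n)
    case (Suc n)
    obtain \<beta> where "m n = x n \<beta>" using m_at by blast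
    then have "exp (- (\<Sum>j<n. e j)) * (exp (- e n) * m (Suc n)) \<le> exp (- (\<Sum>j<n. e j)) * m n"
      using low[of n \<beta>] by simp
    from order_trans[OF this Suc] show ?case by (simp add: mult_exp_exp mult.assoc[symmetric])
  qed simp
  define q where "q = Min (range (\<lambda>(\<alpha>, \<beta>). Q \<alpha> \<beta>))"
  have q_le: "q \<le> Q \<alpha> \<beta>" for \<alpha> \<beta>
    unfolding q_def by (rule Min_le) (auto intro: image_eqI[of _ _ "(\<alpha>, \<beta>)"])
  have "q \<in> range (\<lambda>(\<alpha>, \<beta>). Q \<alpha> \<beta>)" unfolding q_def by (rule Min_in) auto
  then have q: "q > 0" using Q(1) by auto
  \<comment> \<open>Each entry of \<open>P n\<close> is at least exp (-E) q, so the largest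
    component of the next level is felt by every component of this one.\<close>
  have harn: "exp (- E) * q * M (Suc n) \<le> x n \<beta>" for n \<beta>
  proof -
    obtain \<alpha> where \<alpha>: "M (Suc n) = x (Suc n) \<alpha>" using M_at by blast
    have P_pos: "P n \<alpha> \<beta> > 0" for \<alpha>
      using P(1)[of n \<alpha> \<beta>] Q(1)[of \<alpha> \<beta>] by (smt (verit) exp_gt_zero mult_pos_pos)
    have "exp (- E) * q \<le> exp (- e n) * Q \<alpha> \<beta>"
      using e_E q_le q by (intro mult_mono) auto
    also have "\<dots> \<le> P n \<alpha> \<beta>" by (rule P(1))
    finally have "M (Suc n) * (exp (- E) * q) \<le> x (Suc n) \<alpha> * P n \<alpha> \<beta>"
      unfolding \<alpha> using x_pos[of "Suc n" \<alpha>] by (intro mult_left_mono) auto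
    also have "\<dots> \<le> x n \<beta>"
      unfolding x[of n \<beta>]
      using x_pos[of "Suc n"] P_pos by (intro member_le_sum[of \<alpha>]) (auto simp: less_imp_le)
    finally show ?thesis by (simp add: mult_ac)
  qed
  define lo where "lo = exp (- E) * q * (exp (- E) * M 0)"
  \<comment> \<open>Level 0 has no predecessor for the Harnack estimate, hence the separate term
    \<open>M 0\<close>.\<close>
  define hi where "hi = max (M 0) (exp E * m 0 / (exp (- E) * q))"
  have lo: "lo \<le> x n \<beta>" for n \<beta>
  proof -
    have "M 0 \<le> exp E * M (Suc n)"
      using M_iter[of "Suc n"] e(2)[of "Suc n"] M_pos[of "Suc n"]
      by (meson exp_le_cancel_iff less_imp_le mult_right_mono order_trans)
    then have "exp (- E) * M 0 \<le> M (Suc n)" by (simp add: exp_minus field_simps)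
    then have "lo \<le> exp (- E) * q * M (Suc n)" unfolding lo_def using q by (intro mult_left_mono) auto
    then show ?thesis using harn[of n \<beta>] by linarith
  qed
  have hi: "x n \<beta> \<le> hi" for n \<beta>
  proof (cases n)
    case 0
    then show ?thesis using M_ge[of 0 \<beta>] unfolding hi_def by simp
  next
    case (Suc k)
    obtain \<alpha> where \<alpha>: "m k = x k \<alpha>" using m_at by blast
    have "exp (- E) * m k \<le> exp (- (\<Sum>j<k. e j)) * m k"
      using e(2)[of k] m_pos[of k] by (intro mult_right_mono) auto
    also have "\<dots> \<le> m 0" by (rule m_iter)
    finally have "m k \<le> exp E * m 0" by (simp add: exp_minus field_simps)
    then have "exp (- E) * q * M n \<le> exp E * m 0" using harn[of k \<alpha>] \<alpha> Suc by simp
    then have "M n \<le> exp E * m 0 / (exp (- E) * q)" using q by (simp add: pos_le_divide_eq mult.commute)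
    then show ?thesis using M_ge[of n \<beta>] unfolding hi_def by linarith
  qed
  have lo_pos: "lo > 0" unfolding lo_def using q M_pos[of 0] by simp
  have "\<bar>ln (x n \<alpha>)\<bar> \<le> max \<bar>ln lo\<bar> \<bar>ln hi\<bar>" for n \<alpha>
  proof -
    have "ln lo \<le> ln (x n \<alpha>)" using lo[of n \<alpha>] lo_pos x_pos[of n \<alpha>] by simp
    moreover have "ln (x n \<alpha>) \<le> ln hi" using hi[of n \<alpha>] x_pos[of n \<alpha>] by simp
    ultimately show ?thesis by linarith
  qed
  then show ?thesis by blast
qed

text \<open>An eigenvector contributes the power of its eigenvalue; when two summands are combined,
  the larger of the two rates serves for both.\<close>

lemma contracting_decay:
  fixes M :: "real^'a^('a::finite)"
  assumes "v \<in> span {v. \<exists>x. \<bar>x\<bar> < 1 \<and> eigenvector M x v}"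
  shows "\<exists>C \<theta>. 0 \<le> C \<and> 0 \<le> \<theta> \<and> \<theta> < 1 \<and> (\<forall>n. norm (((\<lambda>w. M *v w) ^^ n) v) \<le> C * \<theta> ^ n)"
  using assms
proof (induction rule: span_induct_alt)
  case base
  have "((\<lambda>w. M *v w) ^^ n) 0 = 0" for n by (induction n) auto
  then show ?case by (intro exI[of _ 0]) auto
next
  case (step c x y)
  obtain t where t: "\<bar>t\<bar> < 1" "M *v x = t *s x" using step(1) unfolding eigenvector_def by blast
  obtain C \<theta> where C: "0 \<le> C" "0 \<le> \<theta>" "\<theta> < 1" "\<And>n. norm (((\<lambda>w. M *v w) ^^ n) y) \<le> C * \<theta> ^ n"
    using step(2) by blast
  have it: "((\<lambda>w. M *v w) ^^ n) (c *\<^sub>R x + y) = (c * t ^ n) *\<^sub>R x + ((\<lambda>w. M *v w) ^^ n) y" for n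
  proof (induction n)
    case (Suc n)
    have "M *v ((c * t ^ n) *\<^sub>R x) = (c * t ^ n) *\<^sub>R (t *s x)"
      using t(2) by (metis matrix_vector_mult_scaleR)
    also have "\<dots> = (c * t ^ Suc n) *\<^sub>R x" by (simp add: scalar_mult_eq_scaleR mult.commute mult.left_commute)
    finally show ?case using Suc by (simp add: matrix_vector_right_distrib)
  qed simp
  define \<eta> where "\<eta> = max \<bar>t\<bar> \<theta>"
  have "norm (((\<lambda>w. M *v w) ^^ n) (c *\<^sub>R x + y)) \<le> (\<bar>c\<bar> * norm x + C) * \<eta> ^ n" for n
  proof -
    have "norm ((c * t ^ n) *\<^sub>R x) = \<bar>c\<bar> * norm x * \<bar>t\<bar> ^ n" by (simp add: abs_mult power_abs)
    also have "\<dots> \<le> \<bar>c\<bar> * norm x * \<eta> ^ n" unfolding \<eta>_def by (intro mult_left_mono power_mono) auto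
    finally have 1: "norm ((c * t ^ n) *\<^sub>R x) \<le> \<bar>c\<bar> * norm x * \<eta> ^ n" .
    have "C * \<theta> ^ n \<le> C * \<eta> ^ n" unfolding \<eta>_def using C by (intro mult_left_mono power_mono) auto
    then have 2: "norm (((\<lambda>w. M *v w) ^^ n) y) \<le> C * \<eta> ^ n" using C(4)[of n] by linarith
    have "norm (((\<lambda>w. M *v w) ^^ n) (c *\<^sub>R x + y)) \<le> norm ((c * t ^ n) *\<^sub>R x) + norm (((\<lambda>w. M *v w) ^^ n) y)"
      unfolding it by (rule norm_triangle_ineq)
    then show ?thesis using 1 2 by (simp add: algebra_simps)
  qed
  moreover have "0 \<le> \<eta>" "\<eta> < 1" unfolding \<eta>_def using t C by auto
  ultimately show ?case using C by (intro exI[of _ "\<bar>c\<bar> * norm x + C"] exI[of _ \<eta>]) auto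
qed

lemma det_zero_iff_ker:
  fixes A :: "'k::field^'n^'n"
  shows "det A = 0 \<longleftrightarrow> (\<exists>x. x \<noteq> 0 \<and> A *v x = 0)"
  using invertible_det_nz[of A] invertible_left_inverse[of A] matrix_left_invertible_ker[of A] by blast

lemma eigenvector_iff_ker:
  "M *v x = z *s x \<longleftrightarrow> (mat z - M) *v x = 0"
  for M :: "'k::field^'n^'n"
proof -
  have "mat z *v x = z *s x"
    by (simp add: mat_def matrix_vector_mult_def vec_eq_iff if_distrib[of "\<lambda>c. c * _"] cong: if_cong)
  then show ?thesis by (auto simp: matrix_vector_mult_diff_rdistrib)
qed

lemma eigenvalue_iff_det: "(\<exists>v. eigenvector M z v) \<longleftrightarrow> det (mat z - M) = 0"
  unfolding eigenvector_def eigenvector_iff_ker det_zero_iff_ker ..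

lemma poly_det: "poly (det A) z = det (\<chi> i j. poly (A $ i $ j) z)"
  for A :: "'k::{comm_ring_1} poly^'n^'n"
  unfolding det_def by (simp add: poly_sum poly_prod)

text \<open>Pairing the moduli of an eigenvector with the positive left eigenvector l bounds the
  modulus of its eigenvalue by t. Conversely t is a right eigenvalue because a matrix and its
  transpose have equal determinants.\<close>

lemma perron_frobenius_eqI:
  fixes M :: "real^'a^('a::finite)" and l :: "real^'a"
  assumes M: "\<And>\<alpha> \<beta>. M $ \<alpha> $ \<beta> \<ge> 0" and l: "\<And>\<alpha>. l $ \<alpha> > 0" and t: "t \<ge> 0"
    and eig: "\<And>\<beta>. (\<Sum>\<alpha>\<in>UNIV. l $ \<alpha> * M $ \<alpha> $ \<beta>) = t * l $ \<beta>"
  shows "perron_frobenius M = t"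
proof -
  define Mc :: "complex^'a^'a" where "Mc = (\<chi> i j. complex_of_real (M $ i $ j))"
  have E: "z \<in> complex_eigenvalues M \<longleftrightarrow> (\<exists>v. eigenvector Mc z v)" for z
    unfolding complex_eigenvalues_def Mc_def by simp
  have bound: "cmod z \<le> t" if z: "z \<in> complex_eigenvalues M" for z
  proof -
    obtain v where v: "v \<noteq> 0" "Mc *v v = z *s v" using z unfolding E eigenvector_def by blast
    have row: "cmod z * cmod (v $ \<alpha>) \<le> (\<Sum>\<beta>\<in>UNIV. M $ \<alpha> $ \<beta> * cmod (v $ \<beta>))" for \<alpha>
    proof -
      have "z * v $ \<alpha> = (\<Sum>\<beta>\<in>UNIV. complex_of_real (M $ \<alpha> $ \<beta>) * v $ \<beta>)"
        using arg_cong[OF v(2), of "\<lambda>w. w $ \<alpha>"] by (simp add: matrix_vector_mult_def Mc_def)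
      then have "cmod z * cmod (v $ \<alpha>) = cmod (\<Sum>\<beta>\<in>UNIV. complex_of_real (M $ \<alpha> $ \<beta>) * v $ \<beta>)"
        by (metis norm_mult)
      also have "\<dots> \<le> (\<Sum>\<beta>\<in>UNIV. cmod (complex_of_real (M $ \<alpha> $ \<beta>) * v $ \<beta>))" by (rule norm_sum)
      also have "\<dots> = (\<Sum>\<beta>\<in>UNIV. M $ \<alpha> $ \<beta> * cmod (v $ \<beta>))" using M by (simp add: norm_mult)
      finally show ?thesis .
    qed
    let ?s = "\<Sum>\<alpha>\<in>UNIV. l $ \<alpha> * cmod (v $ \<alpha>)"
    obtain \<alpha>0 where "v $ \<alpha>0 \<noteq> 0" using v(1) by (auto simp: vec_eq_iff)
    then have s: "?s > 0"
      using l by (intro sum_pos2[of UNIV \<alpha>0]) (auto simp: less_imp_le)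
    have "cmod z * ?s = (\<Sum>\<alpha>\<in>UNIV. l $ \<alpha> * (cmod z * cmod (v $ \<alpha>)))"
      unfolding sum_distrib_left by (rule sum.cong) simp_all
    also have "\<dots> \<le> (\<Sum>\<alpha>\<in>UNIV. l $ \<alpha> * (\<Sum>\<beta>\<in>UNIV. M $ \<alpha> $ \<beta> * cmod (v $ \<beta>)))"
      using row l by (intro sum_mono mult_left_mono) (auto simp: less_imp_le)
    also have "\<dots> = (\<Sum>\<alpha>\<in>UNIV. \<Sum>\<beta>\<in>UNIV. l $ \<alpha> * M $ \<alpha> $ \<beta> * cmod (v $ \<beta>))"
      unfolding sum_distrib_left by (simp add: mult.assoc)
    also have "\<dots> = (\<Sum>\<beta>\<in>UNIV. \<Sum>\<alpha>\<in>UNIV. l $ \<alpha> * M $ \<alpha> $ \<beta> * cmod (v $ \<beta>))" by (rule sum.swap)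
    also have "\<dots> = (\<Sum>\<beta>\<in>UNIV. (t * l $ \<beta>) * cmod (v $ \<beta>))"
      unfolding sum_distrib_right[symmetric] eig ..
    also have "\<dots> = t * ?s" unfolding sum_distrib_left by (simp add: mult.assoc)
    finally show ?thesis using s by simp
  qed
  have "(\<exists>v. eigenvector M t v)"
  proof -
    have "transpose (mat t - M) *v l = 0"
    proof -
      have "(transpose (mat t - M) *v l) $ \<beta> = 0" for \<beta>
      proof -
        have "(transpose (mat t - M) *v l) $ \<beta> = (\<Sum>\<alpha>\<in>UNIV. (if \<alpha> = \<beta> then t * l $ \<alpha> else 0) - l $ \<alpha> * M $ \<alpha> $ \<beta>)"
          unfolding transpose_def matrix_vector_mult_def mat_def
          by (simp add: algebra_simps) (rule sum.cong, auto simp: algebra_simps)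
        also have "\<dots> = 0" unfolding sum_subtractf eig by simp
        finally show ?thesis .
      qed
      then show ?thesis by (simp add: vec_eq_iff)
    qed
    moreover have "l \<noteq> 0" using l by (metis less_irrefl zero_index)
    ultimately have "det (transpose (mat t - M)) = 0" unfolding det_zero_iff_ker by blast
    then show ?thesis unfolding eigenvalue_iff_det by simp
  qed
  then obtain v where v: "v \<noteq> 0" "M *v v = t *s v" unfolding eigenvector_def by blast
  have t_in: "complex_of_real t \<in> complex_eigenvalues M"
  proof -
    let ?v = "\<chi> i. complex_of_real (v $ i)"
    have "?v \<noteq> 0" using v(1) by (auto simp: vec_eq_iff)
    moreover have "Mc *v ?v = complex_of_real t *s ?v"
    proof -
      have "(\<Sum>j\<in>UNIV. M $ i $ j * v $ j) = t * v $ i" for i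
        using arg_cong[OF v(2), of "\<lambda>w. w $ i"] by (simp add: matrix_vector_mult_def)
      then have "complex_of_real (\<Sum>j\<in>UNIV. M $ i $ j * v $ j) = complex_of_real (t * v $ i)" for i by simp
      then show ?thesis by (simp add: vec_eq_iff matrix_vector_mult_def Mc_def)
    qed
    ultimately show ?thesis unfolding E eigenvector_def by blast
  qed
  \<comment> \<open>The maximum makes sense only for finitely many eigenvalues. They are the roots
    of a polynomial that is not zero, as t + 1 exceeds the bound just proved.\<close>
  have fin: "finite (complex_eigenvalues M)"
  proof -
    define p where "p = det (\<chi> i j. (if i = j then [:0, 1:] else 0) - [:Mc $ i $ j:])"
    have p: "poly p z = det (mat z - Mc)" for z
      unfolding p_def poly_det
      by (rule arg_cong[of _ _ det]) (simp add: vec_eq_iff mat_def if_distrib[of "\<lambda>q. poly q z"])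
    have roots: "complex_eigenvalues M = {z. poly p z = 0}"
      unfolding p eigenvalue_iff_det[symmetric] using E by auto
    have "complex_of_real (t + 1) \<notin> complex_eigenvalues M"
      using bound[of "complex_of_real (t + 1)"] t by fastforce
    then have "p \<noteq> 0" unfolding roots by auto
    then show ?thesis unfolding roots by (rule poly_roots_finite)
  qed
  show ?thesis unfolding perron_frobenius_def
  proof (rule Max_eqI)
    show "finite (cmod ` complex_eigenvalues M)" using fin by simp
    show "y \<le> t" if "y \<in> cmod ` complex_eigenvalues M" for y using that bound by auto
    show "t \<in> cmod ` complex_eigenvalues M"
      by (rule image_eqI[OF _ t_in]) (use t in simp)
  qed
qed

section \<open>Periodic words and the dictionary with return times, matrices and zeta\<close>

section \<open>Self-similar combinatorics\<close>

text \<open>By periodicity each block of N steps repeats the first N entries of the rotation number,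
  hence produces the same words.\<close>

lemma renorm_chain_aiet:
  fixes f :: "('a::finite) aiet"
  assumes card: "CARD('a) \<ge> 2"
    and f: "is_aiet f" "on_unit_interval f" "infinitely_renormalizable f"
    and per: "is_period (rotation_number f) N"
  defines "W \<equiv> words (rotation_number f) N"
  shows "\<exists>Ls. renorm_chain (\<lambda>n. rv_state f (n * N)) Ls
           (\<lambda>n. ((\<lambda>w. sum_word w W) ^^ n) (($) (logslope f))) W"
proof -
  let ?\<gamma> = "rotation_number f"
  let ?S = "\<lambda>n. rv_state f (n * N)"
  define om where "om n = ((\<lambda>w. sum_word w W) ^^ n) (($) (logslope f))" for n
  have shift: "(rv_step ^^ j) (rv_state f m) = rv_state f (m + j)" for j m
    unfolding rv_state_def by (simp add: funpow_add add.commute[of m])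
  have per': "?\<gamma> (n * N + j) = ?\<gamma> j" for n j
  proof (induction n)
    case (Suc n)
    then show ?case using per unfolding is_period_def by (metis add.assoc add.commute mult_Suc)
  qed simp
  have step: "(\<exists>L'. exchange (fst (?S (Suc n))) (snd (?S (Suc n))) L' (om (Suc n))) \<and> tower (?S n) (?S (Suc n)) W"
    if ex: "exchange (fst (?S n)) (snd (?S n)) L (om n)" for n L
  proof -
    have "(\<exists>L'. exchange (fst ((rv_step ^^ N) (?S n))) (snd ((rv_step ^^ N) (?S n))) L' (sum_word (om n) (words ?\<gamma> N))) \<and>
         tower (?S n) ((rv_step ^^ N) (?S n)) (words ?\<gamma> N)"
    proof (rule rv_chain[OF card ex])
      fix j
      show "len_t ((rv_step ^^ j) (?S n)) \<noteq> len_b ((rv_step ^^ j) (?S n))"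
        unfolding shift using f(3) unfolding infinitely_renormalizable_def by blast
      show "?\<gamma> j = (state_perm ((rv_step ^^ j) (?S n)), step_type ((rv_step ^^ j) (?S n)))"
        unfolding shift using per'[of n j] by (simp add: rotation_number_def)
    qed
    then show ?thesis unfolding shift W_def[symmetric] by (simp add: om_def add.commute)
  qed
  have ex0: "exchange (fst (?S 0)) (snd (?S 0)) 1 (om 0)"
    using exchange_aiet[OF f(1,2)] by (simp add: rv_state_def om_def)
  have "\<exists>L. exchange (fst (?S n)) (snd (?S n)) L (om n) \<and> (n = 0 \<longrightarrow> L = 1)" for n
  proof (induction n)
    case 0
    then show ?case using ex0 by blast
  next
    case (Suc n)
    then show ?case using step by blast
  qed
  then obtain Ls where Ls: "\<And>n. exchange (fst (?S n)) (snd (?S n)) (Ls n) (om n)" "Ls 0 = 1" by metis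
  have "renorm_chain ?S Ls om W"
    by (rule renorm_chain.intro) (use Ls step[OF Ls(1)] in simp_all)
  then show ?thesis unfolding om_def by blast
qed

definition letter_count :: "('a \<Rightarrow> 'a list) \<Rightarrow> 'a \<Rightarrow> 'a \<Rightarrow> real" where
  "letter_count W \<alpha> \<beta> = real (card {i. i < length (W \<alpha>) \<and> W \<alpha> ! i = \<beta>})"

text \<open>Visits weighted by slope: the factor with which the base over \<alpha> contributes to
  the length of \<beta>. For zero log-slopes it is the self-similarity matrix.\<close>

definition weight_matrix :: "('a \<Rightarrow> real) \<Rightarrow> ('a \<Rightarrow> 'a list) \<Rightarrow> 'a \<Rightarrow> 'a \<Rightarrow> real" where
  "weight_matrix \<omega> W \<alpha> \<beta> = (\<Sum>i | i < length (W \<alpha>) \<and> W \<alpha> ! i = \<beta>. exp (floor_slope \<omega> W (\<alpha>, i)))"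

lemma sum_succs:
  fixes W :: "'a::finite \<Rightarrow> 'a list" and F :: "'a \<times> nat \<Rightarrow> real"
  shows "(\<Sum>\<sigma> | \<sigma> \<in> sym_index W \<and> sym_target W \<sigma> = \<beta>. F \<sigma>)
    = (\<Sum>\<alpha>\<in>UNIV. \<Sum>i | i < length (W \<alpha>) \<and> W \<alpha> ! i = \<beta>. F (\<alpha>, i))"
proof -
  have "{\<sigma>. \<sigma> \<in> sym_index W \<and> sym_target W \<sigma> = \<beta>} = (SIGMA \<alpha>:UNIV. {i. i < length (W \<alpha>) \<and> W \<alpha> ! i = \<beta>})"
    unfolding sym_index_def sym_target_def by auto
  then show ?thesis by (simp add: sum.Sigma)
qed

lemma sum_succs_letters:
  fixes W :: "'a::finite \<Rightarrow> 'a list"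
  shows "(\<Sum>\<sigma> | \<sigma> \<in> sym_index W \<and> sym_target W \<sigma> = \<beta>. F (fst \<sigma>)) = (\<Sum>\<alpha>\<in>UNIV. F \<alpha> * letter_count W \<alpha> \<beta>)"
  unfolding sum_succs letter_count_def by (simp add: mult.commute)

lemma sum_word_letter_count:
  fixes W :: "'a::finite \<Rightarrow> 'a list"
  shows "sum_word w W \<alpha> = (\<Sum>\<beta>\<in>UNIV. letter_count W \<alpha> \<beta> * w \<beta>)"
proof -
  have "sum_word w W \<alpha> = (\<Sum>i\<in>{..<length (W \<alpha>)}. w (W \<alpha> ! i))"
    unfolding sum_word_def by (simp add: sum_list_sum_nth atLeast0LessThan)
  also have "\<dots> = (\<Sum>\<beta>\<in>UNIV. \<Sum>i | i \<in> {..<length (W \<alpha>)} \<and> W \<alpha> ! i = \<beta>. w (W \<alpha> ! i))"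
    by (rule sum.group[symmetric]) auto
  also have "\<dots> = (\<Sum>\<beta>\<in>UNIV. letter_count W \<alpha> \<beta> * w \<beta>)"
    unfolding letter_count_def by (intro sum.cong refl) simp
  finally show ?thesis .
qed

context renorm_chain
begin

definition len :: "nat \<Rightarrow> 'a \<Rightarrow> real" where "len n \<alpha> = leb (fst (S n) \<alpha>)"

lemma len_pos: "len n \<alpha> > 0"
proof -
  from exchange.J_ivl[OF ex, of n \<alpha>] obtain a b where "a < b" "fst (S n) \<alpha> = {a..<b}" by (elim exE conjE)
  then show ?thesis unfolding len_def leb_def by simp
qed

lemma len_rec: "len n \<beta> = (\<Sum>\<alpha>\<in>UNIV. len (Suc n) \<alpha> * weight_matrix (om n) W \<alpha> \<beta>)"
  unfolding len_def tp.leb_cover[of n \<beta>] sum_succs weight_matrix_def sum_distrib_left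
  by (simp add: mult.commute)

lemma Ls_eq: "Ls n = (\<Sum>\<alpha>\<in>UNIV. len n \<alpha>)"
proof -
  have s: "fst (S n) \<alpha> \<in> sets lborel \<and> emeasure lborel (fst (S n) \<alpha>) \<noteq> \<infinity>" for \<alpha>
  proof -
    from exchange.J_ivl[OF ex, of n \<alpha>] obtain a b where "a < b" "fst (S n) \<alpha> = {a..<b}" by (elim exE conjE)
    then show ?thesis by simp
  qed
  have "measure lborel (\<Union>\<alpha>\<in>UNIV. fst (S n) \<alpha>) = (\<Sum>\<alpha>\<in>UNIV. measure lborel (fst (S n) \<alpha>))"
    using s exchange.J_disj[OF ex]
    by (intro measure_finite_Union) (auto simp: disjoint_family_on_def)
  moreover have "(\<Union>\<alpha>\<in>UNIV. fst (S n) \<alpha>) = {0..<Ls n}" by (rule exchange.J_Un[OF ex])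
  moreover have "0 < Ls n"
  proof -
    have "fst (S n) undefined \<noteq> {}" by (rule exchange.J_nonempty[OF ex])
    moreover have "fst (S n) undefined \<subseteq> {0..<Ls n}" by (rule exchange.J_sub[OF ex])
    ultimately show ?thesis by force
  qed
  ultimately show ?thesis unfolding len_def leb_def by simp
qed

lemma first_floor: "fst (S (Suc n)) \<alpha> \<subseteq> fst (S n) (W \<alpha> ! 0)"
proof
  fix y assume y: "y \<in> fst (S (Suc n)) \<alpha>"
  have "0 < length (W \<alpha>)" using towerD(1)[OF tws] by simp
  from tp.in_J[OF y this] show "y \<in> fst (S n) (W \<alpha> ! 0)" by simp
qed

end

locale aiet_chain =
  fixes f :: "('a::finite) aiet" and N :: nat and Ls om W
  assumes chain: "renorm_chain (\<lambda>n. rv_state f (n * N)) Ls om W"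
begin

sublocale renorm_chain "\<lambda>n. rv_state f (n * N)" Ls om W by (rule chain)

lemma level_0: "rv_state f (0 * N) = (ivl f, amap f)"
  by (simp add: rv_state_def)

lemma fl_tower_floor: "tp.fl 0 \<sigma> = tower_floor f N \<sigma>"
  unfolding tp.fl_def unfolding tower_floor_def ivl_n_def level_0 by simp

lemma ivl_n_nonempty: "\<exists>y. y \<in> ivl_n f N \<alpha>"
  using exchange.J_nonempty[OF ex[of 1], of \<alpha>] unfolding ivl_n_def by auto

lemma in_ivl: "y \<in> ivl_n f N \<alpha> \<Longrightarrow> i < length (W \<alpha>) \<Longrightarrow> (amap f ^^ i) y \<in> ivl f (W \<alpha> ! i)"
  using tp.in_J[of y 0 \<alpha> i] unfolding ivl_n_def level_0 by simp

text \<open>The defined return time concerns whole intervals; before time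
  \<open>length (W \<alpha>)\<close> even a single point of the interval misses the new domain, so
  the two notions agree.\<close>

lemma return_time_eq: "return_time f N \<alpha> = length (W \<alpha>)"
  unfolding return_time_def
proof (rule Least_equality)
  have "(amap f ^^ length (W \<alpha>)) y \<in> (\<Union>\<beta>. ivl_n f N \<beta>)" if "y \<in> ivl_n f N \<alpha>" for y
  proof -
    have y: "y \<in> fst (rv_state f (Suc 0 * N)) \<alpha>" using that unfolding ivl_n_def by simp
    then have "y \<in> {0..<Ls (Suc 0)}" using subsetD[OF exchange.J_sub[OF ex]] by blast
    then have "snd (rv_state f (Suc 0 * N)) y \<in> {0..<Ls (Suc 0)}" by (rule exchange.F_maps[OF ex])
    then show ?thesis
      using tp.F'_eq[of y 0 \<alpha>] y exchange.J_Un[OF ex, of "Suc 0"] unfolding ivl_n_def level_0 by simp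
  qed
  moreover have "0 < length (W \<alpha>)" using towerD(1)[OF tws] by simp
  ultimately show "0 < length (W \<alpha>) \<and> (amap f ^^ length (W \<alpha>)) ` ivl_n f N \<alpha> \<subseteq> (\<Union>\<beta>. ivl_n f N \<beta>)" by blast
  fix k assume k: "0 < k \<and> (amap f ^^ k) ` ivl_n f N \<alpha> \<subseteq> (\<Union>\<beta>. ivl_n f N \<beta>)"
  show "length (W \<alpha>) \<le> k"
  proof (rule ccontr)
    assume "\<not> length (W \<alpha>) \<le> k"
    then have kl: "k < length (W \<alpha>)" by simp
    obtain y where y: "y \<in> ivl_n f N \<alpha>" using ivl_n_nonempty by blast
    then obtain \<beta> where "(amap f ^^ k) y \<in> ivl_n f N \<beta>" using k by blast
    then show False using tp.avoid[of y 0 \<alpha> k \<beta>] y kl k unfolding ivl_n_def level_0 by simp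
  qed
qed

lemma tower_index_eq: "tower_index f N = sym_index W"
  unfolding tower_index_def sym_index_def return_time_eq ..

lemma ivl_unique: "x \<in> ivl f \<alpha> \<Longrightarrow> x \<in> ivl f \<beta> \<Longrightarrow> \<alpha> = \<beta>"
  using exchange.letter_unique[OF ex[of 0]] unfolding level_0 by simp

lemma floor_subset_iff:
  assumes "i < length (W \<alpha>)"
  shows "(amap f ^^ i) ` ivl_n f N \<alpha> \<subseteq> ivl f \<beta> \<longleftrightarrow> W \<alpha> ! i = \<beta>"
proof
  assume h: "(amap f ^^ i) ` ivl_n f N \<alpha> \<subseteq> ivl f \<beta>"
  obtain y where y: "y \<in> ivl_n f N \<alpha>" using ivl_n_nonempty by blast
  have "(amap f ^^ i) y \<in> ivl f \<beta>" using h y by blast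
  then show "W \<alpha> ! i = \<beta>" using ivl_unique[OF in_ivl[OF y assms]] by simp
next
  assume "W \<alpha> ! i = \<beta>"
  then show "(amap f ^^ i) ` ivl_n f N \<alpha> \<subseteq> ivl f \<beta>" using in_ivl[OF _ assms] by blast
qed

lemma floor_letter_eq:
  assumes "\<sigma> \<in> sym_index W"
  shows "floor_letter f N \<sigma> = sym_target W \<sigma>"
proof -
  have "snd \<sigma> < length (W (fst \<sigma>))" using assms unfolding sym_index_def by auto
  then show ?thesis
    unfolding floor_letter_def tower_floor_def sym_target_def by (simp add: floor_subset_iff)
qed

lemma sim_matrix_eq: "sim_matrix f N $ \<alpha> $ \<beta> = letter_count W \<alpha> \<beta>"
proof -
  have "{k. k < return_time f N \<alpha> \<and> (amap f ^^ k) ` ivl_n f N \<alpha> \<subseteq> ivl f \<beta>} = {i. i < length (W \<alpha>) \<and> W \<alpha> ! i = \<beta>}"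
    unfolding return_time_eq using floor_subset_iff by blast
  then show ?thesis unfolding sim_matrix_def letter_count_def by simp
qed

lemma len_0: "len 0 \<alpha> = lens f $ \<alpha>"
proof -
  have "len 0 \<alpha> = leb (ivl f \<alpha>)" unfolding len_def level_0 by simp
  moreover have "lens f $ \<alpha> > 0"
    using exchange.J_nonempty[OF ex[of 0], of \<alpha>] unfolding level_0 by (simp add: ivl_def)
  ultimately show ?thesis unfolding ivl_def leb_def by simp
qed

definition ratio :: "'a \<times> nat \<Rightarrow> real" where
  "ratio \<sigma> = leb (tower_floor f N \<sigma>) / leb (ivl f (sym_target W \<sigma>))"

text \<open>The symbol of index 0 enters the maximum only through its letter, which is why a path
  may replace it by a dummy.\<close>

lemma zeta_n_eq: "zeta_n f N n = (1 / real n) * Max (path_sum (\<lambda>\<sigma>. - ln (ratio \<sigma>)) ` paths W n)"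
proof -
  define Q where "Q p n \<longleftrightarrow> (\<forall>j\<in>{0..n}. p j \<in> tower_index f N) \<and>
    (\<forall>j\<in>{1..n}. floor_letter f N (p j) = fst (p (j - 1)))" for p :: "nat \<Rightarrow> 'a \<times> nat" and n
  define s where "s p n = - (\<Sum>j=1..n. ln (leb (tower_floor f N (p j)) / leb (ivl f (fst (p (j - 1))))))"
    for p :: "nat \<Rightarrow> 'a \<times> nat" and n :: nat
  let ?\<phi> = "\<lambda>\<sigma>. - ln (ratio \<sigma>)"
  have Q_Suc: "Q p (Suc n) \<longleftrightarrow> Q p n \<and> p (Suc n) \<in> sym_index W \<and> sym_target W (p (Suc n)) = fst (p n)" for p n
  proof -
    have e: "{0..Suc n} = insert (Suc n) {0..n}" "{1..Suc n} = insert (Suc n) {1..n}" by auto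
    show ?thesis unfolding Q_def e tower_index_eq using floor_letter_eq[of "p (Suc n)"] by auto
  qed
  have s_Suc: "s p (Suc n) = s p n + ?\<phi> (p (Suc n))" if "sym_target W (p (Suc n)) = fst (p n)" for p n
    unfolding s_def ratio_def using that by simp
  have fwd: "\<exists>xs\<in>paths W n. fst (hd xs) = fst (p n) \<and> path_sum ?\<phi> xs = s p n" if "Q p n" for p
    using that
  proof (induction n)
    case 0
    then show ?case by (intro bexI[of _ "[(fst (p 0), 0)]"]) (auto simp: s_def)
  next
    case (Suc n)
    then have q: "Q p n" "p (Suc n) \<in> sym_index W" "sym_target W (p (Suc n)) = fst (p n)"
      using Q_Suc by blast+
    obtain xs where xs: "xs \<in> paths W n" "fst (hd xs) = fst (p n)" "path_sum ?\<phi> xs = s p n"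
      using Suc.IH[OF q(1)] by blast
    have "p (Suc n) # xs \<in> paths W (Suc n)" using q xs by simp
    moreover have "path_sum ?\<phi> (p (Suc n) # xs) = s p (Suc n)"
      using xs(3) s_Suc[of p, OF q(3)] paths_not_Nil[OF xs(1)] by simp
    ultimately show ?case by (intro bexI[of _ "p (Suc n) # xs"]) auto
  qed
  have bwd: "\<exists>p. Q p n \<and> fst (p n) = fst (hd xs) \<and> s p n = path_sum ?\<phi> xs" if "xs \<in> paths W n" for xs
    using that
  proof (induction n arbitrary: xs)
    case 0
    then obtain \<alpha> where xs: "xs = [(\<alpha>, 0)]" by auto
    \<comment> \<open>Words are nonempty, so the dummy (\<alpha>, 0) is itself an admissible initial
      symbol.\<close>
    have "0 < length (W \<alpha>)" using towerD(1)[OF tws] by simp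
    then have "(\<alpha>, 0) \<in> sym_index W" unfolding sym_index_def by simp
    then show ?case
      by (intro exI[of _ "\<lambda>_. (\<alpha>, 0)"]) (auto simp: Q_def s_def xs tower_index_eq)
  next
    case (Suc n)
    obtain \<sigma> ys where ys: "xs = \<sigma> # ys" "\<sigma> \<in> sym_index W" "ys \<in> paths W n" "sym_target W \<sigma> = fst (hd ys)"
      using Suc.prems by (rule paths_SucE)
    obtain p where p: "Q p n" "fst (p n) = fst (hd ys)" "s p n = path_sum ?\<phi> ys"
      using Suc.IH[OF ys(3)] by blast
    let ?p = "p(Suc n := \<sigma>)"
    have "Q ?p n" using p(1) unfolding Q_def by auto
    then have "Q ?p (Suc n)" unfolding Q_Suc using ys p(2) by simp
    moreover have "s ?p n = s p n"
    proof -
      have "(\<Sum>j=1..n. ln (leb (tower_floor f N (?p j)) / leb (ivl f (fst (?p (j - 1))))))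
        = (\<Sum>j=1..n. ln (leb (tower_floor f N (p j)) / leb (ivl f (fst (p (j - 1))))))"
        by (rule sum.cong) auto
      then show ?thesis unfolding s_def by simp
    qed
    then have "s ?p (Suc n) = path_sum ?\<phi> xs"
      using s_Suc[of ?p n] ys p paths_not_Nil[OF ys(3)] by simp
    moreover have "fst (?p (Suc n)) = fst (hd xs)" using ys(1) by simp
    ultimately show ?case by blast
  qed
  have "{s p n | p. Q p n} = path_sum ?\<phi> ` paths W n"
  proof (intro equalityI subsetI)
    fix y assume "y \<in> {s p n | p. Q p n}"
    then obtain p where "y = s p n" "Q p n" by blast
    then show "y \<in> path_sum ?\<phi> ` paths W n" using fwd[of p] by force
  next
    fix y assume "y \<in> path_sum ?\<phi> ` paths W n"
    then obtain xs where "y = path_sum ?\<phi> xs" "xs \<in> paths W n" by blast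
    then show "y \<in> {s p n | p. Q p n}" using bwd[of xs] by force
  qed
  then show ?thesis unfolding zeta_n_def Q_def s_def by simp
qed

end

section \<open>Masses of cells and invariant measures of T\<close>

section \<open>Unique ergodicity\<close>

lemma weight_matrix_0: "weight_matrix (\<lambda>_. 0) W = letter_count W"
  unfolding weight_matrix_def letter_count_def floor_slope_def by (intro ext) (simp add: map_replicate_const sum_list_replicate)

lemma weight_matrix_pos: "\<beta> \<in> set (W \<alpha>) \<Longrightarrow> weight_matrix \<omega> W \<alpha> \<beta> > 0"
  unfolding weight_matrix_def by (rule sum_pos) (auto simp: in_set_conv_nth)

lemma letter_count_ge_1: "\<beta> \<in> set (W \<alpha>) \<Longrightarrow> letter_count W \<alpha> \<beta> \<ge> 1"
proof -
  assume "\<beta> \<in> set (W \<alpha>)"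
  then have "{i. i < length (W \<alpha>) \<and> W \<alpha> ! i = \<beta>} \<noteq> {}" by (auto simp: in_set_conv_nth)
  then have "card {i. i < length (W \<alpha>) \<and> W \<alpha> ! i = \<beta>} > 0" by (simp add: card_gt_0_iff)
  then show ?thesis unfolding letter_count_def by simp
qed

text \<open>With zero log-slopes the lengths satisfy a stationary positive recursion, so they scale
  by a factor t, and \<rho> = -ln t. This exhibits the lengths as a positive left eigenvector, which
  identifies exp \<rho> with the spectral radius.\<close>

lemma iet_spectrum:
  fixes T :: "('a::finite) aiet"
  assumes card: "CARD('a) \<ge> 2" and ac: "aiet_chain T N Ls om W" and om: "\<And>n. om n = (\<lambda>_. 0)"
    and full: "\<And>\<alpha> \<beta>. \<beta> \<in> set (W \<alpha>)" and unit: "(\<Sum>\<alpha>\<in>UNIV. lens T $ \<alpha>) = 1"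
    and lens_pos: "\<And>\<alpha>. lens T $ \<alpha> > 0"
  shows "\<exists>\<rho>>0. rho T N = \<rho> \<and>
    (\<forall>n \<alpha>. renorm_chain.len (\<lambda>n. rv_state T (n * N)) n \<alpha> = exp (- (real n * \<rho>)) * lens T $ \<alpha>) \<and>
    (\<forall>\<beta>. (\<Sum>\<alpha>\<in>UNIV. lens T $ \<alpha> * letter_count W \<alpha> \<beta>) = exp \<rho> * lens T $ \<beta>)"
proof -
  interpret aiet_chain T N Ls om W by (rule ac)
  have ge_1: "letter_count W \<alpha> \<beta> \<ge> 1" for \<alpha> \<beta> by (rule letter_count_ge_1[OF full])
  then have pos: "letter_count W \<alpha> \<beta> > 0" for \<alpha> \<beta> by (rule less_le_trans[OF zero_less_one])
  have rec: "len n \<beta> = (\<Sum>\<alpha>\<in>UNIV. len (Suc n) \<alpha> * letter_count W \<alpha> \<beta>)" for n \<beta>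
    using len_rec[of n \<beta>] unfolding om weight_matrix_0 .
  obtain t where t: "t > 0" "\<And>n \<alpha>. len n \<alpha> = t ^ n * len 0 \<alpha>"
    using perron_scaling[of "letter_count W" len, OF pos rec len_pos] by blast
  define \<rho> where "\<rho> = - ln t"
  have e: "exp \<rho> = 1 / t" "exp (- (real n * \<rho>)) = t ^ n" for n
    unfolding \<rho>_def using t(1) by (simp_all add: exp_minus inverse_eq_divide exp_of_nat_mult)
  have eig: "(\<Sum>\<alpha>\<in>UNIV. lens T $ \<alpha> * letter_count W \<alpha> \<beta>) = exp \<rho> * lens T $ \<beta>" for \<beta>
  proof -
    have "lens T $ \<beta> = (\<Sum>\<alpha>\<in>UNIV. (t * lens T $ \<alpha>) * letter_count W \<alpha> \<beta>)"
      using rec[of 0 \<beta>] unfolding t(2)[of "Suc 0"] len_0 by simp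
    also have "\<dots> = t * (\<Sum>\<alpha>\<in>UNIV. lens T $ \<alpha> * letter_count W \<alpha> \<beta>)"
      unfolding sum_distrib_left by (simp add: mult.assoc)
    finally show ?thesis unfolding e using t(1) by (simp add: field_simps)
  qed
  \<comment> \<open>All entries are at least 1 and there are at least two letters, so each component
    of the image of the length vector strictly exceeds that length.\<close>
  have "\<rho> > 0"
  proof -
    obtain \<beta> \<gamma> :: 'a where bg: "\<beta> \<noteq> \<gamma>"
    proof -
      have "card (UNIV - {undefined :: 'a}) = CARD('a) - 1" by (rule card_Diff_singleton) auto
      then have "card (UNIV - {undefined :: 'a}) > 0" using card by simp
      then have "UNIV - {undefined :: 'a} \<noteq> {}" by (rule card_gt_0_iff[THEN iffD1, THEN conjunct1])
      then show ?thesis using that by blast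
    qed
    have "lens T $ \<beta> < (\<Sum>\<alpha>\<in>{\<beta>, \<gamma>}. lens T $ \<alpha>)" using bg lens_pos[of \<gamma>] by simp
    also have "\<dots> \<le> (\<Sum>\<alpha>\<in>UNIV. lens T $ \<alpha>)" using lens_pos by (intro sum_mono2) (auto simp: less_imp_le)
    also have "\<dots> \<le> (\<Sum>\<alpha>\<in>UNIV. lens T $ \<alpha> * letter_count W \<alpha> \<beta>)"
      using lens_pos ge_1
      by (intro sum_mono) (simp add: less_imp_le)
    finally have "1 * lens T $ \<beta> < exp \<rho> * lens T $ \<beta>" unfolding eig by simp
    then show ?thesis using lens_pos[of \<beta>] by simp
  qed
  moreover have "rho T N = \<rho>"
  proof -
    have "perron_frobenius (sim_matrix T N) = exp \<rho>"
      by (rule perron_frobenius_eqI[of _ "lens T"])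
        (use pos lens_pos eig in \<open>simp_all add: sim_matrix_eq less_imp_le\<close>)
    then show ?thesis unfolding rho_def by simp
  qed
  ultimately show ?thesis using eig t(2) e(2) len_0 by (intro exI[of _ \<rho>]) simp
qed

lemma invariant_measure_preimage:
  assumes "invariant_prob f \<mu>" "dom_ivl f = {0..<1}" "C \<in> sets borel" "C \<subseteq> {0..<1}"
  shows "measure \<mu> {x \<in> {0..<1}. amap f x \<in> C} = measure \<mu> C"
  using assms unfolding invariant_prob_def measure_def by simp

lemma invariant_measure_image:
  assumes inv: "invariant_prob f \<mu>" and f: "is_aiet f" "on_unit_interval f"
    and A: "A \<in> sets borel" "A \<subseteq> ivl f \<alpha>"
  shows "measure \<mu> (amap f ` A) = measure \<mu> A" "amap f ` A \<in> sets borel" "amap f ` A \<subseteq> {0..<1}"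
proof -
  interpret exchange "ivl f" "amap f" 1 "($) (logslope f)" by (rule exchange_aiet[OF f])
  obtain c where c: "\<forall>x\<in>ivl f \<alpha>. amap f x = exp (logslope f $ \<alpha>) * x + c" using F_affine by blast
  show b: "amap f ` A \<in> sets borel"
    by (rule affine_image_borel[OF _ _ A(1), of "exp (logslope f $ \<alpha>)" _ c]) (use c A(2) in auto)
  have A01: "A \<subseteq> {0..<1}" using A(2) J_sub by blast
  show s: "amap f ` A \<subseteq> {0..<1}" using A01 F_maps by blast
  have "{x \<in> {0..<1}. amap f x \<in> amap f ` A} = A"
  proof (intro equalityI subsetI)
    fix x assume "x \<in> {x \<in> {0..<1}. amap f x \<in> amap f ` A}"
    then obtain z where z: "x \<in> {0..<1}" "z \<in> A" "amap f x = amap f z" by blast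
    have "x = z" by (rule F_inj[OF z(3,1) subsetD[OF A01 z(2)]])
    then show "x \<in> A" using z(2) by simp
  qed (use A01 in blast)
  moreover have "dom_ivl f = {0..<1}" using f(2) unfolding dom_ivl_def on_unit_interval_def by simp
  ultimately show "measure \<mu> (amap f ` A) = measure \<mu> A"
    using invariant_measure_preimage[OF inv _ b s] by simp
qed

text \<open>The masses of the base intervals and exp (-n \<rho>) l solve the same recursion, hence
  are proportional; total mass 1 at level 0 fixes the factor. The map may have slopes: only the
  words enter.\<close>

lemma level_mass:
  fixes f :: "('a::finite) aiet" and l :: "'a \<Rightarrow> real"
  assumes ac: "aiet_chain f N Ls om W"
    and \<nu>: "finite_measure \<nu>" "sets \<nu> = sets borel" "measure \<nu> {0..<1} = 1"
    and inv0: "\<And>\<alpha> A. A \<in> sets borel \<Longrightarrow> A \<subseteq> ivl f \<alpha> \<Longrightarrow> measure \<nu> (amap f ` A) = measure \<nu> A"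
    and full: "\<And>\<alpha> \<beta>. \<beta> \<in> set (W \<alpha>)"
    and l: "\<And>\<alpha>. l \<alpha> > 0" "(\<Sum>\<alpha>\<in>UNIV. l \<alpha>) = 1"
      "\<And>\<beta>. (\<Sum>\<alpha>\<in>UNIV. l \<alpha> * letter_count W \<alpha> \<beta>) = exp \<rho> * l \<beta>"
  shows "measure \<nu> (fst (rv_state f (n * N)) \<alpha>) = exp (- (real n * \<rho>)) * l \<alpha>"
proof -
  interpret aiet_chain f N Ls om W by (rule ac)
  interpret finite_measure \<nu> by (rule \<nu>(1))
  have inv: "A \<in> sets borel \<Longrightarrow> A \<subseteq> fst (rv_state f (0 * N)) \<alpha> \<Longrightarrow>
      measure \<nu> (snd (rv_state f (0 * N)) ` A) = measure \<nu> A" for A \<alpha>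
    unfolding level_0 fst_conv snd_conv by (rule inv0)
  let ?v = "\<lambda>n \<alpha>. measure \<nu> (fst (rv_state f (n * N)) \<alpha>)"
  let ?u = "\<lambda>n \<alpha>. exp (- (real n * \<rho>)) * l \<alpha>"
  have v: "?v n \<beta> = (\<Sum>\<alpha>\<in>UNIV. ?v (Suc n) \<alpha> * letter_count W \<alpha> \<beta>)" for n \<beta>
    unfolding sum_succs_letters[symmetric]
    by (rule measure_level[OF _ \<nu>(1,2)]) (rule inv; assumption)
  have u: "?u n \<beta> = (\<Sum>\<alpha>\<in>UNIV. ?u (Suc n) \<alpha> * letter_count W \<alpha> \<beta>)" for n \<beta>
  proof -
    have "(\<Sum>\<alpha>\<in>UNIV. ?u (Suc n) \<alpha> * letter_count W \<alpha> \<beta>) = exp (- (real (Suc n) * \<rho>)) * (exp \<rho> * l \<beta>)"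
      unfolding l(3)[symmetric] sum_distrib_left by (simp only: mult.assoc)
    also have "\<dots> = ?u n \<beta>"
      unfolding mult.assoc[symmetric] exp_add[symmetric] by (simp add: algebra_simps)
    finally show ?thesis ..
  qed
  have ge_1: "letter_count W \<alpha> \<beta> \<ge> 1" for \<alpha> \<beta> by (rule letter_count_ge_1[OF full])
  then have pos: "letter_count W \<alpha> \<beta> > 0" for \<alpha> \<beta> by (rule less_le_trans[OF zero_less_one])
  have "\<exists>c. \<forall>n \<alpha>. ?v n \<alpha> = c * ?u n \<alpha>"
    using l(1) by (intro perron_unique[of "letter_count W" ?u ?v, OF pos u _ v]) auto
  then obtain c where c: "\<And>n \<alpha>. ?v n \<alpha> = c * ?u n \<alpha>" by blast
  have "(\<Sum>\<alpha>\<in>UNIV. ?v 0 \<alpha>) = measure \<nu> (\<Union>\<alpha>\<in>UNIV. fst (rv_state f (0 * N)) \<alpha>)"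
  proof (rule finite_measure_finite_Union[symmetric])
    show "range (fst (rv_state f (0 * N))) \<subseteq> sets \<nu>" using J_borel[of 0] \<nu>(2) by auto
    show "disjoint_family_on (fst (rv_state f (0 * N))) UNIV"
      using exchange.J_disj[OF ex[of 0]] unfolding disjoint_family_on_def by blast
  qed simp
  also have "\<dots> = 1" using exchange.J_Un[OF ex[of 0]] Ls_0 \<nu>(3) by simp
  finally have "c = 1" unfolding c sum_distrib_left[symmetric] using l(2) by simp
  then show ?thesis using c by simp
qed

text \<open>Cells inside [0,y) count equally for both measures. The rest of [0,y) lies in the single
  cell that contains y, of mass at most e.\<close>

lemma measure_le_of_cells:
  fixes \<nu>1 \<nu>2 :: "real measure" and I :: "'b \<Rightarrow> real set"
  assumes \<nu>: "finite_measure \<nu>1" "finite_measure \<nu>2" "sets \<nu>1 = sets borel" "sets \<nu>2 = sets borel"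
    and fin: "finite P" and cov: "(\<Union>p\<in>P. I p) = {0..<1}" and iv: "\<And>p. p \<in> P \<Longrightarrow> \<exists>u v. I p = {u..<v}"
    and dj: "\<And>p q. p \<in> P \<Longrightarrow> q \<in> P \<Longrightarrow> p \<noteq> q \<Longrightarrow> I p \<inter> I q = {}"
    and eq: "\<And>p. p \<in> P \<Longrightarrow> measure \<nu>1 (I p) = measure \<nu>2 (I p)"
    and small: "\<And>p. p \<in> P \<Longrightarrow> measure \<nu>1 (I p) \<le> e"
    and y: "0 \<le> y" "y < 1"
  shows "measure \<nu>1 {0..<y} \<le> measure \<nu>2 {0..<y} + e"
proof -
  interpret m1: finite_measure \<nu>1 by fact
  interpret m2: finite_measure \<nu>2 by fact
  define Q where "Q = {p \<in> P. I p \<subseteq> {0..<y}}"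
  have finQ: "finite Q" unfolding Q_def using fin by simp
  have QP: "p \<in> P" if "p \<in> Q" for p using that unfolding Q_def by simp
  have bor: "I p \<in> sets borel" if "p \<in> P" for p
  proof -
    from iv[OF that] obtain u v where "I p = {u..<v}" by (elim exE)
    then show ?thesis by simp
  qed
  have "y \<in> (\<Union>p\<in>P. I p)" unfolding cov using y by simp
  then obtain p0 where p0: "p0 \<in> P" "y \<in> I p0" by blast
  have sub: "{0..<y} \<subseteq> (\<Union>p\<in>Q. I p) \<union> I p0"
  proof
    fix x assume x: "x \<in> {0..<y}"
    then have "x \<in> (\<Union>p\<in>P. I p)" unfolding cov using y by simp
    then obtain p where p: "p \<in> P" "x \<in> I p" by blast
    show "x \<in> (\<Union>p\<in>Q. I p) \<union> I p0"
    proof (cases "p = p0")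
      case True
      then show ?thesis using p by simp
    next
      case False
      from iv[OF p(1)] obtain u v where uv: "I p = {u..<v}" by (elim exE)
      have "y \<notin> I p" using dj[OF p(1) p0(1) False] p0(2) by blast
      then have "v \<le> y" using p(2) x uv by simp
      have "I p \<subseteq> {0..<1}" unfolding cov[symmetric] using p(1) by blast
      then have "I p \<subseteq> {0..<y}" using \<open>v \<le> y\<close> uv by auto
      then show ?thesis using p unfolding Q_def by blast
    qed
  qed
  have UQ: "(\<Union>p\<in>Q. I p) \<in> sets borel" using finQ bor QP by (intro sets.finite_UN) auto
  have dQ: "disjoint_family_on I Q"
    unfolding disjoint_family_on_def using dj QP by blast
  have "measure \<nu>1 {0..<y} \<le> measure \<nu>1 ((\<Union>p\<in>Q. I p) \<union> I p0)"
    using UQ bor[OF p0(1)] \<nu>(3) by (intro m1.finite_measure_mono[OF sub]) simp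
  also have "\<dots> \<le> measure \<nu>1 (\<Union>p\<in>Q. I p) + measure \<nu>1 (I p0)"
    using UQ bor[OF p0(1)] \<nu>(3) by (intro measure_Un_le) simp_all
  also have "measure \<nu>1 (\<Union>p\<in>Q. I p) = (\<Sum>p\<in>Q. measure \<nu>1 (I p))"
    using bor QP \<nu>(3) by (intro m1.finite_measure_finite_Union finQ dQ) auto
  also have "\<dots> = (\<Sum>p\<in>Q. measure \<nu>2 (I p))" using eq QP by (intro sum.cong) auto
  also have "\<dots> = measure \<nu>2 (\<Union>p\<in>Q. I p)"
    using bor QP \<nu>(4) by (intro m2.finite_measure_finite_Union[symmetric] finQ dQ) auto
  also have "\<dots> \<le> measure \<nu>2 {0..<y}"
    using \<nu>(4) by (intro m2.finite_measure_mono) (auto simp: Q_def)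
  also have "measure \<nu>1 (I p0) \<le> e" by (rule small[OF p0(1)])
  finally show ?thesis by simp
qed

text \<open>Lebesgue measure and \<nu> give each cell the same mass: the first because all slopes
  are 1, the second by proportionality of the recursions. Comparing in both directions leaves an
  error exp (-n \<rho>).\<close>

lemma iet_uniquely_ergodic:
  fixes T :: "('a::finite) aiet"
  assumes ac: "aiet_chain T N Ls om W" and om: "\<And>n. om n = (\<lambda>_. 0)"
    and \<nu>: "finite_measure \<nu>" "sets \<nu> = sets borel" "measure \<nu> {0..<1} = 1"
    and inv0: "\<And>\<alpha> A. A \<in> sets borel \<Longrightarrow> A \<subseteq> ivl T \<alpha> \<Longrightarrow> measure \<nu> (amap T ` A) = measure \<nu> A"
    and full: "\<And>\<alpha> \<beta>. \<beta> \<in> set (W \<alpha>)"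
    and unit: "(\<Sum>\<alpha>\<in>UNIV. lens T $ \<alpha>) = 1" and lens_pos: "\<And>\<alpha>. lens T $ \<alpha> > 0"
    and \<rho>: "\<rho> > 0"
    and len: "\<And>n \<alpha>. renorm_chain.len (\<lambda>n. rv_state T (n * N)) n \<alpha> = exp (- (real n * \<rho>)) * lens T $ \<alpha>"
    and eig: "\<And>\<beta>. (\<Sum>\<alpha>\<in>UNIV. lens T $ \<alpha> * letter_count W \<alpha> \<beta>) = exp \<rho> * lens T $ \<beta>"
    and y: "0 \<le> y" "y < 1"
  shows "measure \<nu> {0..<y} = y"
proof -
  interpret aiet_chain T N Ls om W by (rule ac)
  have inv: "A \<in> sets borel \<Longrightarrow> A \<subseteq> fst (rv_state T (0 * N)) \<alpha> \<Longrightarrow>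
      measure \<nu> (snd (rv_state T (0 * N)) ` A) = measure \<nu> A" for A \<alpha>
    unfolding level_0 fst_conv snd_conv by (rule inv0)
  define \<nu>2 where "\<nu>2 = uniform_measure lborel {0..<1::real}"
  have \<nu>2: "finite_measure \<nu>2" "sets \<nu>2 = sets borel"
    unfolding \<nu>2_def by (intro prob_space.finite_measure prob_space_uniform_measure) simp_all
  have \<nu>2_ivl: "measure \<nu>2 {u..<v} = v - u" if "0 \<le> u" "u \<le> v" "v \<le> 1" for u v
  proof -
    have "{0..<1} \<inter> {u..<v} = {u..<v}" using that by auto
    then show ?thesis unfolding \<nu>2_def using that by (simp add: measure_uniform_measure)
  qed
  have "floor_slope (om n) W \<sigma> = 0" for n \<sigma>
    unfolding om floor_slope_def by (simp add: map_replicate_const sum_list_replicate)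
  then have slope0: "slope xs = 0" for xs
    by (induction xs) simp_all
  have m1: "measure \<nu> (cell xs) = exp (- (real n * \<rho>)) * lens T $ (fst (hd xs))" if "xs \<in> paths W n" for n xs
  proof -
    have "measure \<nu> (cell xs) = measure \<nu> (fst (rv_state T (n * N)) (fst (hd xs)))"
      by (rule measure_cell[OF _ that]) (rule inv; assumption)
    also have "\<dots> = exp (- (real n * \<rho>)) * lens T $ (fst (hd xs))"
      by (rule level_mass[OF ac \<nu> _ full lens_pos unit eig]) (rule inv0; assumption)
    finally show ?thesis .
  qed
  have m2: "measure \<nu>2 (cell xs) = exp (- (real n * \<rho>)) * lens T $ (fst (hd xs))" if "xs \<in> paths W n" for n xs
  proof -
    from cell_ivl[OF that] obtain u v where uv: "0 \<le> u" "u < v" "v \<le> 1" "cell xs = {u..<v}"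
      by (elim exE conjE)
    then have "measure \<nu>2 (cell xs) = leb (cell xs)" using \<nu>2_ivl by (simp add: leb_def)
    also have "\<dots> = renorm_chain.len (\<lambda>n. rv_state T (n * N)) n (fst (hd xs))"
      unfolding leb_cell[OF that] slope0 len_def by simp
    finally show ?thesis unfolding len .
  qed
  have lens_le: "lens T $ \<alpha> \<le> 1" for \<alpha>
    unfolding unit[symmetric] using lens_pos by (intro member_le_sum) (auto simp: less_imp_le)
  have iv: "\<exists>u v. cell p = {u..<v}" if "p \<in> paths W n" for p n using cell_ivl[OF that] by blast
  have b: "\<bar>measure \<nu> {0..<y} - measure \<nu>2 {0..<y}\<bar> \<le> exp (- (real n * \<rho>))" for n
  proof -
    have "measure \<nu> {0..<y} \<le> measure \<nu>2 {0..<y} + exp (- (real n * \<rho>))"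
      by (rule measure_le_of_cells[OF \<nu>(1) \<nu>2(1) \<nu>(2) \<nu>2(2) finite_paths[of W n] cell_cover iv cell_disj _ _ y])
        (use lens_le in \<open>simp_all add: m1 m2\<close>)
    moreover have "measure \<nu>2 {0..<y} \<le> measure \<nu> {0..<y} + exp (- (real n * \<rho>))"
      by (rule measure_le_of_cells[OF \<nu>2(1) \<nu>(1) \<nu>2(2) \<nu>(2) finite_paths[of W n] cell_cover iv cell_disj _ _ y])
        (use lens_le in \<open>simp_all add: m1 m2\<close>)
    ultimately show ?thesis by linarith
  qed
  have "(\<lambda>n. exp (- \<rho>) ^ n) \<longlonglongrightarrow> 0" using \<rho> by (intro LIMSEQ_power_zero) simp
  then have "(\<lambda>n. exp (- (real n * \<rho>))) \<longlonglongrightarrow> 0" by (simp add: exp_of_nat_mult[symmetric])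
  then have "\<bar>measure \<nu> {0..<y} - measure \<nu>2 {0..<y}\<bar> \<le> 0"
    by (rule LIMSEQ_le_const) (use b in auto)
  then show ?thesis using \<nu>2_ivl[of 0 y] y by simp
qed

section \<open>Conjugacy, comparison of f with f_c, and the failure of the coboundary
  equation\<close>

section \<open>Comparison with the central model\<close>

lemma invariant_probD:
  assumes "invariant_prob f \<mu>" "on_unit_interval f"
  shows "prob_space \<mu>" "sets \<mu> = sets borel" "measure \<mu> {0..<1} = 1"
proof -
  have "dom_ivl f = {0..<1}" using assms(2) unfolding dom_ivl_def on_unit_interval_def by simp
  then show "prob_space \<mu>" "sets \<mu> = sets borel" "measure \<mu> {0..<1} = 1"
    using assms(1) unfolding invariant_prob_def measure_def by simp_all
qed

text \<open>The image of \<mu> under h is T-invariant, hence Lebesgue measure. As h is increasing,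
  the preimage of [0, h x) is [0, x).\<close>

lemma conjugacy_cdf:
  fixes T f :: "('a::finite) aiet"
  assumes T: "is_aiet T" "on_unit_interval T" and f: "is_aiet f" "on_unit_interval f"
    and conj: "conjugacy h f T" and inv: "invariant_prob f \<mu>"
    and unique: "\<And>\<nu> y. finite_measure \<nu> \<Longrightarrow> sets \<nu> = sets borel \<Longrightarrow> measure \<nu> {0..<1} = 1 \<Longrightarrow>
       (\<And>\<alpha> A. A \<in> sets borel \<Longrightarrow> A \<subseteq> ivl T \<alpha> \<Longrightarrow> measure \<nu> (amap T ` A) = measure \<nu> A) \<Longrightarrow>
       0 \<le> y \<Longrightarrow> y < 1 \<Longrightarrow> measure \<nu> {0..<y} = y"
    and x: "x \<in> {0..1}"
  shows "h x = measure \<mu> {0..<x}"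
proof (cases "x = 1")
  case True
  then show ?thesis
    using conj invariant_probD(3)[OF inv f(2)] unfolding conjugacy_def increasing_homeo_def by simp
next
  case False
  then have x01: "x \<in> {0..<1}" using x by simp
  note \<mu> = invariant_probD[OF inv f(2)]
  interpret \<mu>: prob_space \<mu> by (rule \<mu>(1))
  interpret ET: exchange "ivl T" "amap T" 1 "($) (logslope T)" by (rule exchange_aiet[OF T])
  interpret Ef: exchange "ivl f" "amap f" 1 "($) (logslope f)" by (rule exchange_aiet[OF f])
  obtain g where g: "homeomorphism {0..<1} {0..<1} h g" and mono: "strict_mono_on {0..<1} h"
    and hf: "\<And>z. z \<in> {0..<1} \<Longrightarrow> h (amap f z) = amap T (h z)"
    using conj unfolding conjugacy_def increasing_homeo_def by blast
  have cont: "continuous_on {0..<1} h" using g by (rule homeomorphism_cont1)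
  have img: "h ` {0..<1} = {0..<1}" using g by (rule homeomorphism_image1)
  have h01: "h z \<in> {0..<1}" if "z \<in> {0..<1}" for z using imageI[OF that, of h] unfolding img .
  \<comment> \<open>Continuity of h is available on [0,1) only, so measurability is obtained on the
    restricted space.\<close>
  define \<mu>' where "\<mu>' = restrict_space \<mu> {0..<1}"
  have s01: "{0..<1::real} \<in> sets \<mu>" using \<mu>(2) by simp
  have "emeasure \<mu> {0..<1} = 1" using \<mu>(3) by (simp add: \<mu>.emeasure_eq_measure)
  then have pr: "prob_space \<mu>'" unfolding \<mu>'_def using s01 by (intro prob_space_restrict_space)
  have sp: "space \<mu>' = {0..<1}" unfolding \<mu>'_def using sets_eq_imp_space_eq[OF \<mu>(2)] by (simp add: space_restrict_space)
  have "h \<in> borel_measurable (restrict_space borel {0..<1})"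
    by (rule borel_measurable_continuous_on_restrict[OF cont])
  then have hm: "h \<in> borel_measurable \<mu>'"
    unfolding \<mu>'_def by (simp add: measurable_cong_sets[OF sets_restrict_space_cong[OF \<mu>(2)] refl])
  define \<nu> where "\<nu> = distr \<mu>' borel h"
  have \<nu>: "measure \<nu> A = measure \<mu> {z \<in> {0..<1}. h z \<in> A}" if "A \<in> sets borel" for A
  proof -
    have "measure \<nu> A = measure \<mu>' (h -` A \<inter> {0..<1})"
      unfolding \<nu>_def using measure_distr[OF hm that] sp by simp
    also have "\<dots> = measure \<mu> (h -` A \<inter> {0..<1})"
      unfolding \<mu>'_def using s01 by (intro measure_restrict_space) auto
    also have "h -` A \<inter> {0..<1} = {z \<in> {0..<1}. h z \<in> A}" by auto
    finally show ?thesis .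
  qed
  have pre_sets: "{z \<in> {0..<1}. h z \<in> A} \<in> sets borel" if "A \<in> sets borel" for A
  proof -
    have "h -` A \<inter> {0..<1} \<in> sets \<mu>'" using measurable_sets[OF hm that] sp by simp
    then have "h -` A \<inter> {0..<1} \<in> sets \<mu>" unfolding \<mu>'_def using s01 by (simp add: sets_restrict_space_iff)
    moreover have "h -` A \<inter> {0..<1} = {z \<in> {0..<1}. h z \<in> A}" by auto
    ultimately show ?thesis using \<mu>(2) by simp
  qed
  have "measure \<nu> {0..<h x} = h x"
  proof (rule unique)
    show "finite_measure \<nu>"
      unfolding \<nu>_def by (intro prob_space.finite_measure prob_space.prob_space_distr pr hm)
    show "sets \<nu> = sets borel" unfolding \<nu>_def by simp
    have "{z \<in> {0..<1}. h z \<in> {0..<1}} = {0..<1}" using h01 by blast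
    then show "measure \<nu> {0..<1} = 1" using \<nu>[of "{0..<1}"] \<mu>(3) by simp
    show "0 \<le> h x" "h x < 1" using h01[OF x01] by simp_all
    fix \<alpha> A assume A: "A \<in> sets borel" "A \<subseteq> ivl T \<alpha>"
    obtain c where c: "\<forall>x\<in>ivl T \<alpha>. amap T x = exp (logslope T $ \<alpha>) * x + c" using ET.F_affine by blast
    have TA: "amap T ` A \<in> sets borel"
      by (rule affine_image_borel[OF _ _ A(1), of "exp (logslope T $ \<alpha>)" _ c]) (use c A(2) in auto)
    have A01: "A \<subseteq> {0..<1}" using A(2) ET.J_sub by blast
    \<comment> \<open>Invariance of \<mu> speaks of preimages, while that of \<nu> is wanted for
      images. Since T is injective, the preimage of this set under f is exactly the preimage of
      \<open>A\<close> under h.\<close>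
    let ?C = "{z \<in> {0..<1}. h z \<in> amap T ` A}"
    have "{z \<in> {0..<1}. amap f z \<in> ?C} = {z \<in> {0..<1}. h z \<in> A}"
    proof (intro equalityI subsetI)
      fix z assume "z \<in> {z \<in> {0..<1}. amap f z \<in> ?C}"
      then have z: "z \<in> {0..<1}" "amap T (h z) \<in> amap T ` A" using hf by auto
      then obtain w where w: "w \<in> A" "amap T (h z) = amap T w" by blast
      have "h z = w" by (rule ET.F_inj[OF w(2) h01[OF z(1)] subsetD[OF A01 w(1)]])
      then show "z \<in> {z \<in> {0..<1}. h z \<in> A}" using z(1) w(1) by simp
    next
      fix z assume "z \<in> {z \<in> {0..<1}. h z \<in> A}"
      then have z: "z \<in> {0..<1}" "h z \<in> A" by simp_all
      then have "h (amap f z) \<in> amap T ` A" using hf by simp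
      then show "z \<in> {z \<in> {0..<1}. amap f z \<in> ?C}" using z(1) Ef.F_maps[OF z(1)] by simp
    qed
    moreover have "measure \<mu> {z \<in> {0..<1}. amap f z \<in> ?C} = measure \<mu> ?C"
    proof (rule invariant_measure_preimage[OF inv])
      show "dom_ivl f = {0..<1}" using f(2) unfolding dom_ivl_def on_unit_interval_def by simp
      show "?C \<in> sets borel" by (rule pre_sets[OF TA])
    qed blast
    ultimately show "measure \<nu> (amap T ` A) = measure \<nu> A"
      using \<nu>[OF TA] \<nu>[OF A(1)] by simp
  qed
  moreover have "{z \<in> {0..<1}. h z \<in> {0..<h x}} = {0..<x}"
  proof (intro equalityI subsetI)
    fix z assume z: "z \<in> {z \<in> {0..<1}. h z \<in> {0..<h x}}"
    then have "h z < h x" "z \<in> {0..<1}" by simp_all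
    then have "z < x" using strict_mono_on_less[OF mono, of z x] x01 by simp
    then show "z \<in> {0..<x}" using z by simp
  next
    fix z assume z: "z \<in> {0..<x}"
    then have z01: "z \<in> {0..<1}" using x01 by simp
    then have "h z < h x" using strict_mono_on_less[OF mono, of z x] x01 z by simp
    then show "z \<in> {z \<in> {0..<1}. h z \<in> {0..<h x}}" using z01 h01[OF z01] by simp
  qed
  ultimately show ?thesis using \<nu>[of "{0..<h x}"] by simp
qed

lemma aff_chain:
  fixes T f :: "('a::finite) aiet"
  assumes "CARD('a) \<ge> 2" "f \<in> Aff T w" "is_period (rotation_number T) N"
  shows "\<exists>Ls. aiet_chain f N Ls (\<lambda>n. ((\<lambda>v. sum_word v (words (rotation_number T) N)) ^^ n) (($) w))
           (words (rotation_number T) N)"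
proof -
  have f: "is_aiet f" "on_unit_interval f" "infinitely_renormalizable f"
      "rotation_number f = rotation_number T" "logslope f = w"
    using assms(2) unfolding Aff_def by simp_all
  from renorm_chain_aiet[OF assms(1) f(1-3)] assms(3) show ?thesis
    unfolding f(4,5) aiet_chain_def by blast
qed

lemma floor_slope_diff:
  fixes W :: "'a::finite \<Rightarrow> 'a list"
  assumes "\<And>\<alpha>. \<bar>v \<alpha> - w \<alpha>\<bar> \<le> e"
  shows "\<bar>floor_slope v W \<sigma> - floor_slope w W \<sigma>\<bar> \<le> real (\<Sum>\<alpha>\<in>UNIV. length (W \<alpha>)) * e"
proof -
  have e: "e \<ge> 0" using assms[of undefined] by linarith
  have *: "\<bar>sum_list (map v xs) - sum_list (map w xs)\<bar> \<le> real (length xs) * e" for xs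
  proof (induction xs)
    case (Cons x xs)
    then show ?case using assms[of x] by (simp add: algebra_simps)
  qed simp
  have "length (take (snd \<sigma>) (W (fst \<sigma>))) \<le> length (W (fst \<sigma>))" by simp
  also have "\<dots> \<le> (\<Sum>\<alpha>\<in>UNIV. length (W \<alpha>))" by (rule member_le_sum) auto
  finally have "real (length (take (snd \<sigma>) (W (fst \<sigma>)))) * e \<le> real (\<Sum>\<alpha>\<in>UNIV. length (W \<alpha>)) * e"
    using e by (intro mult_right_mono) (simp_all only: of_nat_le_iff)
  then show ?thesis using *[of "take (snd \<sigma>) (W (fst \<sigma>))"] unfolding floor_slope_def by linarith
qed

text \<open>With the same log-slopes at all levels the recursion for lengths is stationary, so the
  map is exactly self-similar with a factor t, and the ratios of level 0 describe every
  level.\<close>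

lemma central_chain_scaling:
  fixes f :: "('a::finite) aiet"
  assumes ac: "aiet_chain f N Ls om W" and om: "\<And>n. om n = w"
    and full: "\<And>\<alpha> \<beta>. \<beta> \<in> set (W \<alpha>)" and card: "CARD('a) \<ge> 2"
  shows "\<exists>t>0. (\<forall>\<beta>. lens f $ \<beta> = (\<Sum>\<alpha>\<in>UNIV. t * lens f $ \<alpha> * weight_matrix w W \<alpha> \<beta>)) \<and>
    (\<forall>\<sigma>\<in>sym_index W. aiet_chain.ratio f N W \<sigma> = exp (floor_slope w W \<sigma>) * t * lens f $ (fst \<sigma>) / lens f $ (sym_target W \<sigma>)) \<and>
    (\<forall>\<sigma>\<in>sym_index W. 0 < aiet_chain.ratio f N W \<sigma> \<and> aiet_chain.ratio f N W \<sigma> < 1)"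
proof -
  interpret aiet_chain f N Ls om W by (rule ac)
  have rec: "len n \<beta> = (\<Sum>\<alpha>\<in>UNIV. len (Suc n) \<alpha> * weight_matrix w W \<alpha> \<beta>)" for n \<beta>
    using len_rec[of n \<beta>] unfolding om .
  have pos: "weight_matrix w W \<alpha> \<beta> > 0" for \<alpha> \<beta> by (rule weight_matrix_pos[OF full])
  obtain t where t: "t > 0" "\<And>n \<alpha>. len n \<alpha> = t ^ n * len 0 \<alpha>"
    using perron_scaling[of "weight_matrix w W" len, OF pos rec len_pos] by blast
  have eig: "lens f $ \<beta> = (\<Sum>\<alpha>\<in>UNIV. t * lens f $ \<alpha> * weight_matrix w W \<alpha> \<beta>)" for \<beta>
    using rec[of 0 \<beta>] unfolding t(2)[of "Suc 0"] len_0 by simp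
  have lp: "lens f $ \<alpha> > 0" for \<alpha> using len_pos[of 0 \<alpha>] unfolding len_0 .
  have r: "ratio \<sigma> = exp (floor_slope w W \<sigma>) * t * lens f $ (fst \<sigma>) / lens f $ (sym_target W \<sigma>)"
    if "\<sigma> \<in> sym_index W" for \<sigma>
  proof -
    have "leb (tower_floor f N \<sigma>) = exp (floor_slope w W \<sigma>) * len (Suc 0) (fst \<sigma>)"
      unfolding fl_tower_floor[symmetric] tp.leb_fl[OF that] om len_def ..
    also have "len (Suc 0) (fst \<sigma>) = t * lens f $ (fst \<sigma>)" unfolding t(2)[of "Suc 0"] len_0 by simp
    finally have "leb (tower_floor f N \<sigma>) = exp (floor_slope w W \<sigma>) * (t * lens f $ (fst \<sigma>))" .
    moreover have "leb (ivl f (sym_target W \<sigma>)) = lens f $ (sym_target W \<sigma>)"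
      using len_0[of "sym_target W \<sigma>"] unfolding len_def level_0 by simp
    ultimately show ?thesis unfolding ratio_def by simp
  qed
  have r0: "0 < ratio \<sigma>" if "\<sigma> \<in> sym_index W" for \<sigma> unfolding r[OF that] using t(1) lp by simp
  have sum1: "(\<Sum>\<sigma> | \<sigma> \<in> sym_index W \<and> sym_target W \<sigma> = \<beta>. ratio \<sigma>) = 1" for \<beta>
  proof -
    have "(\<Sum>\<sigma> | \<sigma> \<in> sym_index W \<and> sym_target W \<sigma> = \<beta>. ratio \<sigma>)
      = (\<Sum>\<sigma> | \<sigma> \<in> sym_index W \<and> sym_target W \<sigma> = \<beta>. exp (floor_slope w W \<sigma>) * t * lens f $ (fst \<sigma>) / lens f $ \<beta>)"
      using r by (intro sum.cong) auto
    also have "\<dots> = (\<Sum>\<alpha>\<in>UNIV. t * lens f $ \<alpha> * weight_matrix w W \<alpha> \<beta>) / lens f $ \<beta>"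
      unfolding sum_succs weight_matrix_def sum_divide_distrib sum_distrib_left fst_conv
      by (intro sum.cong refl) (simp add: mult_ac)
    also have "\<dots> = 1" unfolding eig[of \<beta>, symmetric] using lp[of \<beta>] by simp
    finally show ?thesis .
  qed
  \<comment> \<open>The ratios of the floors inside one interval add up to 1, and a second letter
    supplies another floor there.\<close>
  have r1: "ratio \<sigma> < 1" if s: "\<sigma> \<in> sym_index W" for \<sigma>
  proof -
    let ?A = "{\<tau>. \<tau> \<in> sym_index W \<and> sym_target W \<tau> = sym_target W \<sigma>}"
    obtain \<gamma> where g: "\<gamma> \<noteq> fst \<sigma>"
    proof -
      have "card (UNIV - {fst \<sigma>}) = CARD('a) - 1" by (rule card_Diff_singleton) auto
      then have "card (UNIV - {fst \<sigma>}) > 0" using card by simp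
      then have "UNIV - {fst \<sigma>} \<noteq> {}" by (rule card_gt_0_iff[THEN iffD1, THEN conjunct1])
      then show ?thesis using that by blast
    qed
    obtain i where i: "i < length (W \<gamma>)" "W \<gamma> ! i = sym_target W \<sigma>"
      using full[where \<alpha> = \<gamma> and \<beta> = "sym_target W \<sigma>"] by (auto simp: in_set_conv_nth)
    have in_A: "(\<gamma>, i) \<in> ?A" using i unfolding sym_index_def sym_target_def by simp
    have ne: "\<sigma> \<noteq> (\<gamma>, i)" using g by auto
    have "ratio \<sigma> < ratio \<sigma> + ratio (\<gamma>, i)" using r0 in_A by simp
    also have "\<dots> = (\<Sum>\<tau>\<in>{\<sigma>, (\<gamma>, i)}. ratio \<tau>)" using ne by simp
    also have "\<dots> \<le> (\<Sum>\<tau>\<in>?A. ratio \<tau>)"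
      using r0 in_A s by (intro sum_mono2 tp.finite_succs) (auto simp: less_imp_le)
    finally show ?thesis unfolding sum1 .
  qed
  show ?thesis using t(1) eig r r0 r1 by blast
qed

text \<open>The logarithm of a cell length is a sum of slopes plus the logarithm of a base length.
  The slopes differ from those of f_c by a summable error; the base lengths differ by a bounded
  factor, since their quotient solves a summably perturbed averaging recursion.\<close>

lemma size_comparison:
  fixes f fc :: "('a::finite) aiet"
  assumes ac: "aiet_chain f N Ls om W" and acc: "aiet_chain fc N Lsc omc W" and omc: "\<And>n. omc n = w"
    and full: "\<And>\<alpha> \<beta>. \<beta> \<in> set (W \<alpha>)" and card: "CARD('a) \<ge> 2"
    and decay: "\<And>n \<alpha>. \<bar>om n \<alpha> - w \<alpha>\<bar> \<le> C * \<theta> ^ n" and \<theta>: "0 \<le> C" "0 \<le> \<theta>" "\<theta> < 1"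
  shows "\<exists>D. \<forall>n. \<forall>xs\<in>paths W n.
    \<bar>ln (leb (renorm_chain.cell (\<lambda>n. rv_state f (n * N)) xs)) - path_sum (\<lambda>\<sigma>. ln (aiet_chain.ratio fc N W \<sigma>)) xs\<bar> \<le> D"
proof -
  interpret F: aiet_chain f N Ls om W by (rule ac)
  interpret G: aiet_chain fc N Lsc omc W by (rule acc)
  obtain t where t: "t > 0" "\<And>\<beta>. lens fc $ \<beta> = (\<Sum>\<alpha>\<in>UNIV. t * lens fc $ \<alpha> * weight_matrix w W \<alpha> \<beta>)"
    "\<And>\<sigma>. \<sigma> \<in> sym_index W \<Longrightarrow> G.ratio \<sigma> = exp (floor_slope w W \<sigma>) * t * lens fc $ (fst \<sigma>) / lens fc $ (sym_target W \<sigma>)"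
    using central_chain_scaling[OF acc omc full card] by blast
  let ?l = "\<lambda>\<alpha>. lens fc $ \<alpha>"
  have lp: "?l \<alpha> > 0" for \<alpha> using G.len_pos[of 0 \<alpha>] unfolding G.len_0 .
  define q where "q = real (\<Sum>\<alpha>\<in>UNIV. length (W \<alpha>))"
  define e where "e n = q * (C * \<theta> ^ n)" for n
  have q: "q \<ge> 0" unfolding q_def by (rule of_nat_0_le_iff)
  have e0: "e n \<ge> 0" for n unfolding e_def using q \<theta> by simp
  have fs: "\<bar>floor_slope (om n) W \<sigma> - floor_slope w W \<sigma>\<bar> \<le> e n" for n \<sigma>
    unfolding e_def q_def by (rule floor_slope_diff[OF decay])
  define E where "E = q * C / (1 - \<theta>)"
  have E: "(\<Sum>j<n. e j) \<le> E" for n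
  proof -
    have "(\<Sum>j<n. e j) = q * C * (\<Sum>j<n. \<theta> ^ j)"
      unfolding e_def sum_distrib_left by (simp add: mult.assoc)
    also have "(\<Sum>j<n. \<theta> ^ j) \<le> 1 / (1 - \<theta>)"
      using \<theta> by (simp add: sum_gp_strict divide_right_mono)
    then have "q * C * (\<Sum>j<n. \<theta> ^ j) \<le> q * C * (1 / (1 - \<theta>))"
      using q \<theta> by (intro mult_left_mono) auto
    finally show ?thesis unfolding E_def by simp
  qed
  \<comment> \<open>The denominator is the base length of f_c at level n. Dividing by it turns the
    unperturbed recursion into an average with weights summing to 1.\<close>
  define x where "x n \<alpha> = F.len n \<alpha> / (t ^ n * ?l \<alpha>)" for n \<alpha>
  have x_pos: "x n \<alpha> > 0" for n \<alpha> unfolding x_def using F.len_pos[of n \<alpha>] t(1) lp[of \<alpha>] by simp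
  have wm: "exp (- e n) * weight_matrix w W \<alpha> \<beta> \<le> weight_matrix (om n) W \<alpha> \<beta>"
      "weight_matrix (om n) W \<alpha> \<beta> \<le> exp (e n) * weight_matrix w W \<alpha> \<beta>" for n \<alpha> \<beta>
  proof -
    have "- e n + floor_slope w W \<sigma> \<le> floor_slope (om n) W \<sigma>"
      "floor_slope (om n) W \<sigma> \<le> e n + floor_slope w W \<sigma>" for \<sigma> using fs[of n \<sigma>] by linarith+
    then show "exp (- e n) * weight_matrix w W \<alpha> \<beta> \<le> weight_matrix (om n) W \<alpha> \<beta>"
      "weight_matrix (om n) W \<alpha> \<beta> \<le> exp (e n) * weight_matrix w W \<alpha> \<beta>"
      unfolding weight_matrix_def sum_distrib_left exp_add[symmetric]
      by (intro sum_mono; simp)+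
  qed
  have "\<exists>B. \<forall>n \<alpha>. \<bar>ln (x n \<alpha>)\<bar> \<le> B"
  proof (rule perturbed_average[where P = "\<lambda>n \<alpha> \<beta>. t * ?l \<alpha> * weight_matrix (om n) W \<alpha> \<beta> / ?l \<beta>"
        and Q = "\<lambda>\<alpha> \<beta>. t * ?l \<alpha> * weight_matrix w W \<alpha> \<beta> / ?l \<beta>" and e = e and E = E])
    show "x n \<beta> = (\<Sum>\<alpha>\<in>UNIV. x (Suc n) \<alpha> * (t * ?l \<alpha> * weight_matrix (om n) W \<alpha> \<beta> / ?l \<beta>))" for n \<beta>
    proof -
      have "x (Suc n) \<alpha> * (t * ?l \<alpha> * weight_matrix (om n) W \<alpha> \<beta> / ?l \<beta>)
          = F.len (Suc n) \<alpha> * weight_matrix (om n) W \<alpha> \<beta> / (t ^ n * ?l \<beta>)" for \<alpha>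
        unfolding x_def using t(1) lp[of \<alpha>] by (simp add: field_simps)
      then have "(\<Sum>\<alpha>\<in>UNIV. x (Suc n) \<alpha> * (t * ?l \<alpha> * weight_matrix (om n) W \<alpha> \<beta> / ?l \<beta>))
          = (\<Sum>\<alpha>\<in>UNIV. F.len (Suc n) \<alpha> * weight_matrix (om n) W \<alpha> \<beta>) / (t ^ n * ?l \<beta>)"
        by (simp add: sum_divide_distrib)
      then show ?thesis unfolding x_def F.len_rec[of n \<beta>, symmetric] by simp
    qed
    show "x n \<alpha> > 0" for n \<alpha> by (rule x_pos)
    show "exp (- e n) * (t * ?l \<alpha> * weight_matrix w W \<alpha> \<beta> / ?l \<beta>) \<le> t * ?l \<alpha> * weight_matrix (om n) W \<alpha> \<beta> / ?l \<beta>"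
      for n \<alpha> \<beta>
    proof -
      have "(t * ?l \<alpha> / ?l \<beta>) * (exp (- e n) * weight_matrix w W \<alpha> \<beta>) \<le> (t * ?l \<alpha> / ?l \<beta>) * weight_matrix (om n) W \<alpha> \<beta>"
        using t(1) lp[of \<alpha>] lp[of \<beta>] by (intro mult_left_mono[OF wm(1)]) simp
      then show ?thesis by (simp add: mult_ac)
    qed
    show "t * ?l \<alpha> * weight_matrix (om n) W \<alpha> \<beta> / ?l \<beta> \<le> exp (e n) * (t * ?l \<alpha> * weight_matrix w W \<alpha> \<beta> / ?l \<beta>)"
      for n \<alpha> \<beta>
    proof -
      have "(t * ?l \<alpha> / ?l \<beta>) * weight_matrix (om n) W \<alpha> \<beta> \<le> (t * ?l \<alpha> / ?l \<beta>) * (exp (e n) * weight_matrix w W \<alpha> \<beta>)"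
        using t(1) lp[of \<alpha>] lp[of \<beta>] by (intro mult_left_mono[OF wm(2)]) simp
      then show ?thesis by (simp add: mult_ac)
    qed
    show "t * ?l \<alpha> * weight_matrix w W \<alpha> \<beta> / ?l \<beta> > 0" for \<alpha> \<beta>
      using t(1) lp[of \<alpha>] lp[of \<beta>] weight_matrix_pos[of \<beta> W \<alpha> w] full by simp
    show "(\<Sum>\<alpha>\<in>UNIV. t * ?l \<alpha> * weight_matrix w W \<alpha> \<beta> / ?l \<beta>) = 1" for \<beta>
      unfolding sum_divide_distrib[symmetric] t(2)[of \<beta>, symmetric] using lp[of \<beta>] by simp
    show "e n \<ge> 0" for n by (rule e0)
    show "(\<Sum>j<n. e j) \<le> E" for n by (rule E)
  qed
  then obtain B where B: "\<And>n \<alpha>. \<bar>ln (x n \<alpha>)\<bar> \<le> B" by blast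
  let ?s = "path_sum (floor_slope w W)"
  have sl: "\<bar>F.slope xs - ?s xs\<bar> \<le> (\<Sum>j<n. e j)" if "xs \<in> paths W n" for n xs
    using that
  proof (induction n arbitrary: xs)
    case 0
    then show ?case by auto
  next
    case (Suc n)
    obtain \<sigma> ys where ys: "xs = \<sigma> # ys" "ys \<in> paths W n" using Suc.prems by (rule paths_SucE)
    have "F.slope xs = floor_slope (om n) W \<sigma> + F.slope ys" unfolding ys(1) by (rule F.slope_Cons[OF ys(2)])
    moreover have "?s xs = floor_slope w W \<sigma> + ?s ys" using ys paths_not_Nil[OF ys(2)] by simp
    ultimately show ?case using Suc.IH[OF ys(2)] fs[of n \<sigma>] by simp
  qed
  \<comment> \<open>The length factors in the ratios telescope, leaving only the letters at the two
    ends of the path.\<close>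
  have ps: "path_sum (\<lambda>\<sigma>. ln (G.ratio \<sigma>)) xs = ?s xs + real n * ln t + ln (?l (fst (hd xs))) - ln (?l (fst (last xs)))"
    if "xs \<in> paths W n" for n xs
    using that
  proof (induction n arbitrary: xs)
    case 0
    then show ?case by auto
  next
    case (Suc n)
    obtain \<sigma> ys where ys: "xs = \<sigma> # ys" "\<sigma> \<in> sym_index W" "ys \<in> paths W n" "sym_target W \<sigma> = fst (hd ys)"
      using Suc.prems by (rule paths_SucE)
    have "ln (G.ratio \<sigma>) = floor_slope w W \<sigma> + ln t + ln (?l (fst \<sigma>)) - ln (?l (fst (hd ys)))"
      unfolding t(3)[OF ys(2)] ys(4) using t(1) lp[of "fst \<sigma>"] lp[of "fst (hd ys)"]
      by (simp add: ln_mult ln_div)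
    then show ?case using Suc.IH[OF ys(3)] ys(1) paths_not_Nil[OF ys(3)] by (simp add: algebra_simps)
  qed
  define K where "K = (\<Sum>\<alpha>\<in>UNIV. \<bar>ln (?l \<alpha>)\<bar>)"
  have K: "\<bar>ln (?l \<alpha>)\<bar> \<le> K" for \<alpha> unfolding K_def by (rule member_le_sum) auto
  have "\<bar>ln (leb (F.cell xs)) - path_sum (\<lambda>\<sigma>. ln (G.ratio \<sigma>)) xs\<bar> \<le> E + B + K" if xs: "xs \<in> paths W n" for n xs
  proof -
    let ?a = "fst (hd xs)"
    have "F.len n ?a = x n ?a * (t ^ n * ?l ?a)" unfolding x_def using t(1) lp[of ?a] by simp
    then have "ln (F.len n ?a) = ln (x n ?a) + real n * ln t + ln (?l ?a)"
      using x_pos[of n ?a] t(1) lp[of ?a] by (simp add: ln_mult ln_realpow)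
    moreover have "ln (leb (F.cell xs)) = F.slope xs + ln (F.len n ?a)"
      using F.leb_cell[OF xs] F.len_pos[of n ?a] unfolding F.len_def by (simp add: ln_mult)
    ultimately have "ln (leb (F.cell xs)) - path_sum (\<lambda>\<sigma>. ln (G.ratio \<sigma>)) xs
        = (F.slope xs - ?s xs) + ln (x n ?a) + ln (?l (fst (last xs)))"
      unfolding ps[OF xs] by simp
    then show ?thesis using sl[OF xs] E[of n] B[of n ?a] K[of "fst (last xs)"] by linarith
  qed
  then show ?thesis by blast
qed

text \<open>Floors of height 0 have slope 0, so U grows by k under the map b sending \<alpha> to the
  first letter of its word. Some iterate of b is constant, which forces k = 0 and U constant. All
  partial sums of w along words then vanish; differences of consecutive ones kill w up to one
  letter, and orthogonality to the lengths settles that letter.\<close>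

lemma central_not_coboundary:
  fixes T :: "('a::finite) aiet"
  assumes ac: "aiet_chain T N Ls om W"
    and full: "\<And>\<alpha> \<beta>. \<beta> \<in> set (W \<alpha>)" and unit: "(\<Sum>\<alpha>\<in>UNIV. lens T $ \<alpha>) = 1"
    and lens_pos: "\<And>\<alpha>. lens T $ \<alpha> > 0" and \<rho>: "\<rho> > 0"
    and len: "\<And>n \<alpha>. renorm_chain.len (\<lambda>n. rv_state T (n * N)) n \<alpha> = exp (- (real n * \<rho>)) * lens T $ \<alpha>"
    and orth: "(\<Sum>\<alpha>\<in>UNIV. lens T $ \<alpha> * w \<alpha>) = 0" and w: "w \<alpha>\<^sub>0 \<noteq> 0"
    and cob: "\<And>\<sigma>. \<sigma> \<in> sym_index W \<Longrightarrow> floor_slope w W \<sigma> = k + U (fst \<sigma>) - U (sym_target W \<sigma>)"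
  shows False
proof -
  interpret aiet_chain T N Ls om W by (rule ac)
  have W_ne: "0 < length (W \<alpha>)" for \<alpha> using towerD(1)[OF tws] by simp
  define b where "b \<alpha> = W \<alpha> ! 0" for \<alpha>
  have U_b: "U (b \<alpha>) = k + U \<alpha>" for \<alpha>
    using cob[of "(\<alpha>, 0)"] W_ne[of \<alpha>] unfolding sym_index_def sym_target_def floor_slope_def b_def by simp
  have U_iter: "U ((b ^^ n) \<alpha>) = real n * k + U \<alpha>" for n \<alpha>
    by (induction n) (simp_all add: U_b algebra_simps)
  have nest: "fst (rv_state T (n * N)) \<alpha> \<subseteq> ivl T ((b ^^ n) \<alpha>)" for n \<alpha>
  proof (induction n arbitrary: \<alpha>)
    case 0
    then show ?case using level_0 by simp
  next
    case (Suc n)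
    have "fst (rv_state T (Suc n * N)) \<alpha> \<subseteq> fst (rv_state T (n * N)) (b \<alpha>)"
      unfolding b_def by (rule first_floor)
    also have "\<dots> \<subseteq> ivl T ((b ^^ n) (b \<alpha>))" by (rule Suc)
    finally show ?case by (simp add: funpow_swap1)
  qed
  have "(0::real) \<in> {0..<1}" by simp
  then have "0 \<in> (\<Union>\<alpha>. ivl T \<alpha>)" using exchange.J_Un[OF ex[of 0]] Ls_0 unfolding level_0 by simp
  then obtain \<beta>\<^sub>0 where \<beta>\<^sub>0: "0 \<in> ivl T \<beta>\<^sub>0" by blast
  define \<delta> where "\<delta> = left_end T \<beta>\<^sub>0 + lens T $ \<beta>\<^sub>0"
  have \<delta>: "\<delta> > 0" "left_end T \<beta>\<^sub>0 \<le> 0" using \<beta>\<^sub>0 unfolding ivl_def \<delta>_def by auto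
  have "(\<lambda>n. exp (- \<rho>) ^ n) \<longlonglongrightarrow> 0" using \<rho> by (intro LIMSEQ_power_zero) simp
  then have "(\<lambda>n. exp (- (real n * \<rho>))) \<longlonglongrightarrow> 0" by (simp add: exp_of_nat_mult[symmetric])
  then have "\<forall>\<^sub>F n in sequentially. exp (- (real n * \<rho>)) < \<delta>" using \<delta>(1) by (rule order_tendstoD(2))
  then obtain n where n: "exp (- (real n * \<rho>)) < \<delta>" using eventually_happens'[OF sequentially_bot] by blast
  have "Ls n = exp (- (real n * \<rho>))"
    unfolding Ls_eq len sum_distrib_left[symmetric] unit by simp
  then have Ls: "Ls n < \<delta>" using n by simp
  \<comment> \<open>At a deep level the whole domain is shorter than the first interval of T, so all
    its base intervals lie in that interval.\<close>
  have reach: "(b ^^ n) \<alpha> = \<beta>\<^sub>0" for \<alpha>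
  proof -
    obtain y where y: "y \<in> fst (rv_state T (n * N)) \<alpha>" using exchange.J_nonempty[OF ex[of n], of \<alpha>] by blast
    have "y \<in> {0..<Ls n}" by (rule subsetD[OF exchange.J_sub[OF ex[of n]] y])
    then have "y \<in> ivl T \<beta>\<^sub>0" using Ls \<delta> unfolding ivl_def \<delta>_def by auto
    then show ?thesis using ivl_unique subsetD[OF nest y] by blast
  qed
  have U_const: "U \<alpha> = U \<beta>\<^sub>0 - real n * k" for \<alpha> using U_iter[of n \<alpha>] unfolding reach by simp
  have k0: "k = 0" using U_b[of \<beta>\<^sub>0] U_const[of "b \<beta>\<^sub>0"] U_const[of \<beta>\<^sub>0] by simp
  have U_eq: "U \<alpha> = U \<beta>\<^sub>0" for \<alpha> using U_const[of \<alpha>] k0 by simp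
  have fs0: "floor_slope w W \<sigma> = 0" if "\<sigma> \<in> sym_index W" for \<sigma>
    using cob[OF that] k0 U_eq[of "fst \<sigma>"] U_eq[of "sym_target W \<sigma>"] by simp
  \<comment> \<open>A letter is killed by two consecutive floors; no floor follows the last position
    of the word, so this argument misses at most its letter.\<close>
  define \<gamma> where "\<gamma> = last (W \<beta>\<^sub>0)"
  have w0: "w \<beta> = 0" if "\<beta> \<noteq> \<gamma>" for \<beta>
  proof -
    obtain i where i: "i < length (W \<beta>\<^sub>0)" "W \<beta>\<^sub>0 ! i = \<beta>"
      using full[where \<alpha> = \<beta>\<^sub>0 and \<beta> = \<beta>] by (auto simp: in_set_conv_nth)
    have "i \<noteq> length (W \<beta>\<^sub>0) - 1"
      using i that W_ne[of \<beta>\<^sub>0] unfolding \<gamma>_def by (auto simp: last_conv_nth)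
    then have i': "Suc i < length (W \<beta>\<^sub>0)" using i by linarith
    have "floor_slope w W (\<beta>\<^sub>0, Suc i) = floor_slope w W (\<beta>\<^sub>0, i) + w \<beta>"
      using i by (simp add: floor_slope_def take_Suc_conv_app_nth)
    moreover have "floor_slope w W (\<beta>\<^sub>0, Suc i) = 0" "floor_slope w W (\<beta>\<^sub>0, i) = 0"
      using i i' by (intro fs0; simp add: sym_index_def)+
    ultimately show ?thesis by simp
  qed
  have "(\<Sum>\<alpha>\<in>UNIV. lens T $ \<alpha> * w \<alpha>) = (\<Sum>\<alpha>\<in>{\<gamma>}. lens T $ \<alpha> * w \<alpha>)"
    using w0 by (intro sum.mono_neutral_right) auto
  then have "w \<gamma> = 0" using orth lens_pos[of \<gamma>] by simp
  then show False using w0 w by (cases "\<alpha>\<^sub>0 = \<gamma>") auto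
qed

theorem proposition14p3:
  fixes T f f\<^sub>c :: "('a::finite) aiet"
    and N :: nat
    and \<omega> \<omega>\<^sub>c \<omega>\<^sub>s :: "real^'a"
    and h :: "real \<Rightarrow> real"
    and \<mu> :: "real measure"
  assumes "CARD('a) \<ge> 2"
    and "hyperbolically_self_similar T N"
    and "positive_matrix (sim_matrix T N)"
    and "positive_spectrum (sim_matrix T N)"
    and "central_stable_type (sim_matrix T N) (lens T) \<omega>"
    and "f \<in> Aff T \<omega>"
    and "conjugacy h f T"
    and "central_stable_decomposition (sim_matrix T N) \<omega> \<omega>\<^sub>c \<omega>\<^sub>s"
    and "f\<^sub>c \<in> Aff T \<omega>\<^sub>c"
    and "invariant_prob f \<mu>"
  shows "holder_exponent h = ereal (rho T N / zeta f\<^sub>c N) \<and>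
         0 < rho T N / zeta f\<^sub>c N \<and>
         ereal (rho T N / zeta f\<^sub>c N) < measure_dim \<mu>"
proof -
  define W where "W = words (rotation_number T) N"
  let ?M = "sim_matrix T N"
  let ?om = "\<lambda>v n. ((\<lambda>u. sum_word u W) ^^ n) (($) (v :: real^'a))"
  have card: "CARD('a) \<ge> 2" by (rule assms(1))
  have T: "is_aiet T" "on_unit_interval T" "infinitely_renormalizable T" "logslope T = 0"
    and per: "is_period (rotation_number T) N"
    using assms(2) unfolding hyperbolically_self_similar_def self_similar_def is_iet_def by blast+
  have f: "is_aiet f" "on_unit_interval f" using assms(6) unfolding Aff_def by simp_all
  have "T \<in> Aff T 0" using T unfolding Aff_def by simp
  from aff_chain[OF card this per] obtain LsT where acT: "aiet_chain T N LsT (?om 0) W"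
    unfolding W_def by blast
  from aff_chain[OF card assms(6) per] obtain Lsf where acf: "aiet_chain f N Lsf (?om \<omega>) W"
    unfolding W_def by blast
  from aff_chain[OF card assms(9) per] obtain Lsc where acc: "aiet_chain f\<^sub>c N Lsc (?om \<omega>\<^sub>c) W"
    unfolding W_def by blast
  interpret TT: aiet_chain T N LsT "?om 0" W by (rule acT)
  interpret FF: aiet_chain f N Lsf "?om \<omega>" W by (rule acf)
  interpret CC: aiet_chain f\<^sub>c N Lsc "?om \<omega>\<^sub>c" W by (rule acc)
  \<comment> \<open>Positive entries of M say that each word contains every letter.\<close>
  have full: "\<beta> \<in> set (W \<alpha>)" for \<alpha> \<beta>
  proof -
    have "letter_count W \<alpha> \<beta> > 0"
      using assms(3) unfolding positive_matrix_def TT.sim_matrix_eq by blast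
    then have "{i. i < length (W \<alpha>) \<and> W \<alpha> ! i = \<beta>} \<noteq> {}"
      unfolding letter_count_def by (metis card.empty less_irrefl of_nat_0)
    then show ?thesis by auto
  qed
  \<comment> \<open>Summing along words is the action of M on vectors, so the level-n log-slopes are
    M^n applied to the initial ones.\<close>
  have om: "?om v n = ($) (((\<lambda>u. ?M *v u) ^^ n) v)" for v n
  proof (induction n)
    case (Suc n)
    have "sum_word (($) u) W = ($) (?M *v u)" for u :: "real^'a"
      unfolding sum_word_letter_count matrix_vector_mult_def
      by (intro ext) (simp add: sum_word_letter_count TT.sim_matrix_eq)
    then show ?case using Suc by simp
  qed simp
  have om_T: "?om 0 n = (\<lambda>_. 0)" for n
  proof -
    have "((\<lambda>u. ?M *v u) ^^ n) 0 = 0" by (induction n) simp_all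
    then show ?thesis unfolding om by auto
  qed
  have dec: "\<omega> = \<omega>\<^sub>c + \<omega>\<^sub>s" "\<omega>\<^sub>c \<noteq> 0" "?M *v \<omega>\<^sub>c = \<omega>\<^sub>c"
      "\<omega>\<^sub>s \<in> span {v. \<exists>x. \<bar>x\<bar> < 1 \<and> eigenvector ?M x v}"
    using assms(8) unfolding central_stable_decomposition_def eigenvector_def by auto
  have om_c: "?om \<omega>\<^sub>c n = ($) \<omega>\<^sub>c" for n
  proof -
    have "((\<lambda>u. ?M *v u) ^^ n) \<omega>\<^sub>c = \<omega>\<^sub>c" by (induction n) (simp_all add: dec(3))
    then show ?thesis unfolding om by simp
  qed
  obtain C \<theta> where C: "0 \<le> C" "0 \<le> \<theta>" "\<theta> < 1" "\<And>n. norm (((\<lambda>u. ?M *v u) ^^ n) \<omega>\<^sub>s) \<le> C * \<theta> ^ n"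
    using contracting_decay[OF dec(4)] by blast
  have decay: "\<bar>?om \<omega> n \<alpha> - \<omega>\<^sub>c $ \<alpha>\<bar> \<le> C * \<theta> ^ n" for n \<alpha>
  proof -
    have "((\<lambda>u. ?M *v u) ^^ n) \<omega> = \<omega>\<^sub>c + ((\<lambda>u. ?M *v u) ^^ n) \<omega>\<^sub>s"
      unfolding dec(1) by (induction n) (simp_all add: matrix_vector_right_distrib dec(3))
    then have "?om \<omega> n \<alpha> - \<omega>\<^sub>c $ \<alpha> = ((\<lambda>u. ?M *v u) ^^ n) \<omega>\<^sub>s $ \<alpha>" unfolding om by simp
    then show ?thesis using component_le_norm_cart[of "((\<lambda>u. ?M *v u) ^^ n) \<omega>\<^sub>s" \<alpha>] C(4)[of n] by simp
  qed
  have lens_pos: "lens T $ \<alpha> > 0" for \<alpha> using T(1) unfolding is_aiet_def by blast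
  have unit: "(\<Sum>\<alpha>\<in>UNIV. lens T $ \<alpha>) = 1" using T(2) unfolding on_unit_interval_def .
  obtain \<rho> where \<rho>: "\<rho> > 0" "rho T N = \<rho>"
    "\<And>n \<alpha>. TT.len n \<alpha> = exp (- (real n * \<rho>)) * lens T $ \<alpha>"
    "\<And>\<beta>. (\<Sum>\<alpha>\<in>UNIV. lens T $ \<alpha> * letter_count W \<alpha> \<beta>) = exp \<rho> * lens T $ \<beta>"
    using iet_spectrum[OF card acT om_T full unit lens_pos] by blast
  note \<mu> = invariant_probD[OF assms(10) f(2)]
  interpret \<mu>: prob_space \<mu> by (rule \<mu>(1))
  have h: "h x = measure \<mu> {0..<x}" if "x \<in> {0..1}" for x
  proof (rule conjugacy_cdf[OF T(1,2) f assms(7,10) _ that])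
    fix \<nu> :: "real measure" and y :: real
    assume \<nu>: "finite_measure \<nu>" "sets \<nu> = sets borel" "measure \<nu> {0..<1} = 1"
      and inv: "\<And>\<alpha> A. A \<in> sets borel \<Longrightarrow> A \<subseteq> ivl T \<alpha> \<Longrightarrow> measure \<nu> (amap T ` A) = measure \<nu> A"
      and y: "0 \<le> y" "y < 1"
    show "measure \<nu> {0..<y} = y"
      by (rule iet_uniquely_ergodic[OF acT om_T \<nu> _ full unit lens_pos \<rho>(1,3,4) y]) (rule inv; assumption)
  qed
  have mass: "measure \<mu> (FF.cell xs) = exp (- (real n * \<rho>)) * lens T $ (fst (hd xs))" if "xs \<in> paths W n" for n xs
  proof -
    have "measure \<mu> (FF.cell xs) = measure \<mu> (fst (rv_state f (n * N)) (fst (hd xs)))"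
      by (rule FF.measure_cell[OF _ that])
        (simp only: FF.level_0 fst_conv snd_conv invariant_measure_image(1)[OF assms(10) f])
    also have "\<dots> = exp (- (real n * \<rho>)) * lens T $ (fst (hd xs))"
      by (rule level_mass[OF acf \<mu>.finite_measure_axioms \<mu>(2,3) _ full lens_pos unit \<rho>(4)])
        (rule invariant_measure_image(1)[OF assms(10) f]; assumption)
    finally show ?thesis .
  qed
  obtain t where t: "t > 0"
    "\<And>\<sigma>. \<sigma> \<in> sym_index W \<Longrightarrow> CC.ratio \<sigma> = exp (floor_slope (($) \<omega>\<^sub>c) W \<sigma>) * t * lens f\<^sub>c $ (fst \<sigma>) / lens f\<^sub>c $ (sym_target W \<sigma>)"
    "\<And>\<sigma>. \<sigma> \<in> sym_index W \<Longrightarrow> 0 < CC.ratio \<sigma> \<and> CC.ratio \<sigma> < 1"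
    using central_chain_scaling[OF acc om_c full card] by blast
  obtain D where D: "\<And>n xs. xs \<in> paths W n \<Longrightarrow>
      \<bar>ln (leb (FF.cell xs)) - path_sum (\<lambda>\<sigma>. ln (CC.ratio \<sigma>)) xs\<bar> \<le> D"
    using size_comparison[OF acf acc om_c full card decay C(1-3)] by blast
  interpret K: coded_measure W FF.cell \<mu> CC.ratio "\<lambda>\<alpha>. lens T $ \<alpha>" \<rho> D
  proof (rule coded_measure.intro)
    show "\<beta> \<in> set (W \<alpha>)" for \<alpha> \<beta> by (rule full)
    show "\<exists>u v. 0 \<le> u \<and> u < v \<and> v \<le> 1 \<and> FF.cell xs = {u..<v}" if "xs \<in> paths W n" for xs n
      by (rule FF.cell_ivl[OF that])
    show "(\<Union>xs\<in>paths W n. FF.cell xs) = {0..<1}" for n by (rule FF.cell_cover)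
    show "FF.cell xs \<inter> FF.cell ys = {}" if "xs \<in> paths W n" "ys \<in> paths W n" "xs \<noteq> ys" for xs ys n
      by (rule FF.cell_disj[OF that])
    show "0 < CC.ratio \<sigma> \<and> CC.ratio \<sigma> < 1" if "\<sigma> \<in> sym_index W" for \<sigma> by (rule t(3)[OF that])
    show "\<bar>ln (leb (FF.cell xs)) - path_sum (\<lambda>\<sigma>. ln (CC.ratio \<sigma>)) xs\<bar> \<le> D" if "xs \<in> paths W n" for xs n
      by (rule D[OF that])
    show "measure \<mu> (FF.cell xs) = exp (- (real n * \<rho>)) * lens T $ (fst (hd xs))" if "xs \<in> paths W n" for xs n
      by (rule mass[OF that])
    show "(\<Sum>\<sigma> | \<sigma> \<in> sym_index W \<and> sym_target W \<sigma> = \<beta>. lens T $ (fst \<sigma>)) = exp \<rho> * lens T $ \<beta>" for \<beta>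
      unfolding sum_succs_letters[where F = "\<lambda>\<alpha>. lens T $ \<alpha>"] by (rule \<rho>(4))
  qed (fact \<mu> lens_pos \<rho>(1))+
  have zeta: "zeta f\<^sub>c N = K.\<zeta>"
    unfolding zeta_def K.\<zeta>_def K.Z_def CC.zeta_n_eq by (simp add: K.\<phi>_def[abs_def])
  \<comment> \<open>Pairing the fixed vector with the left eigenvector multiplies the pairing by exp
    \<rho>, which differs from 1.\<close>
  have orth: "(\<Sum>\<alpha>\<in>UNIV. lens T $ \<alpha> * \<omega>\<^sub>c $ \<alpha>) = 0"
  proof -
    let ?s = "\<Sum>\<alpha>\<in>UNIV. lens T $ \<alpha> * \<omega>\<^sub>c $ \<alpha>"
    have w: "\<omega>\<^sub>c $ \<alpha> = (\<Sum>\<beta>\<in>UNIV. letter_count W \<alpha> \<beta> * \<omega>\<^sub>c $ \<beta>)" for \<alpha>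
      using arg_cong[OF dec(3), of "\<lambda>v. v $ \<alpha>"] by (simp add: matrix_vector_mult_def TT.sim_matrix_eq)
    have "?s = (\<Sum>\<alpha>\<in>UNIV. lens T $ \<alpha> * (\<Sum>\<beta>\<in>UNIV. letter_count W \<alpha> \<beta> * \<omega>\<^sub>c $ \<beta>))"
      by (intro sum.cong refl arg_cong[where f = "(*) _"] w)
    also have "\<dots> = (\<Sum>\<alpha>\<in>UNIV. \<Sum>\<beta>\<in>UNIV. lens T $ \<alpha> * letter_count W \<alpha> \<beta> * \<omega>\<^sub>c $ \<beta>)"
      unfolding sum_distrib_left by (simp add: mult.assoc)
    also have "\<dots> = (\<Sum>\<beta>\<in>UNIV. \<Sum>\<alpha>\<in>UNIV. lens T $ \<alpha> * letter_count W \<alpha> \<beta> * \<omega>\<^sub>c $ \<beta>)" by (rule sum.swap)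
    also have "\<dots> = (\<Sum>\<beta>\<in>UNIV. exp \<rho> * lens T $ \<beta> * \<omega>\<^sub>c $ \<beta>)"
      unfolding sum_distrib_right[symmetric] \<rho>(4) ..
    also have "\<dots> = exp \<rho> * ?s" unfolding sum_distrib_left by (simp add: mult.assoc)
    finally have "(exp \<rho> - 1) * ?s = 0" by (simp add: algebra_simps)
    then show ?thesis using \<rho>(1) by simp
  qed
  obtain \<alpha>\<^sub>0 where \<alpha>\<^sub>0: "\<omega>\<^sub>c $ \<alpha>\<^sub>0 \<noteq> 0" using dec(2) by (auto simp: vec_eq_iff)
  have lc: "lens f\<^sub>c $ \<alpha> > 0" for \<alpha> using CC.len_pos[of 0 \<alpha>] unfolding CC.len_0 .
  have noncob: "\<not> (\<exists>V k. \<forall>\<sigma>\<in>sym_index W. ln (CC.ratio \<sigma>) = k + V (fst \<sigma>) - V (sym_target W \<sigma>))"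
  proof
    assume "\<exists>V k. \<forall>\<sigma>\<in>sym_index W. ln (CC.ratio \<sigma>) = k + V (fst \<sigma>) - V (sym_target W \<sigma>)"
    then obtain V k where V: "\<And>\<sigma>. \<sigma> \<in> sym_index W \<Longrightarrow> ln (CC.ratio \<sigma>) = k + V (fst \<sigma>) - V (sym_target W \<sigma>)"
      by blast
    \<comment> \<open>Up to ln t, the logarithm of a ratio is the slope plus a coboundary of
      log-lengths; subtracting the latter leaves an equation for the slopes alone.\<close>
    define U where "U \<alpha> = V \<alpha> - ln (lens f\<^sub>c $ \<alpha>)" for \<alpha>
    have cob: "floor_slope (($) \<omega>\<^sub>c) W \<sigma> = (k - ln t) + U (fst \<sigma>) - U (sym_target W \<sigma>)"
      if "\<sigma> \<in> sym_index W" for \<sigma>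
      using V[OF that] t(1) lc[of "fst \<sigma>"] lc[of "sym_target W \<sigma>"]
      unfolding t(2)[OF that] U_def by (simp add: ln_mult ln_div)
    show False
      by (rule central_not_coboundary[OF acT full unit lens_pos \<rho>(1,3) orth \<alpha>\<^sub>0 cob])
  qed
  show ?thesis
    unfolding zeta \<rho>(2)
    using K.holder_exponent_coded[OF h] K.measure_dim_coded[OF noncob] K.\<zeta>_pos \<rho>(1) by simp
qed

end
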